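(* $$R(3,3,k) = \Theta\bigg( \frac{k^3}{(\log k)^2} \bigg)$$ as $k \to \infty$; that is, there exist constants $C > c > 0$ such that $\frac{c k^3}{(\log k)^2} \le R(3,3,k) \le \frac{C k^3}{(\log k)^2}$ for all sufficiently large $k \in \mathbb{N}$.
   Context: $R(3,3,k)$ is the smallest $n \in \mathbb{N}$ such that every red-blue-green colouring of the edges of the complete graph $K_n$ contains either a red triangle, a green triangle, or a blue copy of $K_k$. *)

theory Defs
  imports Complex_Main "HOL-Library.Ramsey"
begin

text \<open>
  The multicolour Ramsey number of graphs. The edges of \<open>K_n\<close> are the two-element subsets of
  \<open>{..<n}\<close>. A colouring is a map from them to the colours \<open>{..<length qs}\<close>, and the \<open>i\<close>th entry
  of \<open>qs\<close> is the order of the clique sought in colour \<open>i\<close>. So \<open>ramsey_number [3, 3, k]\<close> is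
  \<open>R(3,3,k)\<close>, with colour 0 for red, 1 for green and 2 for blue.
\<close>

definition ramsey_number :: "nat list \<Rightarrow> nat" where
  "ramsey_number qs = (LEAST n. partn_lst {..<n} qs 2)"

text \<open>The set of such \<open>n\<close> is nonempty, so the least element is meaningful.\<close>

lemma partn_lst_ramsey_number: "partn_lst {..<ramsey_number qs} qs 2"
  unfolding ramsey_number_def using ramsey_full by (rule LeastI_ex)

end

theory Submission
  imports Defs "HOL-Library.Disjoint_Sets" "HOL-Real_Asymp.Real_Asymp"
begin

text \<open>Lower bound. Put \<open>k^3 / (ln k)^2\<close> vertices at random into \<open>N\<close> cells that carry a random graph of
  density \<open>1 / q\<close>, where \<open>q\<close> is about \<open>k / ln k\<close> and \<open>N\<close> about \<open>q^2\<close>, made triangle-free by deleting a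
  maximal family of edge-disjoint triangles. Take two such copies, and keep an edge of one copy unless
  its ends have a common neighbour in the other copy. Two edges of a triangle come
  from the same copy and close the third pair there, so the resulting graph is triangle-free; a set of
  size \<open>k\<close> is independent in it with probability at most \<open>O(1 / q)^k\<close>. Use two independent graphs of this
  kind as red and green: then a blue clique of size \<open>k\<close> has probability at most \<open>O(1 / q^2)^k\<close>, and the union bound
  over the \<open>k\<close>-sets suffices.

  Upper bound. If no \<open>k\<close>-set is blue, then the green graph inside a red neighbourhood is triangle-free of degree
  less than \<open>k\<close>, so Alon's bound on independent sets makes red and green degrees \<open>O(k^2 / ln k)\<close>, and
  the union of the two graphs has few triangles. A random sparse subset has, after deletions, no triangles, and Alon's
  bound applied to it gives a blue clique.\<close>

section \<open>Uniform probability on finite sets\<close>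

text \<open>The bound O(1 / q)^k for one graph is sharp: with probability about q^(-k) all of a
  k-set falls into the neighbourhood of one cell of the first copy, where the first copy has no edge
  and closes every edge of the second. The estimates show that nothing is much likelier. Two colours
  then give q^(-2k) against about (n / k)^k sets, so n is a small multiple of k q^2. N is tied to
  q^2 from both sides: if larger, each arc lies in too many triangles and deletion costs too much;
  if smaller, O(q) cells are no longer an O(1 / q) fraction of all. The value of q reflects the
  price of an occupied cell: k^4 in the union bounds, against exp (- c k / q) from the order of k
  edges missing at that cell. The obstacle is that cells hold order k vertices, so a set may
  collapse onto few cells, where the labels have little randomness left; collapsed and concentrated
  sets are therefore charged to the positions instead. In the upper bound the sample costs only a
  constant factor: size and degree shrink by the same factor, and the degree stays a power of k, so
  the logarithm survives.\<close>

definition pr :: "'a set \<Rightarrow> ('a \<Rightarrow> bool) \<Rightarrow> real" where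
  "pr \<Omega> P = real (card {\<omega>\<in>\<Omega>. P \<omega>}) / real (card \<Omega>)"

lemma pr_nonneg: "0 \<le> pr \<Omega> P"
  by (simp add: pr_def)

lemma pr_le_1: "finite \<Omega> \<Longrightarrow> pr \<Omega> P \<le> 1"
proof -
  assume "finite \<Omega>"
  then have "card {\<omega>\<in>\<Omega>. P \<omega>} \<le> card \<Omega>" by (intro card_mono) auto
  then show ?thesis by (simp add: pr_def divide_le_eq)
qed

lemma pr_mono:
  assumes "finite \<Omega>" "\<And>\<omega>. \<omega> \<in> \<Omega> \<Longrightarrow> P \<omega> \<Longrightarrow> Q \<omega>"
  shows "pr \<Omega> P \<le> pr \<Omega> Q"
  unfolding pr_def using assms by (intro divide_right_mono of_nat_mono card_mono) auto

lemma pr_False [simp]: "pr \<Omega> (\<lambda>_. False) = 0"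
  by (simp add: pr_def)

lemma pr_disj:
  assumes "finite \<Omega>" shows "pr \<Omega> (\<lambda>\<omega>. P \<omega> \<or> Q \<omega>) \<le> pr \<Omega> P + pr \<Omega> Q"
proof -
  have "{\<omega>\<in>\<Omega>. P \<omega> \<or> Q \<omega>} = {\<omega>\<in>\<Omega>. P \<omega>} \<union> {\<omega>\<in>\<Omega>. Q \<omega>}" by auto
  then have "card {\<omega>\<in>\<Omega>. P \<omega> \<or> Q \<omega>} \<le> card {\<omega>\<in>\<Omega>. P \<omega>} + card {\<omega>\<in>\<Omega>. Q \<omega>}"
    by (simp add: card_Un_le)
  then show ?thesis
    unfolding pr_def add_divide_distrib[symmetric]
    by (intro divide_right_mono) (auto simp del: of_nat_add simp add: of_nat_add[symmetric])
qed

lemma pr_Ex: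
  assumes "finite \<Omega>" "finite I"
  shows "pr \<Omega> (\<lambda>\<omega>. \<exists>i\<in>I. P i \<omega>) \<le> (\<Sum>i\<in>I. pr \<Omega> (P i))"
  using assms(2)
proof (induction I rule: finite_induct)
  case (insert i I)
  have "pr \<Omega> (\<lambda>\<omega>. \<exists>j\<in>insert i I. P j \<omega>) = pr \<Omega> (\<lambda>\<omega>. P i \<omega> \<or> (\<exists>j\<in>I. P j \<omega>))"
    by (simp add: pr_def)
  also have "\<dots> \<le> pr \<Omega> (P i) + pr \<Omega> (\<lambda>\<omega>. \<exists>j\<in>I. P j \<omega>)"
    by (rule pr_disj[OF assms(1)])
  finally show ?case using insert by simp
qed simp

lemma pr_Ex_le:
  fixes \<beta> :: real
  assumes "finite \<Omega>" "finite I" "\<And>i. i \<in> I \<Longrightarrow> pr \<Omega> (P i) \<le> \<beta>"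
  shows "pr \<Omega> (\<lambda>\<omega>. \<exists>i\<in>I. P i \<omega>) \<le> card I * \<beta>"
proof -
  have "(\<Sum>i\<in>I. pr \<Omega> (P i)) \<le> card I * \<beta>" using assms(3) by (rule sum_bounded_above)
  then show ?thesis using pr_Ex[OF assms(1,2), of P] by linarith
qed

lemma pr_sum: "finite \<Omega> \<Longrightarrow> pr \<Omega> P = (\<Sum>\<omega>\<in>\<Omega>. of_bool (P \<omega>)) / card \<Omega>"
  unfolding pr_def by (simp add: of_bool_def sum.If_cases Int_def)

lemma pr_markov:
  assumes "finite \<Omega>" "\<And>\<omega>. \<omega> \<in> \<Omega> \<Longrightarrow> 0 \<le> F \<omega>" "\<And>\<omega>. \<omega> \<in> \<Omega> \<Longrightarrow> P \<omega> \<Longrightarrow> 1 \<le> F \<omega>"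
  shows "pr \<Omega> P \<le> (\<Sum>\<omega>\<in>\<Omega>. F \<omega>) / card \<Omega>"
  unfolding pr_sum[OF assms(1)] using assms(2,3)
  by (intro divide_right_mono sum_mono) (auto simp: of_bool_def)

lemma pr_bij: "bij_betw h \<Omega> \<Omega>' \<Longrightarrow> pr \<Omega>' P = pr \<Omega> (\<lambda>x. P (h x))"
proof -
  assume b: "bij_betw h \<Omega> \<Omega>'"
  have "bij_betw h {x\<in>\<Omega>. P (h x)} {y\<in>\<Omega>'. P y}"
    using b by (auto simp: bij_betw_def inj_on_def)
  then show ?thesis using b bij_betw_same_card unfolding pr_def by metis
qed

lemma pr_prod_eq:
  assumes "finite A" "finite B"
  shows "pr (A \<times> B) P = (\<Sum>a\<in>A. pr B (\<lambda>b. P (a, b))) / card A"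
proof -
  have "(\<Sum>\<omega>\<in>A \<times> B. of_bool (P \<omega>)) = (\<Sum>a\<in>A. \<Sum>b\<in>B. of_bool (P (a,b)) :: real)"
    using assms by (subst sum.cartesian_product) (auto intro!: sum.cong simp del: sum_of_bool_eq)
  then show ?thesis using assms
    by (simp only: pr_sum finite_cartesian_product card_cartesian_product sum_divide_distrib[symmetric]
        of_nat_mult divide_divide_eq_left mult.commute)
qed

text \<open>Conditioning on the first coordinate: the event forces \<open>Q a\<close>, and for each
  such \<open>a\<close> the second coordinate contributes at most \<beta>.\<close>

lemma pr_prod_le:
  fixes \<beta> :: real
  assumes "finite A" "finite B" "0 \<le> \<beta>"
    and P: "\<And>a b. a \<in> A \<Longrightarrow> b \<in> B \<Longrightarrow> P (a,b) \<Longrightarrow> Q a"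
    and le: "\<And>a. a \<in> A \<Longrightarrow> Q a \<Longrightarrow> pr B (\<lambda>b. P (a, b)) \<le> \<beta>"
  shows "pr (A \<times> B) P \<le> pr A Q * \<beta>"
proof -
  have "pr B (\<lambda>b. P (a, b)) \<le> of_bool (Q a) * \<beta>" if "a \<in> A" for a
  proof (cases "Q a")
    case False
    then have "pr B (\<lambda>b. P (a, b)) \<le> pr B (\<lambda>_. False)"
      using P that by (intro pr_mono assms) auto
    then show ?thesis using False by simp
  qed (use le that in auto)
  then have "(\<Sum>a\<in>A. pr B (\<lambda>b. P (a, b))) \<le> (\<Sum>a\<in>A. of_bool (Q a)) * \<beta>"
    by (simp add: sum_distrib_right sum_mono)
  then show ?thesis
    unfolding pr_prod_eq[OF assms(1,2)] pr_sum[OF assms(1)]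
    by (metis divide_right_mono of_nat_0_le_iff times_divide_eq_left)
qed

lemma pr_prod_swap: "pr (A \<times> B) P = pr (B \<times> A) (\<lambda>(b, a). P (a, b))"
proof -
  have b: "bij_betw (\<lambda>(b,a). (a,b)) (B \<times> A) (A \<times> B)"
    by (auto simp: bij_betw_def inj_on_def)
  show ?thesis unfolding pr_bij[OF b] by (simp add: case_prod_unfold)
qed

lemma pr_prod_indep:
  assumes "finite A" "finite B"
  shows "pr (A \<times> B) (\<lambda>(a,b). P a \<and> Q b) \<le> pr A P * pr B Q"
  by (rule pr_prod_le) (use assms in \<open>auto intro: pr_nonneg pr_mono\<close>)

section \<open>Functions with independent coordinates: splitting, conditioning, exponential
  moments\<close>

definition mrg :: "'a set \<Rightarrow> ('a \<Rightarrow> 'b) \<Rightarrow> ('a \<Rightarrow> 'b) \<Rightarrow> 'a \<Rightarrow> 'b" where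
  "mrg I g h = (\<lambda>x. if x \<in> I then g x else h x)"

lemma bij_betw_mrg:
  assumes "I \<inter> J = {}"
  shows "bij_betw (\<lambda>(g,h). mrg I g h) ((I \<rightarrow>\<^sub>E C) \<times> (J \<rightarrow>\<^sub>E C)) ((I \<union> J) \<rightarrow>\<^sub>E C)"
proof (rule bij_betw_byWitness[where f' = "\<lambda>f. (restrict f I, restrict f J)"])
  show "\<forall>a\<in>(I \<rightarrow>\<^sub>E C) \<times> (J \<rightarrow>\<^sub>E C).
     (restrict (case a of (g, h) \<Rightarrow> mrg I g h) I, restrict (case a of (g, h) \<Rightarrow> mrg I g h) J) = a"
  proof
    fix a assume "a \<in> (I \<rightarrow>\<^sub>E C) \<times> (J \<rightarrow>\<^sub>E C)"
    then obtain g h where a: "a = (g, h)" and gh: "g \<in> I \<rightarrow>\<^sub>E C" "h \<in> J \<rightarrow>\<^sub>E C" by auto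
    have "restrict (mrg I g h) I = g"
      using gh by (auto simp: mrg_def fun_eq_iff PiE_def extensional_def)
    moreover have "restrict (mrg I g h) J = h"
      using gh assms by (auto simp: mrg_def fun_eq_iff PiE_def extensional_def)
    ultimately show "(restrict (case a of (g, h) \<Rightarrow> mrg I g h) I,
        restrict (case a of (g, h) \<Rightarrow> mrg I g h) J) = a" by (simp add: a)
  qed
  show "\<forall>f\<in>(I \<union> J) \<rightarrow>\<^sub>E C. (case (restrict f I, restrict f J) of (g, h) \<Rightarrow> mrg I g h) = f"
    by (auto simp: mrg_def fun_eq_iff PiE_def extensional_def)
qed (auto simp: mrg_def PiE_def extensional_def)

lemma pr_PiE_split:
  assumes "I \<inter> J = {}"
  shows "pr ((I \<union> J) \<rightarrow>\<^sub>E C) P = pr ((I \<rightarrow>\<^sub>E C) \<times> (J \<rightarrow>\<^sub>E C)) (\<lambda>(g,h). P (mrg I g h))"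
  unfolding pr_bij[OF bij_betw_mrg[OF assms]] by (simp add: case_prod_unfold)

text \<open>A bound valid for every fixing of the coordinates in \<open>I\<close> survives averaging
  over them. This is how labels or positions already exposed are frozen.\<close>

lemma pr_PiE_cond:
  fixes \<beta> :: real
  assumes "I \<inter> J = {}" "finite I" "finite J" "finite C" "0 \<le> \<beta>"
    and "\<And>g. g \<in> I \<rightarrow>\<^sub>E C \<Longrightarrow> pr (J \<rightarrow>\<^sub>E C) (\<lambda>h. P (mrg I g h)) \<le> \<beta>"
  shows "pr ((I \<union> J) \<rightarrow>\<^sub>E C) P \<le> \<beta>"
proof -
  have "pr ((I \<rightarrow>\<^sub>E C) \<times> (J \<rightarrow>\<^sub>E C)) (\<lambda>(g,h). P (mrg I g h)) \<le> pr (I \<rightarrow>\<^sub>E C) (\<lambda>_. True) * \<beta>"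
    using assms by (intro pr_prod_le) (auto intro: finite_PiE)
  also have "\<dots> \<le> 1 * \<beta>"
    using assms by (intro mult_right_mono pr_le_1 finite_PiE) auto
  finally show ?thesis unfolding pr_PiE_split[OF assms(1)] by simp
qed

lemma pr_PiE_prod:
  assumes "finite I" "finite C" "C \<noteq> {}"
  shows "pr (I \<rightarrow>\<^sub>E C) (\<lambda>g. \<forall>v\<in>I. g v \<in> B v) = (\<Prod>v\<in>I. card (B v \<inter> C) / card C)"
proof -
  have "{g \<in> I \<rightarrow>\<^sub>E C. \<forall>v\<in>I. g v \<in> B v} = (\<Pi>\<^sub>E v\<in>I. B v \<inter> C)"
    by (auto simp: PiE_def Pi_def)
  then show ?thesis
    using assms by (simp add: pr_def card_PiE prod_dividef)
qed

text \<open>The admissible values at the coordinates in \<open>J\<close> may depend on the other coordinates.\<close>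

lemma pr_PiE_dep:
  fixes \<beta> :: real
  assumes fin: "finite I" "finite C" "C \<noteq> {}" and J: "J \<subseteq> I" and \<beta>: "0 \<le> \<beta>"
    and card: "\<And>g v. g \<in> I \<rightarrow>\<^sub>E C \<Longrightarrow> v \<in> J \<Longrightarrow> card (B g v \<inter> C) \<le> \<beta> * card C"
    and dep: "\<And>g g' v. (\<And>i. i \<in> I - J \<Longrightarrow> g i = g' i) \<Longrightarrow> v \<in> J \<Longrightarrow> B g v = B g' v"
  shows "pr (I \<rightarrow>\<^sub>E C) (\<lambda>g. \<forall>v\<in>J. g v \<in> B g v) \<le> \<beta> ^ card J"
proof -
  have fJ: "finite J" using J fin(1) finite_subset by blast
  have I: "I = (I - J) \<union> J" using J by auto
  have "pr (((I - J) \<union> J) \<rightarrow>\<^sub>E C) (\<lambda>g. \<forall>v\<in>J. g v \<in> B g v) \<le> \<beta> ^ card J"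
  proof (rule pr_PiE_cond)
    fix g assume g: "g \<in> (I - J) \<rightarrow>\<^sub>E C"
    obtain c where c: "c \<in> C" using fin by auto
    \<comment> \<open>\<open>h0\<close> is a reference extension of \<open>g\<close>, with the
      arbitrary value \<open>c\<close> on \<open>J\<close>. By \<open>dep\<close>, its admissible
      sets are those of every extension of \<open>g\<close>, so they can be treated as
      constant.\<close>
    define h0 where "h0 = mrg (I - J) g (\<lambda>x. if x \<in> J then c else undefined)"
    have h0: "h0 \<in> I \<rightarrow>\<^sub>E C"
      using g c J by (auto simp: h0_def mrg_def PiE_def extensional_def)
    have "pr (J \<rightarrow>\<^sub>E C) (\<lambda>h. \<forall>v\<in>J. mrg (I - J) g h v \<in> B (mrg (I - J) g h) v)
        = pr (J \<rightarrow>\<^sub>E C) (\<lambda>h. \<forall>v\<in>J. h v \<in> B h0 v)"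
    proof -
      have "B (mrg (I - J) g h) v = B h0 v" if "v \<in> J" for h v
        using that by (intro dep) (auto simp: h0_def mrg_def)
      then have "(\<forall>v\<in>J. mrg (I - J) g h v \<in> B (mrg (I - J) g h) v) \<longleftrightarrow> (\<forall>v\<in>J. h v \<in> B h0 v)" for h
        by (auto simp: mrg_def)
      then show ?thesis by presburger
    qed
    also have "\<dots> = (\<Prod>v\<in>J. card (B h0 v \<inter> C) / card C)"
      by (rule pr_PiE_prod) (use fin fJ in auto)
    also have "\<dots> \<le> (\<Prod>v\<in>J. \<beta>)"
    proof (rule prod_mono)
      fix v assume v: "v \<in> J"
      have "card C > 0" using fin by (simp add: card_gt_0_iff)
      then show "0 \<le> card (B h0 v \<inter> C) / card C \<and> card (B h0 v \<inter> C) / card C \<le> \<beta>"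
        using card[OF h0 v] by (simp add: divide_le_eq)
    qed
    finally show "pr (J \<rightarrow>\<^sub>E C) (\<lambda>h. \<forall>v\<in>J. mrg (I - J) g h v \<in> B (mrg (I - J) g h) v) \<le> \<beta> ^ card J"
      by simp
  qed (use fin fJ \<beta> in auto)
  then show ?thesis using I by simp
qed

lemma pr_PiE_all:
  fixes \<beta> :: real
  assumes "finite I" "finite C" "C \<noteq> {}" "J \<subseteq> I" "\<And>v. v \<in> J \<Longrightarrow> card (B v \<inter> C) \<le> \<beta> * card C" "0 \<le> \<beta>"
  shows "pr (I \<rightarrow>\<^sub>E C) (\<lambda>g. \<forall>v\<in>J. g v \<in> B v) \<le> \<beta> ^ card J"
  by (rule pr_PiE_dep) (use assms in auto)

lemma pr_PiE_zero:
  assumes "finite I" "U \<subseteq> I" "0 < (q::nat)"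
  shows "pr (I \<rightarrow>\<^sub>E {..<q}) (\<lambda>f. \<forall>e\<in>U. f e = 0) \<le> (1 / q) ^ card U"
proof -
  have "pr (I \<rightarrow>\<^sub>E {..<q}) (\<lambda>f. \<forall>e\<in>U. f e \<in> {0}) \<le> (1 / q) ^ card U"
    by (rule pr_PiE_all) (use assms in auto)
  then show ?thesis by simp
qed

text \<open>Chernoff's method: Markov's inequality for the exponential of the sum. Its mean
  factorises over the independent labels, with factors \<open>1 + (exp (c e) - 1) / q\<close>, and
  \<open>1 + x \<le> exp x\<close>. Negative weights are allowed and yield lower tails.\<close>

lemma pr_weighted:
  assumes "finite I" "0 < (q::nat)"
  shows "pr (I \<rightarrow>\<^sub>E {..<q}) (\<lambda>f. x \<le> (\<Sum>e\<in>I. if f e = 0 then c e else 0))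
     \<le> exp (- x + (\<Sum>e\<in>I. exp (c e) - 1) / q)"
proof -
  let ?F = "\<lambda>f. exp (- x) * (\<Prod>e\<in>I. if f e = (0::nat) then exp (c e) else 1)"
  have F: "?F f = exp (- x + (\<Sum>e\<in>I. if f e = 0 then c e else 0))" for f
  proof -
    have "(\<Prod>e\<in>I. if f e = (0::nat) then exp (c e) else 1) = (\<Prod>e\<in>I. exp (if f e = 0 then c e else 0))"
      by (intro prod.cong) auto
    then show ?thesis by (simp add: exp_sum[OF assms(1)] exp_diff exp_minus field_simps)
  qed
  have "pr (I \<rightarrow>\<^sub>E {..<q}) (\<lambda>f. x \<le> (\<Sum>e\<in>I. if f e = 0 then c e else 0))
      \<le> (\<Sum>f\<in>I \<rightarrow>\<^sub>E {..<q}. ?F f) / card (I \<rightarrow>\<^sub>E {..<q})"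
    unfolding F using assms by (intro pr_markov finite_PiE) auto
  also have "(\<Sum>f\<in>I \<rightarrow>\<^sub>E {..<q}. ?F f)
      = exp (- x) * (\<Prod>e\<in>I. \<Sum>y\<in>{..<q}. if y = 0 then exp (c e) else 1)"
    using assms by (subst prod_sum_PiE) (auto simp: sum_distrib_left)
  also have "(\<lambda>e. \<Sum>y\<in>{..<q}. if y = 0 then exp (c e) else 1) = (\<lambda>e. q + (exp (c e) - 1))"
  proof
    fix e
    have "(\<Sum>y\<in>{..<q}. if y = 0 then exp (c e) else 1)
       = exp (c e) + (\<Sum>y\<in>{..<q} - {0}. if y = 0 then exp (c e) else 1)"
      using assms by (subst sum.remove[of _ 0]) auto
    also have "(\<Sum>y\<in>{..<q} - {0}. if y = 0 then exp (c e) else 1) = (\<Sum>y\<in>{..<q} - {0}. 1)"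
      by (intro sum.cong) auto
    finally show "(\<Sum>y\<in>{..<q}. if y = 0 then exp (c e) else 1) = q + (exp (c e) - 1)"
      using assms by (simp add: of_nat_diff)
  qed
  also have "exp (- x) * (\<Prod>e\<in>I. q + (exp (c e) - 1)) / card (I \<rightarrow>\<^sub>E {..<q})
      = exp (- x) * (\<Prod>e\<in>I. 1 + (exp (c e) - 1) / q)"
  proof -
    have "(\<Prod>e\<in>I. 1 + (exp (c e) - 1) / q) = (\<Prod>e\<in>I. (q + (exp (c e) - 1)) / q)"
      using assms by (intro prod.cong) (auto simp: field_simps)
    then show ?thesis using assms by (simp add: prod_dividef card_PiE)
  qed
  also have "\<dots> \<le> exp (- x) * (\<Prod>e\<in>I. exp ((exp (c e) - 1) / q))"
  proof (intro mult_left_mono prod_mono)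
    fix e
    have "(exp (c e) - 1) / q \<ge> -1"
    proof -
      have "(exp (c e) - 1) / q \<ge> - 1 / q" using assms by (intro divide_right_mono) auto
      moreover have "- 1 / real q \<ge> -1" using assms by (simp add: field_simps)
      ultimately show ?thesis by linarith
    qed
    then show "0 \<le> 1 + (exp (c e) - 1) / q \<and> 1 + (exp (c e) - 1) / q \<le> exp ((exp (c e) - 1) / q)"
      by (auto intro: exp_ge_add_one_self)
  qed auto
  also have "\<dots> = exp (- x + (\<Sum>e\<in>I. exp (c e) - 1) / q)"
    using assms by (simp add: exp_sum[symmetric] exp_add[symmetric] sum_divide_distrib)
  finally show ?thesis .
qed

section \<open>Binomial estimates\<close>

lemma choose_le_power: "real (n choose m) \<le> real n ^ m"
proof -
  have "(n choose m) * 1 \<le> (n choose m) * fact m" by (intro mult_le_mono) auto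
  then have "n choose m \<le> n ^ m" using binomial_fact_pow[of n m] by linarith
  then show ?thesis by (metis of_nat_le_iff of_nat_power)
qed

lemma power_le_fact_exp: "real m ^ m \<le> fact m * exp (real m)"
proof -
  have "real m ^ m / fact m \<le> exp (real m)"
  proof -
    have "(\<Sum>n\<in>{m}. inverse (fact n) *\<^sub>R real m ^ n) \<le> (\<Sum>n. inverse (fact n) *\<^sub>R real m ^ n)"
      by (intro sum_le_suminf summable_exp_generic) auto
    then show ?thesis by (simp add: exp_def field_simps)
  qed
  then show ?thesis by (simp add: field_simps)
qed

lemma choose_le_exp:
  assumes "0 < m" shows "real (n choose m) \<le> (exp 1 * n / m) ^ m"
proof -
  have "real (n choose m) * real m ^ m \<le> real (n choose m) * (fact m * exp (real m))"
    by (intro mult_left_mono power_le_fact_exp) auto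
  also have "\<dots> = real ((n choose m) * fact m) * exp (real m)" by simp
  also have "\<dots> \<le> real (n ^ m) * exp (real m)"
    by (intro mult_right_mono of_nat_mono binomial_fact_pow) auto
  finally have "real (n choose m) * real m ^ m \<le> (exp 1 * n) ^ m"
    by (simp add: power_mult_distrib exp_of_nat_mult[symmetric] mult.commute)
  then show ?thesis using assms by (simp add: power_divide pos_le_divide_eq)
qed

section \<open>Random labellings and a triangle-free subgraph\<close>

type_synonym labelling = "nat \<times> nat \<Rightarrow> nat"

text \<open>The label 0 at \<open>(x, y)\<close> encodes an arc from \<open>x\<close> to \<open>y\<close>, so under a uniform labelling all arcs are
  independent and each is present with probability \<open>1 / q\<close>.\<close>

definition lab :: "nat \<Rightarrow> nat \<Rightarrow> labelling set" where
  "lab N q = ({..<N} \<times> {..<N}) \<rightarrow>\<^sub>E {..<q}"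

definition adj :: "labelling \<Rightarrow> nat \<Rightarrow> nat \<Rightarrow> bool" where
  "adj f x y \<longleftrightarrow> x \<noteq> y \<and> (f (x, y) = 0 \<or> f (y, x) = 0)"

definition tri :: "nat \<Rightarrow> labelling \<Rightarrow> nat set \<Rightarrow> bool" where
  "tri N f T \<longleftrightarrow> T \<subseteq> {..<N} \<and> card T = 3 \<and> (\<forall>x\<in>T. \<forall>y\<in>T. x \<noteq> y \<longrightarrow> adj f x y)"

definition tripack :: "nat \<Rightarrow> labelling \<Rightarrow> nat set set \<Rightarrow> bool" where
  "tripack N f \<T> \<longleftrightarrow> (\<forall>T\<in>\<T>. tri N f T) \<and> (\<forall>T\<in>\<T>. \<forall>T'\<in>\<T>. T \<noteq> T' \<longrightarrow> card (T \<inter> T') \<le> 1)"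

definition tmax :: "nat \<Rightarrow> labelling \<Rightarrow> nat set set" where
  "tmax N f = (SOME \<T>. tripack N f \<T> \<and> (\<forall>\<T>'. tripack N f \<T>' \<longrightarrow> \<T> \<subseteq> \<T>' \<longrightarrow> \<T>' = \<T>))"

text \<open>\<open>adj\<close> without the edges of a maximal family of edge-disjoint triangles: by maximality this is
  triangle-free, and only few edges are lost.\<close>

definition adjs :: "nat \<Rightarrow> labelling \<Rightarrow> nat \<Rightarrow> nat \<Rightarrow> bool" where
  "adjs N f x y \<longleftrightarrow> x < N \<and> y < N \<and> adj f x y \<and> \<not> (\<exists>T\<in>tmax N f. x \<in> T \<and> y \<in> T)"

lemma finite_lab [simp]: "finite (lab N q)"
  by (simp add: lab_def finite_PiE)

lemma card_lab_pos: "0 < q \<Longrightarrow> 0 < card (lab N q)"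
  by (simp add: lab_def card_PiE)

lemma adj_sym: "adj f x y = adj f y x"
  by (auto simp: adj_def)

lemma adjs_sym: "adjs N f x y = adjs N f y x"
  by (auto simp: adjs_def adj_sym)

lemma tmax:
  "tripack N f (tmax N f)"
  "tripack N f \<T>' \<Longrightarrow> tmax N f \<subseteq> \<T>' \<Longrightarrow> \<T>' = tmax N f"
proof -
  let ?P = "{\<T>. tripack N f \<T>}"
  have "?P \<subseteq> Pow (Pow {..<N})" by (auto simp: tripack_def tri_def)
  then have "finite ?P" by (rule finite_subset) auto
  moreover have "{} \<in> ?P" by (simp add: tripack_def)
  ultimately have "\<exists>m\<in>?P. \<forall>b\<in>?P. m \<subseteq> b \<longrightarrow> m = b"
    by (intro finite_has_maximal) auto
  then have "\<exists>\<T>. tripack N f \<T> \<and> (\<forall>\<T>'. tripack N f \<T>' \<longrightarrow> \<T> \<subseteq> \<T>' \<longrightarrow> \<T>' = \<T>)" by blast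
  from someI_ex[OF this] show "tripack N f (tmax N f)"
    "tripack N f \<T>' \<Longrightarrow> tmax N f \<subseteq> \<T>' \<Longrightarrow> \<T>' = tmax N f"
    unfolding tmax_def by blast+
qed

lemma finite_tmax: "finite (tmax N f)"
proof -
  have "tmax N f \<subseteq> Pow {..<N}" using tmax(1)[of N f] by (auto simp: tripack_def tri_def)
  then show ?thesis by (rule finite_subset) auto
qed

text \<open>A surviving triangle shares no pair of vertices with a member of the packing, hence at
  most one vertex with each, so it could be added, against maximality.\<close>

lemma adjs_triangle_free:
  assumes "adjs N f x y" "adjs N f y z" "adjs N f x z" shows False
proof -
  let ?T = "{x, y, z}"
  have ne: "x \<noteq> y" "y \<noteq> z" "x \<noteq> z" using assms by (auto simp: adjs_def adj_def)
  have T: "tri N f ?T"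
    using assms ne by (auto simp: tri_def adjs_def adj_sym)
  have notin: "\<not> (u \<in> T \<and> v \<in> T)" if "T \<in> tmax N f" "(u, v) \<in> {(x, y), (y, z), (x, z)}" for T u v
    using that assms by (auto simp: adjs_def)
  have "card (?T \<inter> T) \<le> 1" if "T \<in> tmax N f" for T
  proof -
    have "?T \<inter> T = {} \<or> ?T \<inter> T = {x} \<or> ?T \<inter> T = {y} \<or> ?T \<inter> T = {z}"
      using notin[OF that] by blast
    then show ?thesis by auto
  qed
  then have "tripack N f (insert ?T (tmax N f))"
    using tmax(1)[of N f] T by (auto simp: tripack_def Int_commute)
  from tmax(2)[OF this] have "?T \<in> tmax N f" by blast
  then show False using notin by blast
qed

text \<open>Three arcs that realise a triangle. The arc \<open>(x, y)\<close> of \<open>Q\<close> is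
  prescribed, whereas each of the other two edges may come from an arc in either direction; the
  Booleans choose the directions.\<close>

definition cand :: "(nat \<times> nat) \<times> nat \<times> bool \<times> bool \<Rightarrow> (nat \<times> nat) set" where
  "cand = (\<lambda>((x, y), z, b1, b2). {(x, y), if b1 then (y, z) else (z, y), if b2 then (x, z) else (z, x)})"

definition cands :: "nat \<Rightarrow> (nat \<times> nat) set \<Rightarrow> (nat \<times> nat) set set" where
  "cands N Q = cand ` {((x, y), z, b1, b2). (x, y) \<in> Q \<and> x \<noteq> y \<and> z < N \<and> z \<noteq> x \<and> z \<noteq> y}"

lemma cands_props:
  assumes "Q \<subseteq> {..<N} \<times> {..<N}"
  shows "finite (cands N Q)" "card (cands N Q) \<le> 4 * N * card Q"
    "F \<in> cands N Q \<Longrightarrow> card F = 3 \<and> F \<subseteq> {..<N} \<times> {..<N} \<and> (\<forall>(a, b)\<in>F. a \<noteq> b)"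
proof -
  let ?D = "{((x, y), z, b1 :: bool, b2 :: bool). (x, y) \<in> Q \<and> x \<noteq> y \<and> z < N \<and> z \<noteq> x \<and> z \<noteq> y}"
  have sub: "?D \<subseteq> Q \<times> {..<N} \<times> (UNIV :: bool set) \<times> (UNIV :: bool set)" by auto
  have fQ: "finite Q" using assms by (rule finite_subset) auto
  have finD: "finite ?D" using sub by (rule finite_subset) (use fQ in auto)
  show "finite (cands N Q)" unfolding cands_def using finD by (rule finite_imageI)
  have "card (cands N Q) \<le> card ?D" unfolding cands_def using finD by (rule card_image_le)
  also have "\<dots> \<le> card (Q \<times> {..<N} \<times> (UNIV :: bool set) \<times> (UNIV :: bool set))"
    using sub by (intro card_mono) (use fQ in auto)
  finally show "card (cands N Q) \<le> 4 * N * card Q"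
    by (simp add: card_cartesian_product card_UNIV_bool UNIV_Times_UNIV[symmetric] mult.commute
        del: UNIV_Times_UNIV)
  show "F \<in> cands N Q \<Longrightarrow> card F = 3 \<and> F \<subseteq> {..<N} \<times> {..<N} \<and> (\<forall>(a, b)\<in>F. a \<noteq> b)"
    using assms by (auto simp: cands_def cand_def card_insert_if split: if_splits)
qed

text \<open>Every present arc of \<open>Q\<close> lies in a triangle of the packing. One candidate
  is picked inside each triangle concerned: edge-disjoint triangles give disjoint candidates, and a
  triangle has only six ordered pairs, whence the factor 6.\<close>

lemma killed_arcs:
  assumes Q: "Q \<subseteq> {..<N} \<times> {..<N}" "\<And>x y. (x, y) \<in> Q \<Longrightarrow> x \<noteq> y"
    and no: "\<forall>(x, y)\<in>Q. \<not> adjs N f x y"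
  defines "E0 \<equiv> {e\<in>Q. f e = 0}"
  shows "\<exists>\<C>\<subseteq>cands N Q. card E0 \<le> 6 * card \<C> \<and> disjoint \<C> \<and> (\<forall>F\<in>\<C>. \<forall>e\<in>F. f e = 0)"
proof -
  define \<T>0 where "\<T>0 = {T\<in>tmax N f. \<exists>e\<in>E0. e \<in> T \<times> T}"
  have fin0: "finite \<T>0" using finite_tmax by (auto simp: \<T>0_def)
  have tri: "tri N f T" if "T \<in> \<T>0" for T using that tmax(1)[of N f] by (auto simp: \<T>0_def tripack_def)
  have one: "card (T \<inter> T') \<le> 1" if "T \<in> \<T>0" "T' \<in> \<T>0" "T \<noteq> T'" for T T'
    using that tmax(1)[of N f] by (auto simp: \<T>0_def tripack_def)
  have ex: "\<exists>F. F \<in> cands N Q \<and> F \<subseteq> T \<times> T \<and> (\<forall>e\<in>F. f e = 0)" if T: "T \<in> \<T>0" for T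
  proof -
    obtain x y where e: "(x, y) \<in> E0" "x \<in> T" "y \<in> T" using T by (auto simp: \<T>0_def)
    have ne: "x \<noteq> y" using e Q by (auto simp: E0_def)
    have "card T = 3" using tri[OF T] by (simp add: tri_def)
    then have "card (T - {x, y}) = 1" using e ne by (subst card_Diff_subset) auto
    then obtain z where "T - {x, y} = {z}" by (auto simp: card_1_singleton_iff)
    then have z: "z \<in> T" "z \<noteq> x" "z \<noteq> y" by auto
    have "z < N" using z tri[OF T] by (auto simp: tri_def)
    have a: "adj f y z" "adj f x z" using tri[OF T] z e by (auto simp: tri_def)
    let ?F = "cand ((x, y), z, f (y, z) = 0, f (x, z) = 0)"
    have "?F \<in> cands N Q" using e z \<open>z < N\<close> ne by (auto simp: cands_def E0_def)
    moreover have "?F \<subseteq> T \<times> T" using e z by (auto simp: cand_def)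
    moreover have "\<forall>e\<in>?F. f e = 0" using a e by (auto simp: cand_def adj_def E0_def)
    ultimately show ?thesis by blast
  qed
  define c where "c T = (SOME F. F \<in> cands N Q \<and> F \<subseteq> T \<times> T \<and> (\<forall>e\<in>F. f e = 0))" for T
  have c: "c T \<in> cands N Q" "c T \<subseteq> T \<times> T" "\<forall>e\<in>c T. f e = 0" if "T \<in> \<T>0" for T
    using someI_ex[OF ex[OF that]] by (auto simp: c_def)
  have dis: "c T \<inter> c T' = {}" if T: "T \<in> \<T>0" "T' \<in> \<T>0" "T \<noteq> T'" for T T'
  proof (rule ccontr)
    assume "c T \<inter> c T' \<noteq> {}"
    then obtain a b where ab: "(a, b) \<in> c T" "(a, b) \<in> c T'" by auto
    have "a \<noteq> b" using ab c(1)[OF T(1)] cands_props(3)[OF Q(1)] by blast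
    moreover have "{a, b} \<subseteq> T \<inter> T'" using ab c(2)[OF T(1)] c(2)[OF T(2)] by auto
    moreover have "finite (T \<inter> T')" using tri[OF T(1)] by (auto simp: tri_def intro: finite_subset)
    ultimately have "2 \<le> card (T \<inter> T')" by (metis card_2_iff card_mono)
    then show False using one[OF T] by simp
  qed
  have ne: "c T \<noteq> {}" if "T \<in> \<T>0" for T
    using cands_props(3)[OF Q(1) c(1)[OF that]] by auto
  have inj: "inj_on c \<T>0"
    using dis ne by (intro inj_onI) (metis Int_absorb)
  have "E0 \<subseteq> (\<Union>T\<in>\<T>0. T \<times> T - (\<lambda>x. (x, x)) ` T)"
  proof
    fix e assume e: "e \<in> E0"
    obtain x y where xy: "e = (x, y)" by (cases e)
    have "adj f x y" "x < N" "y < N" using e Q xy by (auto simp: E0_def adj_def)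
    moreover have "\<not> adjs N f x y" using no e xy by (auto simp: E0_def)
    ultimately obtain T where "T \<in> tmax N f" "x \<in> T" "y \<in> T" by (auto simp: adjs_def)
    moreover have "x \<noteq> y" using e xy Q by (auto simp: E0_def)
    ultimately show "e \<in> (\<Union>T\<in>\<T>0. T \<times> T - (\<lambda>x. (x, x)) ` T)"
      using e xy by (auto simp: \<T>0_def)
  qed
  moreover have fT: "finite T" "card T = 3" if "T \<in> \<T>0" for T
    using tri[OF that] by (auto simp: tri_def intro: finite_subset)
  ultimately have "card E0 \<le> card (\<Union>T\<in>\<T>0. T \<times> T - (\<lambda>x. (x, x)) ` T)"
    using fin0 by (intro card_mono) auto
  also have "\<dots> \<le> (\<Sum>T\<in>\<T>0. card (T \<times> T - (\<lambda>x. (x, x)) ` T))"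
    using fin0 by (rule card_UN_le)
  also have "\<dots> = (\<Sum>T\<in>\<T>0. 6)"
  proof (rule sum.cong)
    fix T assume T: "T \<in> \<T>0"
    have "card ((\<lambda>x. (x, x)) ` T) = 3"
      using fT[OF T] by (subst card_image) (auto simp: inj_on_def)
    then show "card (T \<times> T - (\<lambda>x. (x, x)) ` T) = 6"
      using fT[OF T] by (subst card_Diff_subset) (auto simp: card_cartesian_product)
  qed simp
  also have "\<dots> = 6 * card (c ` \<T>0)" using inj by (simp add: card_image)
  finally have "card E0 \<le> 6 * card (c ` \<T>0)" .
  moreover have "disjoint (c ` \<T>0)"
    using dis by (auto simp: disjoint_def pairwise_def disjnt_def)
  ultimately show ?thesis using c by (intro exI[of _ "c ` \<T>0"]) auto
qed

text \<open>Lower tail at half of the mean \<open>card Q / q\<close>. The weight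
  \<open>- ln 2\<close> makes each \<open>exp (c e) - 1\<close> equal to -1/2, and
  \<open>ln 2 \<le> 3 / 4\<close> leaves the exponent \<open>- card Q / (8 * q)\<close>, better than
  claimed.\<close>

lemma few_arcs:
  assumes Q: "Q \<subseteq> {..<N} \<times> {..<N}" and q: "0 < q"
  shows "pr (lab N q) (\<lambda>f. card {e\<in>Q. f e = 0} \<le> card Q / (2 * real q)) \<le> exp (- (card Q / (12 * real q)))"
proof -
  let ?I = "{..<N} \<times> {..<N}"
  let ?c = "\<lambda>e. if e \<in> Q then - ln 2 else (0::real)"
  let ?x = "- (ln 2 * (card Q / (2 * real q))) :: real"
  have fQ: "finite Q" using Q by (rule finite_subset) auto
  have sumE: "(\<Sum>e\<in>?I. if f e = 0 then ?c e else 0) = - (ln 2 * card {e\<in>Q. f e = 0})" for f :: "nat \<times> nat \<Rightarrow> nat"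
  proof -
    have "(\<Sum>e\<in>?I. if f e = 0 then ?c e else 0) = (\<Sum>e\<in>?I. if e \<in> {e\<in>Q. f e = 0} then - ln 2 else 0)"
      by (intro sum.cong) auto
    also have "\<dots> = (\<Sum>e\<in>{e\<in>Q. f e = 0}. - ln 2)"
      using Q fQ by (subst sum.inter_restrict[symmetric]) (auto intro!: arg_cong[of _ _ card])
    finally show ?thesis by simp
  qed
  have "pr (lab N q) (\<lambda>f. card {e\<in>Q. f e = 0} \<le> card Q / (2 * real q))
     \<le> pr (lab N q) (\<lambda>f. ?x \<le> (\<Sum>e\<in>?I. if f e = 0 then ?c e else 0))"
    unfolding sumE
  proof (rule pr_mono)
    fix f :: "nat \<times> nat \<Rightarrow> nat" assume "card {e\<in>Q. f e = 0} \<le> card Q / (2 * real q)"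
    then have "ln 2 * real (card {e\<in>Q. f e = 0}) \<le> ln 2 * (card Q / (2 * real q))"
      by (intro mult_left_mono) auto
    then show "?x \<le> - (ln 2 * real (card {e\<in>Q. f e = 0}))" by simp
  qed simp
  also have "\<dots> \<le> exp (- ?x + (\<Sum>e\<in>?I. exp (?c e) - 1) / q)"
    unfolding lab_def by (rule pr_weighted) (use q in auto)
  also have "(\<Sum>e\<in>?I. exp (?c e) - 1) = (\<Sum>e\<in>?I. if e \<in> Q then - (1/2) else 0)"
    by (intro sum.cong) (auto simp: exp_minus)
  also have "\<dots> = (\<Sum>e\<in>Q. - (1/2))"
    using Q fQ by (subst sum.inter_restrict[symmetric]) (auto intro!: arg_cong[of _ _ card])
  also have "- ?x + (\<Sum>e\<in>Q. - (1/2)) / q \<le> - (card Q / (12 * real q))"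
  proof -
    have "(2::real) \<le> exp (3 / 4)"
      using exp_lower_Taylor_quadratic[of "3 / 4 :: real"] by (simp add: power2_eq_square)
    then have "ln 2 \<le> (3 / 4 :: real)" using ln_mono[of 2 "exp (3 / 4 :: real)"] by simp
    then have "ln 2 * (card Q / (2 * real q)) \<le> 3 / 4 * (card Q / (2 * real q))"
      by (intro mult_right_mono) auto
    then show ?thesis using q by (simp add: field_simps)
  qed
  finally show ?thesis by simp
qed

text \<open>Krivelevich's device: the arcs of \<open>Q\<close> are removed only along edge-disjoint triangles, so
  losing all of them forces many triangles with pairwise disjoint sets of arcs.\<close>

lemma pr_no_adjs:
  assumes Q: "Q \<subseteq> {..<N} \<times> {..<N}" "\<And>x y. (x, y) \<in> Q \<Longrightarrow> x \<noteq> y"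
    and q: "0 < q" and N: "500 * real N \<le> (real q)\<^sup>2"
  shows "pr (lab N q) (\<lambda>f. \<forall>(x, y)\<in>Q. \<not> adjs N f x y) \<le> 2 * exp (- (card Q / (12 * real q)))"
proof (cases "Q = {}")
  case True
  then show ?thesis using pr_le_1[of "lab N q" "\<lambda>f. True"] by simp
next
  case False
  have fQ: "finite Q" using Q(1) by (rule finite_subset) auto
  \<comment> \<open>The mean number of present arcs is \<open>12 * \<mu>\<close>. If more than half
    of that is present, the factor 6 of \<open>killed_arcs\<close> forces more than \<mu> disjoint
    candidates.\<close>
  define \<mu> where "\<mu> = card Q / (12 * real q)"
  have \<mu>: "0 < \<mu>" using False fQ q by (simp add: \<mu>_def card_gt_0_iff)
  define m where "m = nat \<lceil>\<mu>\<rceil>"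
  have m: "\<mu> \<le> m" "0 < m" using \<mu> by (auto simp: m_def)
  define X where "X = {\<C>. \<C> \<subseteq> cands N Q \<and> card \<C> = m \<and> disjoint \<C>}"
  have finX: "finite X" using cands_props(1)[OF Q(1)] by (auto simp: X_def intro: finite_subset[of _ "Pow (cands N Q)"])
  have N0: "0 < N" using False Q(1) by (cases N) auto
  have A: "pr (lab N q) (\<lambda>f. \<exists>\<C>\<in>X. \<forall>e\<in>\<Union>\<C>. f e = 0) \<le> exp (- \<mu>)"
  proof -
    have "pr (lab N q) (\<lambda>f. \<exists>\<C>\<in>X. \<forall>e\<in>\<Union>\<C>. f e = 0) \<le> card X * (1 / q) ^ (3 * m)"
    proof (rule pr_Ex_le)
      fix \<C> assume C: "\<C> \<in> X"
      have "card (\<Union>\<C>) = (\<Sum>F\<in>\<C>. card F)"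
        using C cands_props(3)[OF Q(1)] by (intro card_Union_disjoint)
          (auto simp: X_def disjoint_def pairwise_def disjnt_def intro!: card_ge_0_finite)
      also have "\<dots> = (\<Sum>F\<in>\<C>. 3)"
        using C cands_props(3)[OF Q(1)] by (intro sum.cong) (auto simp: X_def)
      finally have "card (\<Union>\<C>) = 3 * m" using C by (simp add: X_def)
      moreover have "\<Union>\<C> \<subseteq> {..<N} \<times> {..<N}"
        using C cands_props(3)[OF Q(1)] unfolding X_def by blast
      ultimately show "pr (lab N q) (\<lambda>f. \<forall>e\<in>\<Union>\<C>. f e = 0) \<le> (1 / q) ^ (3 * m)"
        unfolding lab_def using pr_PiE_zero[of "{..<N} \<times> {..<N}" "\<Union>\<C>" q] q by simp
    qed (use finX in auto)
    also have "card X \<le> card {\<C>. \<C> \<subseteq> cands N Q \<and> card \<C> = m}"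
      using cands_props(1)[OF Q(1)] by (intro card_mono) (auto simp: X_def intro: finite_subset[of _ "Pow (cands N Q)"])
    also have "\<dots> = card (cands N Q) choose m"
      using cands_props(1)[OF Q(1)] by (rule n_subsets)
    also have "real \<dots> \<le> (exp 1 * card (cands N Q) / m) ^ m"
      using m by (intro choose_le_exp)
    also have "(exp 1 * card (cands N Q) / m) ^ m * (1 / real q) ^ (3 * m)
       = (exp 1 * card (cands N Q) / m * (1 / q) ^ 3) ^ m"
      by (simp add: power_mult_distrib power_mult[symmetric] power_divide)
    \<comment> \<open>There are at most \<open>4 * N * card Q\<close> candidates, so the base is at
      most \<open>48 * exp 1 * N / q^2\<close>; the constant 500 of the hypothesis suffices because
      \<open>48 * 9 < 500\<close>.\<close>
    also have "\<dots> \<le> (exp (-1)) ^ m"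
    proof (intro power_mono)
      have "real (card (cands N Q)) \<le> 4 * N * (12 * q * \<mu>)"
      proof -
        have "card (cands N Q) \<le> 4 * N * card Q" by (rule cands_props(2)[OF Q(1)])
        then have "real (card (cands N Q)) \<le> real (4 * N * card Q)" by (rule of_nat_mono)
        then show ?thesis using q by (simp add: \<mu>_def)
      qed
      also have "\<dots> \<le> 4 * real N * (12 * real q * real m)" using m by (simp add: mult_left_mono)
      finally have "real (card (cands N Q)) / m \<le> 48 * N * q" using m by (simp add: field_simps)
      then have "exp 1 * (card (cands N Q) / m) * (1 / q) ^ 3 \<le> exp 1 * (48 * N * q) * (1 / q) ^ 3"
        by (intro mult_right_mono mult_left_mono) auto
      also have "\<dots> = exp 1 * 48 * (N / (real q)\<^sup>2)" using q by (simp add: power3_eq_cube power2_eq_square)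
      also have "\<dots> \<le> exp 1 * 48 * (1 / 500)"
        using N q by (intro mult_left_mono) (auto simp: field_simps)
      also have "\<dots> \<le> exp (-1)"
      proof -
        have "exp (1::real) * exp 1 \<le> 3 * 3"
          using exp_le by (intro mult_mono) auto
        then have "exp (1::real) * 48 * (1 / 500) * exp 1 \<le> 1" by simp
        then show ?thesis by (simp add: exp_minus field_simps)
      qed
      finally show "exp 1 * card (cands N Q) / m * (1 / q) ^ 3 \<le> exp (-1)" by simp
    qed auto
    also have "\<dots> = exp (- real m)" by (simp add: exp_of_nat_mult[symmetric])
    also have "\<dots> \<le> exp (- \<mu>)" using m by simp
    finally show ?thesis by (simp add: mult_right_mono)
  qed
  have "pr (lab N q) (\<lambda>f. \<forall>(x, y)\<in>Q. \<not> adjs N f x y)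
      \<le> pr (lab N q) (\<lambda>f. card {e\<in>Q. f e = 0} \<le> card Q / (2 * real q) \<or> (\<exists>\<C>\<in>X. \<forall>e\<in>\<Union>\<C>. f e = 0))"
  proof (rule pr_mono)
    fix f assume "\<forall>(x, y)\<in>Q. \<not> adjs N f x y"
    from killed_arcs[OF Q this] obtain \<C> where C: "\<C> \<subseteq> cands N Q"
      "card {e\<in>Q. f e = 0} \<le> 6 * card \<C>" "disjoint \<C>" "\<forall>F\<in>\<C>. \<forall>e\<in>F. f e = 0" by blast
    show "card {e\<in>Q. f e = 0} \<le> card Q / (2 * real q) \<or> (\<exists>\<C>\<in>X. \<forall>e\<in>\<Union>\<C>. f e = 0)"
    proof (cases "card {e\<in>Q. f e = 0} \<le> card Q / (2 * real q)")
      case False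
      have "6 * \<mu> = card Q / (2 * real q)" by (simp add: \<mu>_def field_simps)
      then have "6 * \<mu> < 6 * real (card \<C>)" using False C(2) by linarith
      then have "m \<le> card \<C>" by (simp add: m_def ceiling_le_iff)
      then obtain \<C>' where C': "\<C>' \<subseteq> \<C>" "card \<C>' = m" by (metis obtain_subset_with_card_n)
      then have "\<C>' \<in> X" using C unfolding X_def by (auto intro: pairwise_subset)
      then show ?thesis using C C' by blast
    qed simp
  qed simp
  also have "\<dots> \<le> exp (- \<mu>) + exp (- \<mu>)"
    using few_arcs[OF Q(1) q] A unfolding \<mu>_def[symmetric]
    by (intro order.trans[OF pr_disj[OF finite_lab]] add_mono)
  finally show ?thesis by (simp add: \<mu>_def)
qed

section \<open>Cells joined to half of a sample\<close>

text \<open>The two directions are counted separately, so that each count is a sum over distinct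
  labels; \<open>flip\<close> transfers estimates from one direction to the other.\<close>

definition ap :: "labelling \<Rightarrow> nat set \<Rightarrow> nat \<Rightarrow> nat" where
  "ap f X w = card {y\<in>X. f (w, y) = 0}"

definition am :: "labelling \<Rightarrow> nat set \<Rightarrow> nat \<Rightarrow> nat" where
  "am f X w = card {y\<in>X. f (y, w) = 0}"

text \<open>Paths are taken in \<open>adj\<close>, which contains \<open>adjs\<close>: its labels
  are independent, and the deleted triangles need not be tracked.\<close>

definition Bad :: "nat \<Rightarrow> labelling \<Rightarrow> nat set \<Rightarrow> nat set" where
  "Bad N f X = {z\<in>{..<N}. card X \<le> 2 * card {y\<in>X. \<exists>w<N. adj f z w \<and> adj f w y}}"

text \<open>The order of \<open>10 * q\<close> is that of a neighbourhood and cannot be lowered: if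
  all of \<open>X\<close> is adjacent to one cell, every neighbour of that cell is bad.\<close>

definition Good :: "nat \<Rightarrow> nat \<Rightarrow> nat \<Rightarrow> labelling \<Rightarrow> bool" where
  "Good N q t f \<longleftrightarrow> (\<forall>X\<subseteq>{..<N}. card X = t \<longrightarrow> card (Bad N f X) \<le> 10 * q)"

definition flip :: "labelling \<Rightarrow> nat \<times> nat \<Rightarrow> nat" where
  "flip f = (\<lambda>(x, y). f (y, x))"

lemma flip_apply [simp]: "flip f (x, y) = f (y, x)"
  by (simp add: flip_def)

lemma pr_lab_flip: "pr (lab N q) (\<lambda>f. P (flip f)) = pr (lab N q) P"
proof -
  have "bij_betw (\<lambda>f. restrict (flip f) ({..<N} \<times> {..<N})) (lab N q) (lab N q)"
    by (rule bij_betw_byWitness[where f' = "\<lambda>f. restrict (flip f) ({..<N} \<times> {..<N})"])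
      (auto simp: lab_def PiE_def extensional_def restrict_def fun_eq_iff Pi_def)
  moreover have "restrict (flip f) ({..<N} \<times> {..<N}) = flip f" if "f \<in> lab N q" for f
    using that by (auto simp: lab_def PiE_def extensional_def fun_eq_iff)
  ultimately have b: "bij_betw flip (lab N q) (lab N q)"
    by (simp cong: bij_betw_cong)
  show ?thesis by (rule pr_bij[OF b, symmetric])
qed

lemma ap_flip [simp]: "ap (flip f) = am f" and am_flip [simp]: "am (flip f) = ap f"
  by (auto simp: ap_def am_def fun_eq_iff)

text \<open>\<open>N\<close> is the number of cells, \<open>1 / q\<close> the arc density, \<open>t\<close> the size of the samples, \<open>d0\<close> a bound on
  the in- and out-degrees.\<close>

locale cells =
  fixes N q t d0 :: nat
  assumes N: "3000 * real N \<le> (real q)\<^sup>2"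
    and t10: "t ^ 10 \<le> q"
    and tL: "1920 + 960 * ln q \<le> t"
    and q_ge: "100000000 \<le> q"
    and d0: "q \<le> 400 * d0" "400 * d0 \<le> q + 400"
    and Nd: "real N * 64 \<le> 2 ^ d0"
begin

definition L :: real where "L = ln q"

lemma q_pos: "0 < q" using q_ge by linarith

lemma q_exp: "real q = exp L" using q_pos by (simp add: L_def)

lemma L_ge: "1 \<le> L"
proof -
  have "exp 1 \<le> real q" using q_ge exp_le by linarith
  then show ?thesis using q_exp by simp
qed

lemma t_ge: "1920 + 960 * L \<le> t" using tL by (simp add: L_def)

lemma t_exp: "real t \<le> exp (L / 10)"
proof -
  have "real t ^ 10 \<le> exp L" using t10 unfolding q_exp[symmetric] by (metis of_nat_le_iff of_nat_power)
  also have "exp L = exp (L / 10) ^ 10" by (simp add: exp_of_nat_mult[symmetric])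
  finally show ?thesis by (rule power_le_imp_le_base[of _ 9, simplified]) auto
qed

lemma N_exp: "real N \<le> exp (2 * L)"
proof -
  have "real N \<le> (real q)\<^sup>2" using N by linarith
  also have "\<dots> = exp (2 * L)" by (simp add: q_exp power2_eq_square exp_add[symmetric])
  finally show ?thesis .
qed

lemma N_pow: "real N ^ j \<le> exp (2 * L * j)"
  using power_mono[OF N_exp, of j] by (simp add: exp_of_nat_mult[symmetric] mult.commute)

lemma q_pow: "(1 / real q) ^ j = exp (- (L * j))"
  by (simp add: q_exp power_divide exp_of_nat_mult[symmetric] exp_minus inverse_eq_divide mult.commute)

lemma inverse_q: "1 / real q = exp (- L)"
  using q_pow[of 1] by simp

section \<open>Degrees and hubs of a random labelling\<close>

lemma outdeg: "pr (lab N q) (\<lambda>f. \<exists>x<N. d0 \<le> ap f {..<N} x) \<le> 1 / 64"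
proof -
  have d0p: "0 < d0" using d0 q_pos by (cases d0) auto
  let ?D = "{D. D \<subseteq> {..<N} \<and> card D = d0}"
  have fD: "finite ?D" by (rule finite_subset[of _ "Pow {..<N}"]) auto
  have "pr (lab N q) (\<lambda>f. \<exists>x<N. d0 \<le> ap f {..<N} x)
     \<le> pr (lab N q) (\<lambda>f. \<exists>xD\<in>{..<N} \<times> ?D. \<forall>e\<in>{fst xD} \<times> snd xD. f e = 0)"
  proof (rule pr_mono)
    fix f assume "\<exists>x<N. d0 \<le> ap f {..<N} x"
    then obtain x where x: "x < N" "d0 \<le> card {y\<in>{..<N}. f (x, y) = 0}" by (auto simp: ap_def)
    from x(2) obtain D where "D \<subseteq> {y\<in>{..<N}. f (x, y) = 0}" "card D = d0"
      by (rule obtain_subset_with_card_n)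
    then show "\<exists>xD\<in>{..<N} \<times> ?D. \<forall>e\<in>{fst xD} \<times> snd xD. f e = 0"
      using x by (intro bexI[of _ "(x, D)"]) auto
  qed simp
  also have "\<dots> \<le> card ({..<N} \<times> ?D) * (1 / q) ^ d0"
  proof (rule pr_Ex_le)
    fix xD assume xD: "xD \<in> {..<N} \<times> ?D"
    have "card ({fst xD} \<times> snd xD) = d0" using xD by (auto simp: card_cartesian_product)
    moreover have sub: "{fst xD} \<times> snd xD \<subseteq> {..<N} \<times> {..<N}" using xD by auto
    have "pr (lab N q) (\<lambda>f. \<forall>e\<in>{fst xD} \<times> snd xD. f e = 0) \<le> (1 / q) ^ card ({fst xD} \<times> snd xD)"
      unfolding lab_def by (rule pr_PiE_zero[OF _ sub q_pos]) simp
    ultimately show "pr (lab N q) (\<lambda>f. \<forall>e\<in>{fst xD} \<times> snd xD. f e = 0) \<le> (1 / q) ^ d0"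
      by (simp only:)
  qed (use fD in auto)
  also have "card ({..<N} \<times> ?D) = N * (N choose d0)"
    by (simp add: card_cartesian_product n_subsets)
  also have "real (N * (N choose d0)) * (1 / q) ^ d0 \<le> N * (exp 1 * N / d0) ^ d0 * (1 / q) ^ d0"
    using choose_le_exp[OF d0p, of N] by (simp add: mult_left_mono mult_right_mono)
  also have "\<dots> = N * (exp 1 * N / (d0 * q)) ^ d0"
    by (simp add: power_mult_distrib[symmetric] mult.assoc)
  \<comment> \<open>\<open>d0\<close> is at least \<open>q / 400\<close>, more than
    \<open>2 * exp 1\<close> times the mean out-degree \<open>N / q\<close>, which is at most
    \<open>q / 3000\<close>.\<close>
  also have "\<dots> \<le> N * (1 / 2) ^ d0"
  proof (intro mult_left_mono power_mono)
    have "6 * real N \<le> d0 * real q"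
    proof -
      have "real q \<le> 400 * real d0" using d0 by linarith
      then have "(real q)\<^sup>2 \<le> 400 * real d0 * real q"
        unfolding power2_eq_square by (intro mult_right_mono) auto
      then show ?thesis using N by linarith
    qed
    moreover have "exp 1 * real N \<le> 3 * real N" using exp_le by (intro mult_right_mono) auto
    ultimately have "exp 1 * real N \<le> 1 / 2 * (d0 * real q)" by linarith
    then show "exp 1 * N / (d0 * q) \<le> 1 / 2" using d0p q_pos
      by (simp add: divide_le_eq)
  qed auto
  also have "\<dots> \<le> 1 / 64" using Nd by (simp add: power_divide divide_le_eq)
  finally show ?thesis .
qed

definition hubs_ok :: "(nat set \<Rightarrow> nat \<Rightarrow> nat) \<Rightarrow> nat set \<Rightarrow> bool" where
  "hubs_ok a X \<longleftrightarrow> (\<forall>h\<in>{10..t}. h * card {w\<in>{..<N}. h \<le> a X w} \<le> 4 * t)"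

text \<open>Union bound over \<open>X\<close>, over \<open>J\<close> hubs and over \<open>h\<close>
  arcs from each. In the exponent, in units of \<open>L\<close>, the choices cost
  \<open>2 * t + 2 * J + h * J / 10\<close>, since \<open>N \<le> q^2\<close> and
  \<open>t ^ 10 \<le> q\<close>, while the arcs gain \<open>h * J\<close>. As
  \<open>h * J \<ge> 4 * t\<close> and \<open>h \<ge> 10\<close>, the gain wins; this is why the
  scales start at 10.\<close>

lemma pr_many_hubs:
  assumes h: "10 \<le> h" "h \<le> t"
  shows "pr (lab N q) (\<lambda>f. \<exists>X\<in>{X. X \<subseteq> {..<N} \<and> card X = t}. 4 * t < h * card {w\<in>{..<N}. h \<le> ap f X w})
     \<le> exp (- 2 * L)"
proof -
  \<comment> \<open>The least number of hubs that violates the bound.\<close>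
  define J where "J = 4 * t div h + 1"
  have J: "4 * t < h * card A \<longleftrightarrow> J \<le> card A" for A :: "nat set"
  proof -
    have "4 * t < h * card A \<longleftrightarrow> 4 * t div h < card A"
      using h by (metis (no_types) div_less_iff_less_mult less_le_trans mult.commute zero_less_numeral)
    then show ?thesis by (auto simp: J_def)
  qed
  have hJ: "4 * t \<le> h * J"
  proof -
    have "4 * t = h * (4 * t div h) + 4 * t mod h" by simp
    moreover have "4 * t mod h < h" using h by simp
    ultimately have "4 * t \<le> h * (4 * t div h) + h" by linarith
    then show ?thesis unfolding J_def by (simp only: distrib_left mult_1_right)
  qed
  let ?X = "{X. X \<subseteq> {..<N} \<and> card X = t}"
  let ?W = "{W. W \<subseteq> {..<N} \<and> card W = J}"
  let ?Y = "\<lambda>X W. W \<rightarrow>\<^sub>E {Y. Y \<subseteq> X \<and> card Y = h}"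
  have fin: "finite {X. X \<subseteq> {..<N} \<and> card X = m}" for m
    by (rule finite_subset[of _ "Pow {..<N}"]) auto
  have fin2: "finite (?Y X W)" if "X \<in> ?X" "W \<in> ?W" for X W
    using that by (intro finite_PiE) (auto intro: finite_subset[of _ "Pow X"] finite_subset[of _ "{..<N}"])
  have step: "pr (lab N q) (\<lambda>f. \<exists>Y\<in>?Y X W. \<forall>e\<in>Sigma W Y. f e = 0) \<le> real t ^ (h * J) * (1 / q) ^ (h * J)"
    if X: "X \<in> ?X" and W: "W \<in> ?W" for X W
  proof -
    have fX: "finite X" "finite W" using X W by (auto intro: finite_subset[of _ "{..<N}"])
    have "pr (lab N q) (\<lambda>f. \<exists>Y\<in>?Y X W. \<forall>e\<in>Sigma W Y. f e = 0) \<le> card (?Y X W) * (1 / q) ^ (h * J)"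
    proof (rule pr_Ex_le)
      fix Y assume Y: "Y \<in> ?Y X W"
      have Yw: "Y w \<subseteq> X" "card (Y w) = h" if "w \<in> W" for w using Y that by auto
      have "card (Sigma W Y) = (\<Sum>w\<in>W. card (Y w))"
        using fX Yw by (intro card_SigmaI) (auto intro: finite_subset)
      also have "\<dots> = h * J" using Yw W by simp
      finally have "card (Sigma W Y) = h * J" .
      moreover have "Sigma W Y \<subseteq> {..<N} \<times> {..<N}" using X W Yw by blast
      ultimately show "pr (lab N q) (\<lambda>f. \<forall>e\<in>Sigma W Y. f e = 0) \<le> (1 / q) ^ (h * J)"
        unfolding lab_def using pr_PiE_zero[of "{..<N} \<times> {..<N}" "Sigma W Y" q] q_pos by auto
    qed (use fin2[OF X W] in auto)
    also have "card (?Y X W) = (t choose h) ^ J"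
      using X W fX by (subst card_PiE) (auto simp: n_subsets)
    also have "real ((t choose h) ^ J) \<le> real t ^ (h * J)"
      using power_mono[OF choose_le_power[of t h], of J] by (simp add: power_mult[symmetric])
    finally show ?thesis by (simp add: mult_right_mono)
  qed
  have "pr (lab N q) (\<lambda>f. \<exists>X\<in>?X. 4 * t < h * card {w\<in>{..<N}. h \<le> ap f X w})
    \<le> pr (lab N q) (\<lambda>f. \<exists>X\<in>?X. \<exists>W\<in>?W. \<exists>Y\<in>?Y X W. \<forall>e\<in>Sigma W Y. f e = 0)"
  proof (rule pr_mono)
    fix f assume "\<exists>X\<in>?X. 4 * t < h * card {w\<in>{..<N}. h \<le> ap f X w}"
    then obtain X where X: "X \<in> ?X" "J \<le> card {w\<in>{..<N}. h \<le> ap f X w}" using J by blast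
    from X(2) obtain W where W: "W \<subseteq> {w\<in>{..<N}. h \<le> ap f X w}" "card W = J"
      by (rule obtain_subset_with_card_n)
    have "\<exists>Y. Y \<subseteq> {y\<in>X. f (w, y) = 0} \<and> card Y = h" if "w \<in> W" for w
    proof -
      have "h \<le> card {y\<in>X. f (w, y) = 0}" using W that by (auto simp: ap_def)
      then show ?thesis by (rule obtain_subset_with_card_n) blast
    qed
    then obtain Y where Y: "\<And>w. w \<in> W \<Longrightarrow> Y w \<subseteq> {y\<in>X. f (w, y) = 0} \<and> card (Y w) = h" by metis
    have "restrict Y W \<in> ?Y X W" using Y by auto
    moreover have "\<forall>e\<in>Sigma W (restrict Y W). f e = 0" using Y by force
    moreover have "W \<in> ?W" using W by auto
    ultimately show "\<exists>X\<in>?X. \<exists>W\<in>?W. \<exists>Y\<in>?Y X W. \<forall>e\<in>Sigma W Y. f e = 0" using X by blast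
  qed simp
  also have "\<dots> \<le> card ?X * (card ?W * (real t ^ (h * J) * (1 / q) ^ (h * J)))"
    by (intro pr_Ex_le) (use fin step in auto)
  also have "\<dots> \<le> exp (2 * L * t) * (exp (2 * L * J) * (exp (L / 10 * (h * J)) * exp (- (L * (h * J)))))"
  proof (intro mult_mono)
    show "real (card ?X) \<le> exp (2 * L * t)" "real (card ?W) \<le> exp (2 * L * J)"
      using order_trans[OF choose_le_power N_pow] by (simp_all add: n_subsets)
    show "real t ^ (h * J) \<le> exp (L / 10 * (h * J))"
      using power_mono[OF t_exp, of "h * J"] by (simp only: exp_of_nat_mult[symmetric] mult.commute)
    show "(1 / real q) ^ (h * J) \<le> exp (- (L * (h * J)))" by (simp only: q_pow of_nat_mult)
  qed auto
  also have "\<dots> = exp (L * (2 * real t + 2 * real J - 9 / 10 * (real h * real J)))"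
    by (simp add: exp_add[symmetric] algebra_simps)
  also have "\<dots> \<le> exp (- 2 * L)"
  proof -
    have "10 * real J \<le> real h * real J" using h by (intro mult_right_mono) auto
    moreover have "4 * real t \<le> real h * real J"
      using hJ by (metis of_nat_le_iff of_nat_mult of_nat_numeral)
    moreover have "1 \<le> real J" by (simp add: J_def)
    ultimately have "2 * real t + 2 * real J - 9 / 10 * (real h * real J) \<le> - 2" by argo
    then have "L * (2 * real t + 2 * real J - 9 / 10 * (real h * real J)) \<le> L * (- 2)"
      using L_ge by (intro mult_left_mono) auto
    then show ?thesis by simp
  qed
  finally show ?thesis .
qed

lemma hubs:
  "pr (lab N q) (\<lambda>f. \<exists>X\<in>{X. X \<subseteq> {..<N} \<and> card X = t}. \<not> hubs_ok (ap f) X) \<le> 1 / 64"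
proof -
  have "pr (lab N q) (\<lambda>f. \<exists>X\<in>{X. X \<subseteq> {..<N} \<and> card X = t}. \<not> hubs_ok (ap f) X)
    \<le> pr (lab N q) (\<lambda>f. \<exists>h\<in>{10..t}. \<exists>X\<in>{X. X \<subseteq> {..<N} \<and> card X = t}. 4 * t < h * card {w\<in>{..<N}. h \<le> ap f X w})"
    by (intro pr_mono) (auto simp: hubs_ok_def not_le)
  also have "\<dots> \<le> card {10..t} * exp (- 2 * L)"
    by (rule pr_Ex_le) (use pr_many_hubs in auto)
  also have "\<dots> \<le> exp (L / 10) * exp (- 2 * L)"
    using t_exp t_ge by (intro mult_right_mono) auto
  also have "\<dots> \<le> exp (- L)" using L_ge by (simp add: exp_add[symmetric])
  also have "\<dots> \<le> 1 / 64" using q_ge unfolding inverse_q[symmetric] by (subst divide_le_eq) auto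
  finally show ?thesis .
qed

section \<open>Paths of length two into a sample\<close>

definition aa :: "labelling \<Rightarrow> nat set \<Rightarrow> nat \<Rightarrow> nat" where
  "aa f X w = ap f X w + am f X w"

text \<open>Hubs, that is vertices with very many neighbours in \<open>X\<close>, are truncated to 0: the exponential moments
  of the number of paths of length 2 into \<open>X\<close> are bounded only without them, and the few hubs are
  treated separately.\<close>

definition cut :: "labelling \<Rightarrow> nat set \<Rightarrow> nat \<Rightarrow> nat" where
  "cut f X w = (if 96 * aa f X w < t then aa f X w else 0)"

text \<open>Intermediate cells in \<open>X\<close> are left out: for \<open>z\<close> outside
  \<open>X\<close>, the labels \<open>(z, w)\<close> are then independent of those that determine
  \<open>cut f X\<close>.\<close>

definition Tp :: "labelling \<Rightarrow> nat set \<Rightarrow> nat \<Rightarrow> nat" where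
  "Tp f X z = (\<Sum>w\<in>{..<N} - X. if f (z, w) = 0 then cut f X w else 0)"

text \<open>This depends only on labels of pairs that meet \<open>X\<close>, so it can be decided
  when these are exposed and all other labels are still random.\<close>

definition hyp :: "labelling \<Rightarrow> nat set \<Rightarrow> bool" where
  "hyp f X \<longleftrightarrow> (\<Sum>w<N. aa f X w) \<le> 2 * t * d0 \<and> hubs_ok (ap f) X \<and> hubs_ok (am f) X"

lemma t_pos: "0 < t" using t_ge L_ge by (cases t) auto

text \<open>The threshold is at least 10 because \<open>960 * L \<le> t\<close>, hence a scale
  covered by \<open>hubs_ok\<close>, and \<open>4 * t\<close> divided by it is
  \<open>384 * L\<close>.\<close>

lemma card_medium:
  assumes "hubs_ok a X"
  shows "card {w\<in>{..<N}. t / (96 * L) < a X w} \<le> 384 * L"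
proof -
  define h where "h = nat \<lceil>t / (96 * L)\<rceil>"
  have "10 \<le> t / (96 * L)" using t_ge L_ge by (simp add: field_simps)
  then have h10: "10 \<le> h" unfolding h_def by linarith
  have "t / (96 * L) \<le> t" using L_ge by (simp add: divide_le_eq mult_le_cancel_left1)
  then have ht: "h \<le> t" unfolding h_def by (simp add: ceiling_le_iff)
  have hge: "t / (96 * L) \<le> h" unfolding h_def by linarith
  have "card {w\<in>{..<N}. t / (96 * L) < a X w} \<le> card {w\<in>{..<N}. h \<le> a X w}"
    by (intro card_mono) (auto simp: h_def ceiling_le_iff)
  moreover have "h * card {w\<in>{..<N}. h \<le> a X w} \<le> 4 * t"
    using assms h10 ht by (auto simp: hubs_ok_def)
  ultimately have "h * card {w\<in>{..<N}. t / (96 * L) < a X w} \<le> 4 * t"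
    by (meson le_trans mult_le_mono2)
  then have "real h * card {w\<in>{..<N}. t / (96 * L) < a X w} \<le> 4 * t"
    by (metis of_nat_le_iff of_nat_mult of_nat_numeral)
  moreover have "t / (96 * L) * card {w\<in>{..<N}. t / (96 * L) < a X w}
     \<le> real h * card {w\<in>{..<N}. t / (96 * L) < a X w}"
    using hge by (intro mult_right_mono) auto
  ultimately have "t / (96 * L) * card {w\<in>{..<N}. t / (96 * L) < a X w} \<le> 4 * t" by linarith
  then show ?thesis using t_pos L_ge by (simp add: field_simps)
qed

lemma sqrt_q: "exp (L / 2) \<le> q / 10000"
proof -
  have sq: "exp (L / 2) * exp (L / 2) = q" by (simp add: exp_add[symmetric] q_exp)
  have "10000 \<le> exp (L / 2)"
  proof (rule ccontr)
    assume "\<not> 10000 \<le> exp (L / 2)"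
    then have "exp (L / 2) * exp (L / 2) < 10000 * 10000"
      by (intro mult_strict_mono) auto
    then show False using sq q_ge by simp
  qed
  then have "10000 * exp (L / 2) \<le> exp (L / 2) * exp (L / 2)" by (intro mult_right_mono) auto
  then show ?thesis using sq by simp
qed

text \<open>Where the exponent is at most 1, \<open>exp\<close> is linearised and the sum is
  controlled by the degrees. Elsewhere one direction has more than \<open>t / (96 * L)\<close> arcs,
  which leaves at most \<open>768 * L\<close> cells, and the truncation at \<open>t / 96\<close>
  keeps each term below \<open>exp (L / 2)\<close>, the square root of \<open>q\<close>.\<close>

lemma sum_exp_cut:
  assumes X: "X \<subseteq> {..<N}" and hyp: "hyp f X"
  shows "(\<Sum>w\<in>{..<N} - X. exp (48 * L / t * cut f X w) - 1) \<le> q * L"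
proof -
  define r where "r = 48 * L / t"
  have r: "0 < r" using L_ge t_pos by (simp add: r_def)
  define M where "M = {w\<in>{..<N}. t / (96 * L) < ap f X w} \<union> {w\<in>{..<N}. t / (96 * L) < am f X w}"
  have finM: "finite M" by (simp add: M_def)
  have "card M \<le> card {w\<in>{..<N}. t / (96 * L) < ap f X w} + card {w\<in>{..<N}. t / (96 * L) < am f X w}"
    unfolding M_def by (rule card_Un_le)
  moreover have "card {w\<in>{..<N}. t / (96 * L) < ap f X w} \<le> 384 * L"
    "card {w\<in>{..<N}. t / (96 * L) < am f X w} \<le> 384 * L"
    using hyp card_medium unfolding hyp_def by blast+
  ultimately have cM: "card M \<le> 768 * L" by linarith
  have each: "exp (r * cut f X w) - 1 \<le> 2 * r * aa f X w + (if w \<in> M then exp (L / 2) else 0)"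
    if w: "w \<in> {..<N} - X" for w
  proof (cases "96 * aa f X w < t")
    case False
    then show ?thesis using r by (simp add: cut_def)
  next
    case True
    then have c: "cut f X w = aa f X w" by (simp add: cut_def)
    show ?thesis
    proof (cases "r * aa f X w \<le> 1")
      case le: True
      have "exp (r * aa f X w) \<le> 1 + r * aa f X w + (r * aa f X w)\<^sup>2"
        using le r by (intro exp_bound) auto
      also have "(r * aa f X w)\<^sup>2 \<le> r * aa f X w"
        unfolding power2_eq_square using le r by (intro mult_left_le) auto
      finally have "exp (r * aa f X w) - 1 \<le> 2 * r * aa f X w" by simp
      then show ?thesis unfolding c by (smt (verit) exp_ge_zero)
    next
      case gt: False
      then have "t / (48 * L) < aa f X w" using L_ge t_pos by (simp add: r_def field_simps)
      then have "t / (96 * L) < ap f X w \<or> t / (96 * L) < am f X w"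
        unfolding aa_def by (simp add: field_simps) linarith
      then have m: "w \<in> M" using w by (auto simp: M_def)
      have "real (aa f X w) \<le> t / 96" using True by linarith
      then have "r * aa f X w \<le> r * (t / 96)" using r by (intro mult_left_mono) auto
      also have "\<dots> = L / 2" using t_pos by (simp add: r_def)
      finally have "exp (r * aa f X w) \<le> exp (L / 2)" by simp
      moreover have "0 \<le> 2 * r * aa f X w" using r by simp
      ultimately show ?thesis unfolding c using m by (smt (verit))
    qed
  qed
  have "(\<Sum>w\<in>{..<N} - X. exp (r * cut f X w) - 1)
     \<le> (\<Sum>w\<in>{..<N} - X. 2 * r * aa f X w + (if w \<in> M then exp (L / 2) else 0))"
    by (intro sum_mono each)
  also have "\<dots> = 2 * r * (\<Sum>w\<in>{..<N} - X. real (aa f X w)) + (\<Sum>w\<in>{..<N} - X. if w \<in> M then exp (L / 2) else 0)"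
    by (simp add: sum.distrib sum_distrib_left)
  also have "\<dots> \<le> 2 * r * (2 * real t * real d0) + card M * exp (L / 2)"
  proof (intro add_mono mult_left_mono)
    have "(\<Sum>w\<in>{..<N} - X. real (aa f X w)) \<le> (\<Sum>w<N. real (aa f X w))"
      by (intro sum_mono2) auto
    also have "\<dots> \<le> real (2 * t * d0)" using hyp unfolding hyp_def of_nat_sum[symmetric] by linarith
    finally show "(\<Sum>w\<in>{..<N} - X. real (aa f X w)) \<le> 2 * real t * real d0" by simp
    have "(\<Sum>w\<in>{..<N} - X. if w \<in> M then exp (L / 2) else 0) = card (({..<N} - X) \<inter> M) * exp (L / 2)"
      by (simp add: sum.If_cases Int_def)
    also have "\<dots> \<le> card M * exp (L / 2)" using finM by (intro mult_right_mono of_nat_mono card_mono) auto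
    finally show "(\<Sum>w\<in>{..<N} - X. if w \<in> M then exp (L / 2) else 0) \<le> card M * exp (L / 2)" .
  qed (use r in auto)
  also have "\<dots> \<le> 192 * L * d0 + 768 * L * (q / 10000)"
  proof (rule add_mono)
    show "2 * r * (2 * real t * real d0) \<le> 192 * L * d0" using t_pos by (simp add: r_def)
    show "card M * exp (L / 2) \<le> 768 * L * (q / 10000)"
      by (rule mult_mono) (use cM sqrt_q L_ge in auto)
  qed
  also have "\<dots> = L * (192 * real d0 + 768 * real q / 10000)" by (simp add: algebra_simps)
  also have "\<dots> \<le> L * real q"
  proof (intro mult_left_mono)
    show "192 * real d0 + 768 * real q / 10000 \<le> real q" using d0 q_ge by linarith
  qed (use L_ge in auto)
  finally show ?thesis unfolding r_def by (simp add: mult.commute)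
qed

lemma hyp_cong:
  assumes "\<And>w. w < N \<Longrightarrow> ap f X w = ap g X w" "\<And>w. w < N \<Longrightarrow> am f X w = am g X w"
  shows "hyp f X = hyp g X"
proof -
  have "{w\<in>{..<N}. h \<le> ap f X w} = {w\<in>{..<N}. h \<le> ap g X w}"
    "{w\<in>{..<N}. h \<le> am f X w} = {w\<in>{..<N}. h \<le> am g X w}" for h
    using assms by auto
  moreover have "(\<Sum>w<N. aa f X w) = (\<Sum>w<N. aa g X w)" using assms by (simp add: aa_def)
  ultimately show ?thesis by (simp add: hyp_def hubs_ok_def)
qed

text \<open>The arcs meeting \<open>X\<close> are exposed first and fix the weights; the others stay
  independent. At rate \<open>48 * L / t\<close> the event needs total weight
  \<open>6 * L * t\<close>, the exponential moment costs \<open>L * t\<close> by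
  \<open>sum_exp_cut\<close>, and the remaining \<open>5 * L * t\<close> exceeds the
  \<open>4 * L * t\<close> spent on choosing \<open>X\<close> and \<open>Z\<close>.\<close>

lemma pr_Tp:
  assumes X: "X \<subseteq> {..<N}" "card X = t" and Z: "Z \<subseteq> {..<N} - X" "card Z = t"
  shows "pr (lab N q) (\<lambda>f. hyp f X \<and> (\<forall>z\<in>Z. t \<le> 8 * Tp f X z)) \<le> exp (- (5 * L * t))"
proof -
  define I1 where "I1 = ({..<N} - X) \<times> ({..<N} - X)"
  define I0 where "I0 = {..<N} \<times> {..<N} - I1"
  have U: "{..<N} \<times> {..<N} = I0 \<union> I1" by (auto simp: I0_def I1_def)
  have fin: "finite I0" "finite I1" by (auto simp: I0_def I1_def)
  define r where "r = 48 * L / t"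
  have r: "0 < r" using L_ge t_pos by (simp add: r_def)
  have "pr ((I0 \<union> I1) \<rightarrow>\<^sub>E {..<q}) (\<lambda>f. hyp f X \<and> (\<forall>z\<in>Z. t \<le> 8 * Tp f X z)) \<le> exp (- (5 * L * t))"
  proof (rule pr_PiE_cond)
    fix g assume g: "g \<in> I0 \<rightarrow>\<^sub>E {..<q}"
    have apm: "ap (mrg I0 g h) X w = ap g X w" "am (mrg I0 g h) X w = am g X w" if "w < N" for h w
    proof -
      have "(w, y) \<in> I0" "(y, w) \<in> I0" if "y \<in> X" for y
        using X \<open>w < N\<close> that by (auto simp: I0_def I1_def)
      then show "ap (mrg I0 g h) X w = ap g X w" "am (mrg I0 g h) X w = am g X w"
        by (auto simp: ap_def am_def mrg_def intro!: arg_cong[of _ _ card])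
    qed
    have hc: "hyp (mrg I0 g h) X = hyp g X" for h by (intro hyp_cong apm)
    have cc: "cut (mrg I0 g h) X w = cut g X w" if "w < N" for h w
      using apm[OF that] by (simp add: cut_def aa_def)
    show "pr (I1 \<rightarrow>\<^sub>E {..<q}) (\<lambda>h. hyp (mrg I0 g h) X \<and> (\<forall>z\<in>Z. t \<le> 8 * Tp (mrg I0 g h) X z))
       \<le> exp (- (5 * L * t))"
    proof (cases "hyp g X")
      case False
      then show ?thesis unfolding hc by simp
    next
      case True
      define c where "c = (\<lambda>(z, w). if z \<in> Z then r * cut g X w else 0)"
      have "pr (I1 \<rightarrow>\<^sub>E {..<q}) (\<lambda>h. hyp (mrg I0 g h) X \<and> (\<forall>z\<in>Z. t \<le> 8 * Tp (mrg I0 g h) X z))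
        \<le> pr (I1 \<rightarrow>\<^sub>E {..<q}) (\<lambda>h. 6 * L * t \<le> (\<Sum>e\<in>I1. if h e = 0 then c e else 0))"
      proof (rule pr_mono)
        fix h assume h: "hyp (mrg I0 g h) X \<and> (\<forall>z\<in>Z. t \<le> 8 * Tp (mrg I0 g h) X z)"
        have tz: "t / 8 \<le> (\<Sum>w\<in>{..<N} - X. if h (z, w) = 0 then real (cut g X w) else 0)" if z: "z \<in> Z" for z
        proof -
          have "Tp (mrg I0 g h) X z = (\<Sum>w\<in>{..<N} - X. if h (z, w) = 0 then cut g X w else 0)"
            unfolding Tp_def
          proof (intro sum.cong refl)
            fix w assume w: "w \<in> {..<N} - X"
            then have "(z, w) \<notin> I0" using z Z by (auto simp: I0_def I1_def)
            then show "(if mrg I0 g h (z, w) = 0 then cut (mrg I0 g h) X w else 0)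
               = (if h (z, w) = 0 then cut g X w else 0)" using w cc[of w h] by (simp add: mrg_def)
          qed
          then have "real (Tp (mrg I0 g h) X z) = (\<Sum>w\<in>{..<N} - X. if h (z, w) = 0 then real (cut g X w) else 0)"
            by (simp add: if_distrib cong: if_cong)
          moreover have "t \<le> 8 * Tp (mrg I0 g h) X z" using h z by blast
          ultimately show ?thesis by linarith
        qed
        have "6 * L * t = (\<Sum>z\<in>Z. r * (t / 8))" using Z t_pos by (simp add: r_def)
        also have "\<dots> \<le> (\<Sum>z\<in>Z. r * (\<Sum>w\<in>{..<N} - X. if h (z, w) = 0 then real (cut g X w) else 0))"
          using tz r by (intro sum_mono mult_left_mono) auto
        also have "\<dots> = (\<Sum>z\<in>Z. \<Sum>w\<in>{..<N} - X. if h (z, w) = 0 then c (z, w) else 0)"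
          by (intro sum.cong) (auto simp: c_def sum_distrib_left intro!: sum.cong)
        also have "\<dots> \<le> (\<Sum>z\<in>{..<N} - X. \<Sum>w\<in>{..<N} - X. if h (z, w) = 0 then c (z, w) else 0)"
          using Z r by (intro sum_mono2 sum_nonneg) (auto simp: c_def)
        also have "\<dots> = (\<Sum>e\<in>I1. if h e = 0 then c e else 0)"
          unfolding I1_def by (subst sum.cartesian_product) (auto intro!: sum.cong)
        finally show "6 * L * t \<le> (\<Sum>e\<in>I1. if h e = 0 then c e else 0)" .
      qed (use fin in \<open>auto intro: finite_PiE\<close>)
      also have "\<dots> \<le> exp (- (6 * L * t) + (\<Sum>e\<in>I1. exp (c e) - 1) / q)"
        by (rule pr_weighted[OF fin(2) q_pos])
      also have "(\<Sum>e\<in>I1. exp (c e) - 1) = (\<Sum>z\<in>{..<N} - X. \<Sum>w\<in>{..<N} - X. exp (c (z, w)) - 1)"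
        unfolding I1_def by (subst sum.cartesian_product) (auto intro!: sum.cong)
      also have "\<dots> = (\<Sum>z\<in>Z. \<Sum>w\<in>{..<N} - X. exp (c (z, w)) - 1)"
        using Z by (intro sum.mono_neutral_right) (auto simp: c_def)
      also have "\<dots> = (\<Sum>z\<in>Z. \<Sum>w\<in>{..<N} - X. exp (r * cut g X w) - 1)"
        by (intro sum.cong) (auto simp: c_def)
      also have "- (6 * L * t) + (\<Sum>z\<in>Z. \<Sum>w\<in>{..<N} - X. exp (r * cut g X w) - 1) / q
          \<le> - (6 * L * t) + (t * (q * L)) / q"
        using sum_exp_cut[OF X(1) True] Z
        by (intro add_left_mono divide_right_mono) (auto simp: r_def intro!: mult_left_mono)
      also have "\<dots> = - (5 * L * t)" using q_pos by (simp add: algebra_simps)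
      finally show ?thesis by simp
    qed
  qed (use fin in \<open>auto simp: I0_def\<close>)
  then show ?thesis unfolding lab_def U .
qed

lemma pr_Tp_all:
  "pr (lab N q) (\<lambda>f. \<exists>X\<in>{X. X \<subseteq> {..<N} \<and> card X = t}. \<exists>Z\<in>{Z. Z \<subseteq> {..<N} - X \<and> card Z = t}.
     hyp f X \<and> (\<forall>z\<in>Z. t \<le> 8 * Tp f X z)) \<le> 1 / 64" (is "?p \<le> _")
proof -
  have fin: "finite {X. X \<subseteq> {..<N} - Y \<and> card X = m}" for m Y
    by (rule finite_subset[of _ "Pow {..<N}"]) auto
  have le: "card {X. X \<subseteq> {..<N} - Y \<and> card X = t} \<le> exp (2 * L * t)" for Y
  proof -
    have "card {X. X \<subseteq> {..<N} - Y \<and> card X = t} \<le> card {X. X \<subseteq> {..<N} \<and> card X = t}"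
      using fin[of "{}"] by (intro card_mono) auto
    then show ?thesis using order_trans[OF choose_le_power N_pow] by (simp add: n_subsets) (metis of_nat_le_iff order_trans)
  qed
  have "?p \<le> card {X. X \<subseteq> {..<N} \<and> card X = t} * (exp (2 * L * t) * exp (- (5 * L * t)))"
  proof (rule pr_Ex_le)
    fix X assume X: "X \<in> {X. X \<subseteq> {..<N} \<and> card X = t}"
    have "pr (lab N q) (\<lambda>f. \<exists>Z\<in>{Z. Z \<subseteq> {..<N} - X \<and> card Z = t}. hyp f X \<and> (\<forall>z\<in>Z. t \<le> 8 * Tp f X z))
      \<le> card {Z. Z \<subseteq> {..<N} - X \<and> card Z = t} * exp (- (5 * L * t))"
      by (rule pr_Ex_le) (use X fin pr_Tp in auto)
    also have "\<dots> \<le> exp (2 * L * t) * exp (- (5 * L * t))" using le by (intro mult_right_mono) auto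
    finally show "pr (lab N q) (\<lambda>f. \<exists>Z\<in>{Z. Z \<subseteq> {..<N} - X \<and> card Z = t}. hyp f X \<and> (\<forall>z\<in>Z. t \<le> 8 * Tp f X z))
      \<le> exp (2 * L * t) * exp (- (5 * L * t))" .
  qed (use fin[of "{}"] in auto)
  also have "\<dots> \<le> exp (2 * L * t) * (exp (2 * L * t) * exp (- (5 * L * t)))"
    using le[of "{}"] by (intro mult_right_mono) auto
  also have "\<dots> = exp (- (L * t))" by (simp add: exp_add[symmetric] algebra_simps)
  also have "\<dots> \<le> exp (- L)" using L_ge t_pos by (simp add: mult_le_cancel_left1)
  also have "\<dots> \<le> 1 / 64" using q_ge unfolding inverse_q[symmetric] by (subst divide_le_eq) auto
  finally show ?thesis .
qed

lemma sum_ap: "finite X \<Longrightarrow> (\<Sum>w<N. ap f X w) = (\<Sum>y\<in>X. am f {..<N} y)"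
proof -
  assume X: "finite X"
  have "(\<Sum>w<N. ap f X w) = (\<Sum>w<N. \<Sum>y\<in>X. if f (w, y) = 0 then 1 else 0)"
    using X by (simp add: ap_def sum.If_cases Int_def)
  also have "\<dots> = (\<Sum>y\<in>X. \<Sum>w<N. if f (w, y) = 0 then 1 else 0)" by (rule sum.swap)
  also have "\<dots> = (\<Sum>y\<in>X. am f {..<N} y)" by (simp add: am_def sum.If_cases Int_def)
  finally show ?thesis .
qed

lemma card_adj_le: "finite X \<Longrightarrow> card {y\<in>X. adj f w y} \<le> aa f X w"
proof -
  assume "finite X"
  then have "card {y\<in>X. adj f w y} \<le> card ({y\<in>X. f (w, y) = 0} \<union> {y\<in>X. f (y, w) = 0})"
    by (intro card_mono) (auto simp: adj_def)
  also have "\<dots> \<le> aa f X w" unfolding aa_def ap_def am_def by (rule card_Un_le)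
  finally show ?thesis .
qed

lemma card_hub:
  assumes "hubs_ok a X" "10 \<le> h" "h \<le> t"
  shows "h * card {w\<in>{..<N}. h \<le> a X w} \<le> 4 * t"
  using assms by (auto simp: hubs_ok_def)

text \<open>A cell outside the five exceptional sets sees less than half of \<open>X\<close>: it has
  no hub as a neighbour, at most 20 intermediate cells in \<open>X\<close> give at most
  \<open>20 * t / 96\<close> together, and the cells outside \<open>X\<close> give less than
  \<open>t / 8\<close> for each direction of the first arc, in all
  \<open>44 * t / 96\<close>.\<close>

lemma GoodI:
  assumes out: "\<And>x. x < N \<Longrightarrow> ap f {..<N} x < d0" and inn: "\<And>x. x < N \<Longrightarrow> am f {..<N} x < d0"
    and hubs: "\<And>X. X \<subseteq> {..<N} \<Longrightarrow> card X = t \<Longrightarrow> hubs_ok (ap f) X \<and> hubs_ok (am f) X"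
    and noTp: "\<And>X Z. X \<subseteq> {..<N} \<Longrightarrow> card X = t \<Longrightarrow> Z \<subseteq> {..<N} - X \<Longrightarrow> card Z = t \<Longrightarrow> hyp f X
       \<Longrightarrow> \<exists>z\<in>Z. 8 * Tp f X z < t"
    and noTm: "\<And>X Z. X \<subseteq> {..<N} \<Longrightarrow> card X = t \<Longrightarrow> Z \<subseteq> {..<N} - X \<Longrightarrow> card Z = t \<Longrightarrow> hyp f X
       \<Longrightarrow> \<exists>z\<in>Z. 8 * Tp (flip f) X z < t"
  shows "Good N q t f"
  unfolding Good_def
proof (intro allI impI)
  fix X assume X: "X \<subseteq> {..<N}" "card X = t"
  have fX: "finite X" using X(1) by (rule finite_subset) auto
  have hyp: "hyp f X"
  proof -
    have "(\<Sum>w<N. ap f X w) \<le> t * d0"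
    proof -
      have "(\<Sum>y\<in>X. am f {..<N} y) \<le> (\<Sum>y\<in>X. d0)" using X inn by (intro sum_mono) (auto intro: less_imp_le)
      then show ?thesis using sum_ap[OF fX, of f] X by simp
    qed
    moreover have "(\<Sum>w<N. am f X w) \<le> t * d0"
    proof -
      have "(\<Sum>y\<in>X. ap f {..<N} y) \<le> (\<Sum>y\<in>X. d0)" using X out by (intro sum_mono) (auto intro: less_imp_le)
      then show ?thesis using sum_ap[OF fX, of "flip f"] X by simp
    qed
    ultimately show ?thesis using hubs[OF X] by (simp add: hyp_def aa_def sum.distrib)
  qed
  have hp: "hubs_ok (ap f) X" and hm: "hubs_ok (am f) X" using hubs[OF X] by auto
  have t1920: "1920 \<le> t" using t_ge L_ge by linarith
  define Big where "Big = {w\<in>{..<N}. t \<le> 96 * aa f X w}"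
  define BigN where "BigN = (\<Union>w\<in>Big. {z\<in>{..<N}. adj f w z})"
  define Pop where "Pop = {z\<in>{..<N}. 20 \<le> aa f X z}"
  define Bp where "Bp = {z\<in>{..<N} - X. t \<le> 8 * Tp f X z}"
  define Bm where "Bm = {z\<in>{..<N} - X. t \<le> 8 * Tp (flip f) X z}"
  have cBig: "card Big \<le> 1536"
  proof -
    \<comment> \<open>At least \<open>t / 96\<close> arcs in both directions together mean at least
      \<open>t / 192\<close>, rounded up, in one of them.\<close>
    define h where "h = (t + 191) div 192"
    have h: "10 \<le> h" "h \<le> t" "t \<le> 192 * h" using t1920 by (auto simp: h_def)
    have hs: "192 * (h * c) \<le> 192 * (4 * t) \<Longrightarrow> c \<le> 768" for c
    proof -
      assume "192 * (h * c) \<le> 192 * (4 * t)"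
      moreover have "t * c \<le> 192 * (h * c)" using h(3) mult_le_mono1[of t "192 * h" c] by simp
      ultimately have "t * c \<le> t * 768" by linarith
      then show "c \<le> 768" using t_pos by simp
    qed
    have "card Big \<le> card ({w\<in>{..<N}. h \<le> ap f X w} \<union> {w\<in>{..<N}. h \<le> am f X w})"
      by (intro card_mono) (auto simp: Big_def h_def aa_def)
    also have "\<dots> \<le> card {w\<in>{..<N}. h \<le> ap f X w} + card {w\<in>{..<N}. h \<le> am f X w}"
      by (rule card_Un_le)
    also have "\<dots> \<le> 768 + 768"
      using card_hub[OF hp h(1,2)] card_hub[OF hm h(1,2)] by (intro add_mono hs mult_le_mono2)
    finally show ?thesis by simp
  qed
  have cN: "card {z\<in>{..<N}. adj f w z} \<le> 2 * d0" if "w < N" for w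
    using card_adj_le[of "{..<N}" f w] out[OF that] inn[OF that] by (simp add: aa_def)
  have cBigN: "card BigN \<le> 1536 * (2 * d0)"
  proof -
    have "card BigN \<le> (\<Sum>w\<in>Big. card {z\<in>{..<N}. adj f w z})"
      unfolding BigN_def by (rule card_UN_le) (simp add: Big_def)
    also have "\<dots> \<le> (\<Sum>w\<in>Big. 2 * d0)" using cN by (intro sum_mono) (auto simp: Big_def)
    also have "\<dots> \<le> 1536 * (2 * d0)" using cBig by simp
    finally show ?thesis .
  qed
  have cPop: "card Pop \<le> t"
  proof -
    have "card Pop \<le> card ({w\<in>{..<N}. 10 \<le> ap f X w} \<union> {w\<in>{..<N}. 10 \<le> am f X w})"
      by (intro card_mono) (auto simp: Pop_def aa_def)
    also have "\<dots> \<le> card {w\<in>{..<N}. 10 \<le> ap f X w} + card {w\<in>{..<N}. 10 \<le> am f X w}"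
      by (rule card_Un_le)
    finally show ?thesis using card_hub[OF hp, of 10] card_hub[OF hm, of 10] t1920 by simp
  qed
  have cBp: "card Bp < t"
  proof (rule ccontr)
    assume "\<not> card Bp < t"
    then have "t \<le> card Bp" by simp
    then obtain Z where Z: "Z \<subseteq> Bp" "card Z = t" by (rule obtain_subset_with_card_n)
    then show False using noTp[OF X, of Z] hyp by (auto simp: Bp_def not_less[symmetric])
  qed
  have cBm: "card Bm < t"
  proof (rule ccontr)
    assume "\<not> card Bm < t"
    then have "t \<le> card Bm" by simp
    then obtain Z where Z: "Z \<subseteq> Bm" "card Z = t" by (rule obtain_subset_with_card_n)
    then show False using noTm[OF X, of Z] hyp by (auto simp: Bm_def not_less[symmetric])
  qed
  have sub: "Bad N f X \<subseteq> X \<union> BigN \<union> Pop \<union> Bp \<union> Bm"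
  proof (rule ccontr)
    assume "\<not> ?thesis"
    then obtain z where z: "z \<in> Bad N f X" "z \<notin> X" "z \<notin> BigN" "z \<notin> Pop" "z \<notin> Bp" "z \<notin> Bm" by blast
    have zN: "z < N" using z by (simp add: Bad_def)
    define W where "W = {w\<in>{..<N}. adj f z w}"
    have small: "96 * aa f X w < t" if "w \<in> W" for w
      using that z(3) zN adj_sym[of f z w] by (fastforce simp: W_def BigN_def Big_def not_le[symmetric])
    have "card {y\<in>X. \<exists>w<N. adj f z w \<and> adj f w y} \<le> card (\<Union>w\<in>W. {y\<in>X. adj f w y})"
      using fX by (intro card_mono) (auto simp: W_def)
    also have "\<dots> \<le> (\<Sum>w\<in>W. card {y\<in>X. adj f w y})" by (rule card_UN_le) (simp add: W_def)
    also have "\<dots> \<le> (\<Sum>w\<in>W. aa f X w)" by (intro sum_mono card_adj_le fX)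
    also have "\<dots> = (\<Sum>w\<in>W \<inter> X. aa f X w) + (\<Sum>w\<in>W - X. aa f X w)"
      using sum.Int_Diff[of W "aa f X" X] by (simp add: W_def)
    finally have le: "card {y\<in>X. \<exists>w<N. adj f z w \<and> adj f w y} \<le> (\<Sum>w\<in>W \<inter> X. aa f X w) + (\<Sum>w\<in>W - X. aa f X w)" .
    have "(\<Sum>w\<in>W \<inter> X. 96 * aa f X w) \<le> (\<Sum>w\<in>W \<inter> X. t)"
      using small by (intro sum_mono) (auto intro: less_imp_le)
    also have "\<dots> \<le> 20 * t"
    proof -
      have "card (W \<inter> X) \<le> card {y\<in>X. adj f z y}" using fX by (intro card_mono) (auto simp: W_def)
      then have "card (W \<inter> X) \<le> 20" using card_adj_le[OF fX, of f z] z(4) zN by (simp add: Pop_def)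
      then show ?thesis by simp
    qed
    finally have A: "96 * (\<Sum>w\<in>W \<inter> X. aa f X w) \<le> 20 * t" by (simp add: sum_distrib_left)
    have tr: "cut (flip f) X = cut f X" by (simp add: cut_def aa_def fun_eq_iff)
    have "(\<Sum>w\<in>W - X. aa f X w) = (\<Sum>w\<in>W - X. cut f X w)"
      using small by (intro sum.cong) (auto simp: cut_def)
    also have "\<dots> \<le> (\<Sum>w\<in>W - X. (if f (z, w) = 0 then cut f X w else 0) + (if f (w, z) = 0 then cut f X w else 0))"
      by (intro sum_mono) (auto simp: W_def adj_def)
    also have "\<dots> \<le> (\<Sum>w\<in>{..<N} - X. (if f (z, w) = 0 then cut f X w else 0) + (if f (w, z) = 0 then cut f X w else 0))"
      by (intro sum_mono2) (auto simp: W_def)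
    also have "\<dots> = Tp f X z + Tp (flip f) X z" unfolding Tp_def tr sum.distrib by simp
    finally have B: "(\<Sum>w\<in>W - X. aa f X w) \<le> Tp f X z + Tp (flip f) X z" .
    have "8 * Tp f X z < t" "8 * Tp (flip f) X z < t" using z zN by (auto simp: Bp_def Bm_def not_le)
    then have "2 * card {y\<in>X. \<exists>w<N. adj f z w \<and> adj f w y} < t" using le A B t_pos by linarith
    then show False using z(1) X by (simp add: Bad_def)
  qed
  have fin: "finite (X \<union> BigN \<union> Pop \<union> Bp \<union> Bm)"
    using fX by (auto simp: BigN_def Big_def Pop_def Bp_def Bm_def)
  have "card (Bad N f X) \<le> card (X \<union> BigN \<union> Pop \<union> Bp \<union> Bm)" by (rule card_mono[OF fin sub])
  also have "\<dots> \<le> card X + card BigN + card Pop + card Bp + card Bm"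
    by (meson add_le_mono1 card_Un_le order_trans)
  also have "\<dots> \<le> t + 1536 * (2 * d0) + t + t + t" using X cBigN cPop cBp cBm by linarith
  \<comment> \<open>The neighbours of hubs dominate: \<open>3072 * d0\<close> is at most
    \<open>7.68 * q + 3072\<close>, and the rest is absorbed by
    \<open>4 * t \<le> t ^ 10 \<le> q\<close> and the size of \<open>q\<close>.\<close>
  also have "\<dots> \<le> 10 * q"
  proof -
    have "t * 4 \<le> t ^ 10"
    proof -
      have "4 ^ 9 \<le> t ^ 9" using t1920 by (intro power_mono) auto
      then have "4 \<le> t ^ 9" by simp
      then have "t * 4 \<le> t * t ^ 9" by (rule mult_le_mono2)
      then show ?thesis by (simp add: power_Suc[symmetric] del: power_Suc)
    qed
    then show ?thesis using t10 d0 q_ge by linarith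
  qed
  finally show "card (Bad N f X) \<le> 10 * q" .
qed

lemma pr_not_Good: "pr (lab N q) (\<lambda>f. \<not> Good N q t f) \<le> 1 / 8"
proof -
  let ?X = "{X. X \<subseteq> {..<N} \<and> card X = t}"
  let ?E1 = "\<lambda>f. \<exists>x<N. d0 \<le> ap f {..<N} x"
  let ?E2 = "\<lambda>f. \<exists>X\<in>?X. \<not> hubs_ok (ap f) X"
  let ?E3 = "\<lambda>f. \<exists>X\<in>?X. \<exists>Z\<in>{Z. Z \<subseteq> {..<N} - X \<and> card Z = t}. hyp f X \<and> (\<forall>z\<in>Z. t \<le> 8 * Tp f X z)"
  have ht: "hyp (flip f) X = hyp f X" for f X by (auto simp: hyp_def aa_def add.commute)
  have "pr (lab N q) (\<lambda>f. \<not> Good N q t f)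
    \<le> pr (lab N q) (\<lambda>f. (?E1 f \<or> ?E1 (flip f)) \<or> (?E2 f \<or> ?E2 (flip f)) \<or> (?E3 f \<or> ?E3 (flip f)))"
  proof (rule pr_mono)
    fix f assume ng: "\<not> Good N q t f"
    show "(?E1 f \<or> ?E1 (flip f)) \<or> (?E2 f \<or> ?E2 (flip f)) \<or> (?E3 f \<or> ?E3 (flip f))"
    proof (rule ccontr)
      assume no: "\<not> ?thesis"
      have "Good N q t f"
      proof (rule GoodI)
        show "ap f {..<N} x < d0" if "x < N" for x using no that by (auto simp: not_le)
        show "am f {..<N} x < d0" if "x < N" for x using no that by (auto simp: not_le)
        show "hubs_ok (ap f) X \<and> hubs_ok (am f) X" if "X \<subseteq> {..<N}" "card X = t" for X using no that by auto
        show "\<exists>z\<in>Z. 8 * Tp f X z < t" if "X \<subseteq> {..<N}" "card X = t" "Z \<subseteq> {..<N} - X" "card Z = t" "hyp f X" for X Z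
        proof -
          have "\<not> (hyp f X \<and> (\<forall>z\<in>Z. t \<le> 8 * Tp f X z))" using no that(1-4) by blast
          then show ?thesis using that(5) by (auto simp: not_le)
        qed
        show "\<exists>z\<in>Z. 8 * Tp (flip f) X z < t" if "X \<subseteq> {..<N}" "card X = t" "Z \<subseteq> {..<N} - X" "card Z = t" "hyp f X" for X Z
        proof -
          have "\<not> (hyp (flip f) X \<and> (\<forall>z\<in>Z. t \<le> 8 * Tp (flip f) X z))" using no that(1-4) by blast
          then show ?thesis using that(5) by (auto simp: not_le ht)
        qed
      qed
      then show False using ng by simp
    qed
  qed simp
  also have "\<dots> \<le> (1 / 64 + 1 / 64) + ((1 / 64 + 1 / 64) + (1 / 64 + 1 / 64))"
    using outdeg hubs pr_Tp_all pr_lab_flip[of N q ?E1] pr_lab_flip[of N q ?E2] pr_lab_flip[of N q ?E3]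
    by (intro order.trans[OF pr_disj[OF finite_lab]] add_mono) auto
  finally show ?thesis by simp
qed

end

section \<open>Independent sets in a pair of copies\<close>

text \<open>A uniformly random sequence of length \<open>t\<close> works. Two given entries share a
  fibre with probability at most \<open>4 / s\<close>, so a repetition has probability at most 1/2.
  For a fixed \<open>u\<close>, at least half of the entries lie in \<open>B u\<close> with
  probability at most 2^t * 16^(-t/2) = 2^(-t), which adds up to at most 1/4 over
  \<open>Z\<close>.\<close>

lemma sampling:
  fixes g :: "'a \<Rightarrow> 'b"
  assumes A: "finite A" "A \<noteq> {}" and t: "0 < t" and s: "8 * t\<^sup>2 \<le> s"
    and fib: "\<And>x. s * card {v\<in>A. g v = x} \<le> 4 * card A"
    and Z: "finite Z" "4 * card Z \<le> 2 ^ t" and B: "\<And>u. u \<in> Z \<Longrightarrow> 16 * card (B u \<inter> A) \<le> card A"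
  shows "\<exists>V\<subseteq>A. card V = t \<and> inj_on g V \<and> (\<forall>u\<in>Z. 2 * card (V \<inter> B u) \<le> t)"
proof -
  let ?\<Omega> = "{..<t} \<rightarrow>\<^sub>E A"
  let ?C = "\<lambda>\<tau>. \<exists>ij\<in>{(i, j). i \<in> {..<t} \<and> j \<in> {..<t} \<and> i \<noteq> j}. \<forall>i\<in>{fst ij}. \<tau> i \<in> {v. g v = g (\<tau> (snd ij))}"
  let ?D = "\<lambda>\<tau>. \<exists>u\<in>Z. \<exists>I\<in>{I. I \<subseteq> {..<t} \<and> t \<le> 2 * card I}. \<forall>i\<in>I. \<tau> i \<in> B u"
  have fin\<Omega>: "finite ?\<Omega>" using A by (auto intro: finite_PiE)
  have s0: "0 < s" using s t by (metis gr_zeroI le_zero_eq mult_eq_0_iff power_eq_0_iff zero_neq_numeral less_irrefl)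
  have cA: "0 < card A" using A by (simp add: card_gt_0_iff)
  have "pr ?\<Omega> ?C \<le> card {(i, j). i \<in> {..<t} \<and> j \<in> {..<t} \<and> i \<noteq> j} * (4 / s)"
  proof (rule pr_Ex_le[OF fin\<Omega>])
    show "finite {(i, j). i \<in> {..<t} \<and> j \<in> {..<t} \<and> i \<noteq> j}"
      by (rule finite_subset[of _ "{..<t} \<times> {..<t}"]) auto
    fix ij assume ij: "ij \<in> {(i, j). i \<in> {..<t} \<and> j \<in> {..<t} \<and> i \<noteq> j}"
    have "pr ?\<Omega> (\<lambda>\<tau>. \<forall>i\<in>{fst ij}. \<tau> i \<in> {v. g v = g (\<tau> (snd ij))}) \<le> (4 / s) ^ card {fst ij}"
    proof (rule pr_PiE_dep)
      fix \<tau> :: "nat \<Rightarrow> 'a" and v assume "v \<in> {fst ij}"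
      have e: "{v. g v = g (\<tau> (snd ij))} \<inter> A = {v\<in>A. g v = g (\<tau> (snd ij))}" by auto
      have "real s * card {v\<in>A. g v = g (\<tau> (snd ij))} \<le> 4 * card A"
        using fib[of "g (\<tau> (snd ij))"] by (metis of_nat_le_iff of_nat_mult of_nat_numeral)
      then show "real (card ({v. g v = g (\<tau> (snd ij))} \<inter> A)) \<le> 4 / s * card A"
        unfolding e using s0 by (simp add: field_simps)
    next
      fix \<tau> \<tau>' :: "nat \<Rightarrow> 'a" assume "\<And>i. i \<in> {..<t} - {fst ij} \<Longrightarrow> \<tau> i = \<tau>' i"
      then have "\<tau> (snd ij) = \<tau>' (snd ij)" using ij by auto
      then show "{v. g v = g (\<tau> (snd ij))} = {v. g v = g (\<tau>' (snd ij))}" by simp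
    qed (use A ij in auto)
    then show "pr ?\<Omega> (\<lambda>\<tau>. \<forall>i\<in>{fst ij}. \<tau> i \<in> {v. g v = g (\<tau> (snd ij))}) \<le> 4 / s" by simp
  qed
  also have "\<dots> \<le> real (t * t) * (4 / s)"
  proof (intro mult_right_mono of_nat_mono)
    have "card {(i, j). i \<in> {..<t} \<and> j \<in> {..<t} \<and> i \<noteq> j} \<le> card ({..<t} \<times> {..<t})"
      by (intro card_mono) auto
    then show "card {(i, j). i \<in> {..<t} \<and> j \<in> {..<t} \<and> i \<noteq> j} \<le> t * t" by simp
  qed auto
  also have "\<dots> \<le> 1 / 2"
  proof -
    have "real (8 * (t * t)) \<le> real s" using s by (simp only: of_nat_le_iff power2_eq_square)
    then show ?thesis using s0 by (simp add: field_simps)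
  qed
  finally have pC: "pr ?\<Omega> ?C \<le> 1 / 2" .
  have "pr ?\<Omega> ?D \<le> card Z * (2 ^ t * (1 / 4) ^ t)"
  proof (rule pr_Ex_le[OF fin\<Omega> Z(1)])
    fix u assume u: "u \<in> Z"
    let ?I = "{I. I \<subseteq> {..<t} \<and> t \<le> 2 * card I}"
    have fI: "finite ?I" by (rule finite_subset[of _ "Pow {..<t}"]) auto
    have "pr ?\<Omega> (\<lambda>\<tau>. \<exists>I\<in>?I. \<forall>i\<in>I. \<tau> i \<in> B u) \<le> card ?I * (1 / 4) ^ t"
    proof (rule pr_Ex_le[OF fin\<Omega> fI])
      fix I assume I: "I \<in> ?I"
      have "pr ?\<Omega> (\<lambda>\<tau>. \<forall>i\<in>I. \<tau> i \<in> B u) \<le> (1 / 16) ^ card I"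
        using A I B[OF u] by (intro pr_PiE_all) (auto simp: of_nat_le_iff[symmetric, where ?'a = real] simp del: of_nat_le_iff)
      also have "\<dots> = (1 / 4) ^ (2 * card I)" by (simp add: power_mult power2_eq_square)
      also have "\<dots> \<le> (1 / 4) ^ t" using I by (intro power_decreasing) auto
      finally show "pr ?\<Omega> (\<lambda>\<tau>. \<forall>i\<in>I. \<tau> i \<in> B u) \<le> (1 / 4) ^ t" .
    qed
    also have "\<dots> \<le> 2 ^ t * (1 / 4) ^ t"
    proof (intro mult_right_mono)
      have "card ?I \<le> card (Pow {..<t})" by (intro card_mono) auto
      then show "real (card ?I) \<le> 2 ^ t" by (simp add: card_Pow)
    qed auto
    finally show "pr ?\<Omega> (\<lambda>\<tau>. \<exists>I\<in>?I. \<forall>i\<in>I. \<tau> i \<in> B u) \<le> 2 ^ t * (1 / 4) ^ t" .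
  qed
  also have "\<dots> = card Z / 2 ^ t" proof -
    have "(4::real) ^ t = 2 ^ t * 2 ^ t" by (simp flip: power_mult_distrib)
    then show ?thesis by (simp add: power_divide)
  qed
  also have "\<dots> \<le> 1 / 4"
  proof -
    have "real (4 * card Z) \<le> real (2 ^ t)" using Z(2) by (simp only: of_nat_le_iff)
    then show ?thesis by (simp add: field_simps)
  qed
  finally have "pr ?\<Omega> (\<lambda>\<tau>. ?C \<tau> \<or> ?D \<tau>) < 1" using pC pr_disj[OF fin\<Omega>, of ?C ?D] by linarith
  moreover have "pr ?\<Omega> (\<lambda>_. True) = 1" using A by (simp add: pr_def card_PiE)
  ultimately obtain \<tau> where \<tau>: "\<tau> \<in> ?\<Omega>" "\<not> ?C \<tau>" "\<not> ?D \<tau>"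
    using pr_mono[OF fin\<Omega>, of "\<lambda>_. True" "\<lambda>\<tau>. ?C \<tau> \<or> ?D \<tau>"] by fastforce
  have inj: "inj_on (g \<circ> \<tau>) {..<t}"
    using \<tau>(2) by (force simp: inj_on_def)
  then have inj\<tau>: "inj_on \<tau> {..<t}" and injg: "inj_on g (\<tau> ` {..<t})"
    by (auto simp: inj_on_def)
  show ?thesis
  proof (intro exI[of _ "\<tau> ` {..<t}"] conjI ballI)
    show "\<tau> ` {..<t} \<subseteq> A" using \<tau>(1) by auto
    show "card (\<tau> ` {..<t}) = t" using inj\<tau> by (simp add: card_image)
    fix u assume u: "u \<in> Z"
    have "\<tau> ` {..<t} \<inter> B u = \<tau> ` {i\<in>{..<t}. \<tau> i \<in> B u}" by auto
    then have "card (\<tau> ` {..<t} \<inter> B u) \<le> card {i\<in>{..<t}. \<tau> i \<in> B u}" by (simp add: card_image_le)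
    moreover have "\<not> t \<le> 2 * card {i\<in>{..<t}. \<tau> i \<in> B u}"
    proof
      assume "t \<le> 2 * card {i\<in>{..<t}. \<tau> i \<in> B u}"
      then have "\<exists>I\<in>{I. I \<subseteq> {..<t} \<and> t \<le> 2 * card I}. \<forall>i\<in>I. \<tau> i \<in> B u"
        by (intro bexI[of _ "{i\<in>{..<t}. \<tau> i \<in> B u}"]) auto
      then have "?D \<tau>" using u by (rule rev_bexI[rotated])
      then show False using \<tau>(3) by contradiction
    qed
    ultimately show "2 * card (\<tau> ` {..<t} \<inter> B u) \<le> t" by linarith
  qed (rule injg)
qed

definition closed :: "nat \<Rightarrow> labelling \<Rightarrow> nat \<Rightarrow> nat \<Rightarrow> bool" where
  "closed N f x y \<longleftrightarrow> (\<exists>w<N. adjs N f x w \<and> adjs N f y w)"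

type_synonym copy = "(nat \<Rightarrow> nat) \<times> labelling"

text \<open>A copy places the vertices in cells and labels the pairs of cells. The first copy closes every
  edge of the second one inside \<open>S\<close>, so \<open>S\<close> contains no edge that comes from the second copy.\<close>

definition half :: "nat \<Rightarrow> copy \<Rightarrow> copy \<Rightarrow> nat set \<Rightarrow> bool" where
  "half N a b S \<longleftrightarrow> (\<forall>u\<in>S. \<forall>v\<in>S. adjs N (snd b) (fst b u) (fst b v) \<longrightarrow> closed N (snd a) (fst a u) (fst a v))"

text \<open>\<open>pay\<close> lets the edges missing at one occupied cell contribute k^(-4). The
  assumptions \<open>sN\<close> and \<open>kN\<close> compare powers, with N of order k^2 up to
  logarithms, for concentrated and collapsed sets; \<open>Ns\<close> and \<open>qt\<close> absorb
  the choice of \<open>s\<close> cells and the loss of \<open>t\<close> vertices; \<open>kt\<close>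
  serves the union bound in \<open>sampling\<close>.\<close>

locale params = cells +
  fixes k s n :: nat
  assumes s: "s = 8 * t\<^sup>2" "s \<le> N"
    and qk: "q \<le> k"
    and pay: "48 * q * ln k \<le> k / 320 - 1"
    and k_le: "k \<le> 40000 * q * ln k"
    and N_ge: "(real q)\<^sup>2 \<le> 6000 * N"
    and sN: "s ^ 3 * N \<le> k ^ 3"
    and kN: "k ^ 39 \<le> N ^ 20" "k ^ 15 \<le> N ^ 8"
    and Ns: "real N ^ s \<le> 2 ^ k"
    and qt: "real q ^ t \<le> 2 ^ k"
    and kt: "4 * k \<le> 2 ^ t"
begin

definition Pos :: "(nat \<Rightarrow> nat) set" where "Pos = {..<n} \<rightarrow>\<^sub>E {..<N}"
definition \<Omega> :: "copy set" where "\<Omega> = Pos \<times> lab N q"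

lemma N_pos: "0 < N" using N_ge q_pos by (cases N) auto
lemma k_pos: "0 < k" using qk q_pos by linarith
lemma fin_Pos [simp]: "finite Pos" by (simp add: Pos_def finite_PiE)
lemma fin_Omega [simp]: "finite \<Omega>" by (simp add: \<Omega>_def)
lemma card_Pos: "0 < card Pos" using N_pos by (simp add: Pos_def card_PiE)

end

section \<open>One fixed vertex set: collapse, missing edges, concentration\<close>

locale sets = params +
  fixes S :: "nat set"
  assumes S: "S \<subseteq> {..<n}" "card S = k"
begin

lemma finS: "finite S" using S(1) finite_subset by blast

lemma fin_sub: "finite {B. B \<subseteq> {..<N} \<and> P B}"
  by (rule finite_subset[of _ "Pow {..<N}"]) auto

lemma fin_subS: "finite {B. B \<subseteq> S \<and> P B}"
  by (rule finite_subset[of _ "Pow S"]) (use finS in auto)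

lemma card_subS: "real (card {B. B \<subseteq> S \<and> P B}) \<le> 2 ^ k"
proof -
  have "card {B. B \<subseteq> S \<and> P B} \<le> card (Pow S)" by (intro card_mono) (use finS in auto)
  then show ?thesis using finS S(2) by (simp add: card_Pow)
qed

lemma pr_in_set:
  assumes "U \<subseteq> {..<n}" "B \<subseteq> {..<N}"
  shows "pr Pos (\<lambda>g. \<forall>u\<in>U. g u \<in> B) \<le> (card B / N) ^ card U"
proof -
  have "B \<inter> {..<N} = B" using assms by auto
  then show ?thesis unfolding Pos_def by (intro pr_PiE_all) (use assms N_pos in auto)
qed

lemma pr_image:
  assumes "U \<subseteq> {..<n}" "b \<le> N"
  shows "pr Pos (\<lambda>g. card (g ` U) \<le> b) \<le> real N ^ b * (b / N) ^ card U"
proof -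
  have "pr Pos (\<lambda>g. card (g ` U) \<le> b) \<le> pr Pos (\<lambda>g. \<exists>B\<in>{B. B \<subseteq> {..<N} \<and> card B = b}. \<forall>u\<in>U. g u \<in> B)"
  proof (rule pr_mono)
    fix g assume g: "g \<in> Pos" "card (g ` U) \<le> b"
    have "g ` U \<subseteq> {..<N}" using g assms by (auto simp: Pos_def)
    then obtain B where "g ` U \<subseteq> B" "B \<subseteq> {..<N}" "card B = b"
      using exists_subset_between[of "g ` U" b "{..<N}"] g assms by auto
    then show "\<exists>B\<in>{B. B \<subseteq> {..<N} \<and> card B = b}. \<forall>u\<in>U. g u \<in> B" by blast
  qed simp
  also have "\<dots> \<le> card {B. B \<subseteq> {..<N} \<and> card B = b} * (b / N) ^ card U"
    by (rule pr_Ex_le) (use fin_sub pr_in_set[OF assms(1)] in auto)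
  also have "\<dots> \<le> real N ^ b * (b / N) ^ card U"
    using choose_le_power[of N b] by (intro mult_right_mono) (auto simp: n_subsets)
  finally show ?thesis .
qed

lemma pr_collapsed:
  assumes U: "U \<subseteq> {..<n}"
  shows "pr Pos (\<lambda>g. card (g ` U) = b) \<le> real N ^ b * (b / N) ^ card U"
proof (cases "b \<le> N")
  case True
  have "pr Pos (\<lambda>g. card (g ` U) = b) \<le> pr Pos (\<lambda>g. card (g ` U) \<le> b)" by (intro pr_mono) auto
  then show ?thesis using pr_image[OF U True] by linarith
next
  case False
  have "card (g ` U) \<noteq> b" if "g \<in> Pos" for g
  proof -
    have "g ` U \<subseteq> {..<N}" using that U by (auto simp: Pos_def)
    then have "card (g ` U) \<le> card {..<N}" by (intro card_mono) auto
    then show ?thesis using False by simp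
  qed
  then have "pr Pos (\<lambda>g. card (g ` U) = b) \<le> pr Pos (\<lambda>_. False)" by (intro pr_mono) auto
  then show ?thesis by (smt (verit) pr_False of_nat_0_le_iff divide_nonneg_nonneg mult_nonneg_nonneg zero_le_power)
qed

lemma pay_exp: "exp (- ((k / 320 - 1) / (12 * q))) \<le> 1 / real k ^ 4"
proof -
  have "4 * ln k * (12 * q) \<le> k / 320 - 1" using pay by (simp add: mult_ac)
  then have "4 * ln k \<le> (k / 320 - 1) / (12 * q)" using q_pos by (simp add: pos_le_divide_eq)
  then have "exp (- ((k / 320 - 1) / (12 * q))) \<le> exp (- (4 * ln k))" by simp
  also have "\<dots> = 1 / exp (ln k) ^ 4" by (simp add: exp_minus exp_of_nat_mult[symmetric] inverse_eq_divide)
  finally show ?thesis using k_pos by simp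
qed

text \<open>Each occupied cell of \<open>Y\<close> keeps one representative. Its at least
  \<open>k / 320\<close> partners lie in distinct cells, since \<open>g\<close> is injective on
  \<open>R\<close>, so they give distinct arcs without an edge; at most one partner shares the cell
  of the representative, whence the -1. By \<open>pay\<close>, each occupied cell then contributes
  k^(-4).\<close>

lemma pr_no_adjs_fixed:
  assumes Y: "Y \<subseteq> S" and R: "R \<subseteq> S" and Rs: "\<And>u. u \<in> Y \<Longrightarrow> Rs u \<subseteq> R" "\<And>u. u \<in> Y \<Longrightarrow> k \<le> 320 * card (Rs u)"
    and g: "g \<in> Pos" "inj_on g R"
  shows "pr (lab N q) (\<lambda>f. \<forall>u\<in>Y. \<forall>v\<in>Rs u. \<not> adjs N f (g u) (g v)) \<le> 2 * (1 / real k ^ 4) ^ card (g ` Y)"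
proof -
  obtain Y' where Y': "Y' \<subseteq> Y" "inj_on g Y'" "g ` Y' = g ` Y"
    by (metis subset_image_inj order_refl)
  have fR: "finite R" and fY': "finite Y'" using R Y Y' finS by (auto intro: finite_subset)
  have cY': "card Y' = card (g ` Y)" using Y' by (metis card_image)
  define P where "P = (SIGMA u:Y'. {v\<in>Rs u. g v \<noteq> g u})"
  define Q where "Q = (\<lambda>(u, v). (g u, g v)) ` P"
  have inj: "inj_on (\<lambda>(u, v). (g u, g v)) P"
  proof (rule inj_onI, clarify)
    fix u v u' v' assume a: "(u, v) \<in> P" "(u', v') \<in> P" "g u = g u'" "g v = g v'"
    then have "u = u'" using Y'(2) by (auto simp: P_def inj_on_def)
    moreover have "v \<in> R" "v' \<in> R" using a Rs(1) Y'(1) by (auto simp: P_def)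
    then have "v = v'" using g(2) a(4) by (auto simp: inj_on_def)
    ultimately show "u = u' \<and> v = v'" ..
  qed
  have finRs: "finite (Rs u)" if "u \<in> Y'" for u using Rs(1) that Y' fR by (meson finite_subset subsetD)
  have "card Q = card P" unfolding Q_def using inj by (rule card_image)
  also have "\<dots> = (\<Sum>u\<in>Y'. card {v\<in>Rs u. g v \<noteq> g u})"
    unfolding P_def using fY' finRs by (intro card_SigmaI) auto
  finally have "real (card Q) = (\<Sum>u\<in>Y'. real (card {v\<in>Rs u. g v \<noteq> g u}))" by simp
  also have "\<dots> \<ge> (\<Sum>u\<in>Y'. k / 320 - 1)"
  proof (rule sum_mono)
    fix u assume u: "u \<in> Y'"
    have fin: "finite (Rs u)" by (rule finRs[OF u])
    have "card {v\<in>Rs u. g v = g u} \<le> 1"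
    proof (rule ccontr)
      assume "\<not> card {v\<in>Rs u. g v = g u} \<le> 1"
      moreover have "finite {v\<in>Rs u. g v = g u}" using fin by auto
      ultimately obtain a b where "a \<in> {v\<in>Rs u. g v = g u}" "b \<in> {v\<in>Rs u. g v = g u}" "a \<noteq> b"
        using card_le_Suc0_iff_eq[of "{v\<in>Rs u. g v = g u}"] by auto
      moreover from this have "a \<in> R" "b \<in> R" using Rs(1)[of u] u Y' by auto
      ultimately show False using g(2) by (auto simp: inj_on_def)
    qed
    moreover have "card (Rs u) = card {v\<in>Rs u. g v = g u} + card {v\<in>Rs u. g v \<noteq> g u}"
    proof -
      have "card (Rs u) = card ({v\<in>Rs u. g v = g u} \<union> {v\<in>Rs u. g v \<noteq> g u})"
        by (rule arg_cong[of _ _ card]) auto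
      also have "\<dots> = card {v\<in>Rs u. g v = g u} + card {v\<in>Rs u. g v \<noteq> g u}"
        by (rule card_Un_disjoint) (use fin in auto)
      finally show ?thesis .
    qed
    moreover have "k \<le> 320 * card (Rs u)" using Rs(2)[of u] u Y' by auto
    ultimately show "k / 320 - 1 \<le> real (card {v\<in>Rs u. g v \<noteq> g u})" by linarith
  qed
  finally have Qge: "card (g ` Y) * (k / 320 - 1) \<le> card Q" by (simp add: cY')
  have N500: "500 * real N \<le> (real q)\<^sup>2" using N by linarith
  have "pr (lab N q) (\<lambda>f. \<forall>u\<in>Y. \<forall>v\<in>Rs u. \<not> adjs N f (g u) (g v)) \<le> pr (lab N q) (\<lambda>f. \<forall>(x, y)\<in>Q. \<not> adjs N f x y)"
    using Y' by (intro pr_mono) (auto simp: Q_def P_def)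
  also have "\<dots> \<le> 2 * exp (- (card Q / (12 * real q)))"
  proof (rule pr_no_adjs)
    show "Q \<subseteq> {..<N} \<times> {..<N}"
      using g(1) Y Y' R Rs S unfolding Q_def P_def Pos_def by fastforce
    show "x \<noteq> y" if "(x, y) \<in> Q" for x y using that by (auto simp: Q_def P_def)
  qed (use q_pos N500 in auto)
  also have "exp (- (card Q / (12 * real q))) \<le> exp (- (card (g ` Y) * ((k / 320 - 1) / (12 * q))))"
    using Qge q_pos by (simp add: divide_right_mono)
  also have "\<dots> = exp (- ((k / 320 - 1) / (12 * q))) ^ card (g ` Y)"
    by (simp add: exp_of_nat_mult[symmetric])
  also have "\<dots> \<le> (1 / real k ^ 4) ^ card (g ` Y)" by (intro power_mono pay_exp) auto
  finally show ?thesis by simp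
qed

text \<open>The sum runs over the number \<open>b\<close> of cells that \<open>Y\<close> occupies.
  Of the gain k^(-4b), one half pays for the choice of the cells,
  \<open>N ^ b \<le> k ^ (2 * b)\<close>, and the other for the excess of the collapse probability
  \<open>(b / N) ^ card Y\<close> over \<open>(6000 / q) ^ card Y\<close>. So a collapse never beats
  one factor O(1 / q) per vertex.\<close>

lemma pr_no_adjs_copy:
  assumes Y: "Y \<subseteq> S" and R: "R \<subseteq> S" and Rs: "\<And>u. u \<in> Y \<Longrightarrow> Rs u \<subseteq> R" "\<And>u. u \<in> Y \<Longrightarrow> k \<le> 320 * card (Rs u)"
  shows "pr \<Omega> (\<lambda>(g, f). inj_on g R \<and> (\<forall>u\<in>Y. \<forall>v\<in>Rs u. \<not> adjs N f (g u) (g v)))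
     \<le> 2 * (real k + 1) * 20000 ^ k * (6000 / q) ^ card Y"
proof -
  have fY: "finite Y" and cY: "card Y \<le> k" using Y finS S by (auto intro: finite_subset card_mono)
  have "pr \<Omega> (\<lambda>(g, f). inj_on g R \<and> (\<forall>u\<in>Y. \<forall>v\<in>Rs u. \<not> adjs N f (g u) (g v)))
    = (\<Sum>g\<in>Pos. pr (lab N q) (\<lambda>f. inj_on g R \<and> (\<forall>u\<in>Y. \<forall>v\<in>Rs u. \<not> adjs N f (g u) (g v)))) / card Pos"
    unfolding \<Omega>_def by (subst pr_prod_eq) auto
  also have "\<dots> \<le> (\<Sum>g\<in>Pos. 2 * (1 / real k ^ 4) ^ card (g ` Y)) / card Pos"
  proof (intro divide_right_mono sum_mono)
    fix g assume g: "g \<in> Pos"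
    show "pr (lab N q) (\<lambda>f. inj_on g R \<and> (\<forall>u\<in>Y. \<forall>v\<in>Rs u. \<not> adjs N f (g u) (g v))) \<le> 2 * (1 / real k ^ 4) ^ card (g ` Y)"
    proof (cases "inj_on g R")
      case True
      then show ?thesis using pr_no_adjs_fixed[OF Y R Rs g True] by simp
    qed simp
  qed auto
  also have "(\<Sum>g\<in>Pos. 2 * (1 / real k ^ 4) ^ card (g ` Y))
     = (\<Sum>g\<in>Pos. \<Sum>b\<le>k. (if card (g ` Y) = b then 2 * (1 / real k ^ 4) ^ b else 0))"
  proof (rule sum.cong)
    fix g
    have "card (g ` Y) \<le> k" using cY card_image_le[OF fY, of g] by linarith
    then show "2 * (1 / real k ^ 4) ^ card (g ` Y) = (\<Sum>b\<le>k. (if card (g ` Y) = b then 2 * (1 / real k ^ 4) ^ b else 0))"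
      by (simp add: sum.delta)
  qed simp
  also have "\<dots> = (\<Sum>b\<le>k. \<Sum>g\<in>Pos. (if card (g ` Y) = b then 2 * (1 / real k ^ 4) ^ b else 0))"
    by (rule sum.swap)
  also have "\<dots> = (\<Sum>b\<le>k. 2 * (1 / real k ^ 4) ^ b * card {g\<in>Pos. card (g ` Y) = b})"
    by (intro sum.cong) (simp_all add: sum.If_cases Int_def)
  also have "\<dots> / card Pos = (\<Sum>b\<le>k. 2 * (1 / real k ^ 4) ^ b * pr Pos (\<lambda>g. card (g ` Y) = b))"
    by (simp add: pr_def sum_divide_distrib)
  also have "\<dots> \<le> (\<Sum>b\<le>k. 2 * 20000 ^ k * (6000 / q) ^ card Y)"
  proof (rule sum_mono)
    fix b
    have NY: "(b / real N) ^ card Y \<le> (20000 ^ k * real k ^ (2 * b)) * (6000 / q) ^ card Y"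
    proof -
      have bN: "b / real N \<le> (b / q) * (6000 / q)"
      proof -
        have "1 / real N \<le> 6000 / (real q)\<^sup>2" using N_ge N_pos q_pos by (simp add: field_simps)
        then have "b * (1 / real N) \<le> b * (6000 / (real q)\<^sup>2)" by (intro mult_left_mono) auto
        then show ?thesis by (simp add: power2_eq_square field_simps)
      qed
      \<comment> \<open>This is \<open>x \<le> exp x\<close> for \<open>x = b / (20000 * q)\<close>.
        The scale is half of the constant in \<open>k_le\<close>, so the power
        \<open>card Y \<le> k\<close> of the exponential is at most
        \<open>k ^ (2 * b)\<close>.\<close>
      have "b / q \<le> 20000 * exp (b / (20000 * real q))"
      proof -
        have "b / (20000 * real q) \<le> exp (b / (20000 * real q))"
          using exp_ge_add_one_self[of "b / (20000 * real q)"] by linarith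
        then show ?thesis by (simp add: field_simps)
      qed
      then have "(b / q) ^ card Y \<le> (20000 * exp (b / (20000 * real q))) ^ card Y" by (intro power_mono) auto
      also have "\<dots> = 20000 ^ card Y * exp (card Y * (b / (20000 * real q)))"
        by (simp add: power_mult_distrib exp_of_nat_mult[symmetric])
      also have "\<dots> \<le> 20000 ^ k * exp (2 * b * ln k)"
      proof (intro mult_mono)
        show "(20000 :: real) ^ card Y \<le> 20000 ^ k" using cY by (intro power_increasing) auto
        have "card Y * (b / (20000 * real q)) \<le> k * (b / (20000 * real q))" using cY by (intro mult_right_mono) auto
        also have "\<dots> = b * (k / (20000 * real q))" by simp
        also have "\<dots> \<le> b * (2 * ln k)"
          using k_le q_pos by (intro mult_left_mono) (auto simp: divide_le_eq mult_ac)
        finally show "exp (card Y * (b / (20000 * real q))) \<le> exp (2 * b * ln k)" by simp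
      qed auto
      also have "exp (2 * b * ln k) = real k ^ (2 * b)"
        using k_pos exp_of_nat_mult[of "2 * b" "ln k"] by simp
      finally have e: "(b / q) ^ card Y \<le> 20000 ^ k * real k ^ (2 * b)" .
      have "(b / real N) ^ card Y \<le> ((b / q) * (6000 / q)) ^ card Y" using bN by (intro power_mono) auto
      also have "\<dots> = (b / q) ^ card Y * (6000 / q) ^ card Y" by (rule power_mult_distrib)
      also have "\<dots> \<le> (20000 ^ k * real k ^ (2 * b)) * (6000 / q) ^ card Y" using e by (intro mult_right_mono) auto
      finally show ?thesis .
    qed
    have "real N \<le> real k ^ 2"
    proof -
      have "(real q)\<^sup>2 \<le> (real k)\<^sup>2" using qk by (intro power_mono) auto
      then show ?thesis using N by linarith
    qed
    then have "real N ^ b \<le> (real k ^ 2) ^ b" by (intro power_mono) auto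
    then have Nb: "real N ^ b \<le> real k ^ (2 * b)" by (simp add: power_mult)
    have "pr Pos (\<lambda>g. card (g ` Y) = b) \<le> real N ^ b * (b / N) ^ card Y"
      using Y S by (intro pr_collapsed) auto
    also have "\<dots> \<le> real k ^ (2 * b) * ((20000 ^ k * real k ^ (2 * b)) * (6000 / q) ^ card Y)"
      by (intro mult_mono Nb NY) auto
    finally have "2 * (1 / real k ^ 4) ^ b * pr Pos (\<lambda>g. card (g ` Y) = b)
       \<le> 2 * (1 / real k ^ 4) ^ b * (real k ^ (2 * b) * ((20000 ^ k * real k ^ (2 * b)) * (6000 / q) ^ card Y))"
      by (intro mult_left_mono) auto
    also have "\<dots> = 2 * 20000 ^ k * (6000 / q) ^ card Y"
    proof -
      have e: "(1 / real k ^ 4) ^ b * (real k ^ (2 * b) * real k ^ (2 * b)) = 1"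
        using k_pos by (simp add: power_divide power_mult[symmetric] power_add[symmetric])
      have "2 * (1 / real k ^ 4) ^ b * (real k ^ (2 * b) * ((20000 ^ k * real k ^ (2 * b)) * (6000 / q) ^ card Y))
         = ((1 / real k ^ 4) ^ b * (real k ^ (2 * b) * real k ^ (2 * b))) * (2 * 20000 ^ k * (6000 / q) ^ card Y)"
        by (simp only: mult_ac)
      then show ?thesis unfolding e by simp
    qed
    finally show "2 * (1 / real k ^ 4) ^ b * pr Pos (\<lambda>g. card (g ` Y) = b) \<le> 2 * 20000 ^ k * (6000 / q) ^ card Y" .
  qed
  also have "\<dots> = 2 * (real k + 1) * 20000 ^ k * (6000 / q) ^ card Y" by (simp add: algebra_simps)
  finally show ?thesis .
qed

text \<open>\<open>R\<close> is a set of vertices in distinct cells of the second copy. Either most of it is concentrated in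
  few cells of the first copy (\<open>conc\<close>), or it contains a sample \<open>V\<close> with the following property. The vertices
  \<open>Z\<close> that are closed with most of \<open>R\<close> are all closed with half of \<open>V\<close>, hence land in few cells of a
  good labelling (\<open>hit\<close>), whereas each remaining vertex forces many non-edges in the second copy (\<open>miss\<close>).\<close>

definition conc :: "(nat \<Rightarrow> nat) \<Rightarrow> nat set \<Rightarrow> bool" where
  "conc g R \<longleftrightarrow> (\<exists>B\<in>{B. B \<subseteq> {..<N} \<and> card B = s}. \<exists>R'\<in>{R'. R' \<subseteq> S \<and> R' \<subseteq> R \<and> 3 * card R \<le> 4 * card R'}. \<forall>v\<in>R'. g v \<in> B)"

definition Rs :: "copy \<Rightarrow> nat set \<Rightarrow> nat \<Rightarrow> nat set" where
  "Rs a R u = {v\<in>R. \<not> closed N (snd a) (fst a u) (fst a v)}"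

text \<open>The vertices of \<open>V\<close> are exempt: their cells define the bad set, so they are
  not independent of it.\<close>

definition hit :: "nat set \<Rightarrow> nat set \<Rightarrow> copy \<Rightarrow> bool" where
  "hit Z V a \<longleftrightarrow> Good N q t (snd a) \<and> card (fst a ` V) = t \<and> (\<forall>u\<in>Z - V. fst a u \<in> Bad N (snd a) (fst a ` V))"

definition miss :: "nat set \<Rightarrow> nat set \<Rightarrow> copy \<Rightarrow> copy \<Rightarrow> bool" where
  "miss R Z a b \<longleftrightarrow> inj_on (fst b) R \<and> (\<forall>u\<in>S - Z. k \<le> 320 * card (Rs a R u))
     \<and> (\<forall>u\<in>S - Z. \<forall>v\<in>Rs a R u. \<not> adjs N (snd b) (fst b u) (fst b v))"

text \<open>\<open>(k / N) ^ k\<close> alone misses \<open>k ^ (- k)\<close> by logarithmic factors.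
  By \<open>sN\<close>, concentration of three quarters of the \<rho> vertices is as rare as (k /
  N)^\<rho> with an extra k^(-\<rho>/4), at most k^(-k/20), and \<open>kN\<close> gives
  \<open>(k / N) ^ 20 \<le> (1 / k) ^ 19\<close>. Taking twentieth powers avoids fractional
  exponents.\<close>

lemma conc_exponents:
  assumes \<rho>: "\<rho> \<le> k" "k \<le> 5 * \<rho>" and r: "3 * \<rho> \<le> 4 * r"
  shows "(s / N) ^ r * (k / N) ^ (k - \<rho>) \<le> (1 / real k) ^ k"
proof -
  define B where "B = (s / N) ^ r * (k / N) ^ (k - \<rho>)"
  have sN1: "s / real N \<le> 1" using s(2) N_pos by simp
  have cube: "(s / real N) ^ 3 \<le> (k / N) ^ 4 * (1 / k)"
  proof -
    have "real s ^ 3 * N \<le> real k ^ 3" using sN by (metis of_nat_le_iff of_nat_mult of_nat_power)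
    then have "real s ^ 3 \<le> real k ^ 3 / N" using N_pos by (simp add: pos_le_divide_eq)
    then have "real s ^ 3 / real N ^ 3 \<le> real k ^ 3 / N / real N ^ 3" by (rule divide_right_mono) simp
    also have "\<dots> = (k / N) ^ 4 * (1 / k)"
      using k_pos N_pos by (simp add: power_divide power3_eq_cube power4_eq_xxxx)
    finally show ?thesis by (simp add: power_divide)
  qed
  have "(s / real N) ^ (4 * r) \<le> (s / real N) ^ (3 * \<rho>)" using r sN1 by (intro power_decreasing) auto
  also have "\<dots> \<le> ((k / N) ^ 4 * (1 / k)) ^ \<rho>" unfolding power_mult by (intro power_mono cube) auto
  finally have "B ^ 4 \<le> ((k / N) ^ 4 * (1 / k)) ^ \<rho> * (k / N) ^ (4 * (k - \<rho>))"
    unfolding B_def power_mult_distrib power_mult[symmetric]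
    by (intro mult_mono) (auto simp: mult.commute)
  also have "\<dots> = (k / N) ^ (4 * \<rho> + 4 * (k - \<rho>)) * (1 / k) ^ \<rho>"
    by (simp only: power_mult_distrib power_mult[symmetric] power_add mult_ac)
  also have "4 * \<rho> + 4 * (k - \<rho>) = 4 * k" using \<rho> by simp
  finally have "(B ^ 4) ^ 5 \<le> ((k / N) ^ (4 * k) * (1 / k) ^ \<rho>) ^ 5"
    by (intro power_mono) (auto simp: B_def)
  also have "\<dots> = ((k / N) ^ 20) ^ k * (1 / real k) ^ (5 * \<rho>)"
    by (simp only: power_mult_distrib power_mult[symmetric]) (simp add: mult.commute)
  also have "\<dots> \<le> ((1 / real k) ^ 19) ^ k * (1 / real k) ^ k"
  proof (intro mult_mono power_mono)
    have "real (k ^ 39) \<le> real (N ^ 20)" using kN(1) by (simp only: of_nat_le_iff)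
    then have "real k ^ 20 * real k ^ 19 \<le> real N ^ 20" by (simp add: power_add[symmetric])
    then show "(k / real N) ^ 20 \<le> (1 / real k) ^ 19"
      using k_pos N_pos by (simp add: power_divide divide_le_eq le_divide_eq)
    show "(1 / real k) ^ (5 * \<rho>) \<le> (1 / real k) ^ k" using \<rho> k_pos by (intro power_decreasing) auto
  qed auto
  also have "\<dots> = ((1 / real k) ^ k) ^ 20"
    by (simp add: power_mult[symmetric] power_add[symmetric] mult.commute)
  finally have "B ^ 20 \<le> ((1 / real k) ^ k) ^ 20" by (simp add: power_mult[symmetric])
  then have "B \<le> (1 / real k) ^ k" by (rule power_le_imp_le_base[of _ 19, simplified]) auto
  then show ?thesis by (simp add: B_def)
qed

text \<open>The two events concern different copies and are independent: the first makes
  \<open>R\<close> rare, the second every vertex outside \<open>R\<close>. The factor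
  \<open>4 ^ k\<close> pays for choosing the \<open>s\<close> cells, by \<open>Ns\<close>, and the
  concentrated part of \<open>R\<close>.\<close>

lemma pr_conc:
  assumes R: "R \<subseteq> S" "k \<le> 5 * card R"
  shows "pr (\<Omega> \<times> \<Omega>) (\<lambda>(a, b). conc (fst a) R \<and> fst b ` (S - R) \<subseteq> fst b ` R) \<le> (4 / k) ^ k"
proof -
  have fR: "finite R" and cR: "card R \<le> k" using R finS S by (auto intro: finite_subset card_mono)
  define r where "r = (3 * card R + 3) div 4"
  have r: "3 * card R \<le> 4 * r" by (simp add: r_def)
  have sN1: "s / real N \<le> 1" using s(2) N_pos by simp
  have lift: "pr \<Omega> (\<lambda>a. P (fst a)) \<le> pr Pos P" for P
  proof -
    have "pr \<Omega> (\<lambda>a. P (fst a)) \<le> pr Pos P * 1"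
      unfolding \<Omega>_def by (rule pr_prod_le) (auto intro: pr_le_1)
    then show ?thesis by simp
  qed
  have A: "pr Pos (\<lambda>g. conc g R) \<le> 2 ^ k * (2 ^ k * (s / N) ^ r)"
  proof -
    have "pr Pos (\<lambda>g. conc g R) \<le> card {B. B \<subseteq> {..<N} \<and> card B = s} * (2 ^ k * (s / N) ^ r)"
      unfolding conc_def
    proof (rule pr_Ex_le)
      fix B assume B: "B \<in> {B. B \<subseteq> {..<N} \<and> card B = s}"
      let ?R = "{R'. R' \<subseteq> S \<and> R' \<subseteq> R \<and> 3 * card R \<le> 4 * card R'}"
      have "pr Pos (\<lambda>g. \<exists>R'\<in>?R. \<forall>v\<in>R'. g v \<in> B) \<le> card ?R * (s / N) ^ r"
      proof (rule pr_Ex_le)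
        fix R' assume R': "R' \<in> ?R"
        have "pr Pos (\<lambda>g. \<forall>v\<in>R'. g v \<in> B) \<le> (card B / N) ^ card R'"
          using B R' S by (intro pr_in_set) auto
        also have "\<dots> \<le> (s / N) ^ r" using B R' sN1 by (auto intro!: power_decreasing simp: r_def)
        finally show "pr Pos (\<lambda>g. \<forall>v\<in>R'. g v \<in> B) \<le> (s / N) ^ r" .
      qed (use fin_subS in auto)
      also have "\<dots> \<le> 2 ^ k * (s / N) ^ r" using card_subS by (intro mult_right_mono) auto
      finally show "pr Pos (\<lambda>g. \<exists>R'\<in>?R. \<forall>v\<in>R'. g v \<in> B) \<le> 2 ^ k * (s / N) ^ r" .
    qed (use fin_sub in auto)
    also have "card {B. B \<subseteq> {..<N} \<and> card B = s} \<le> (2::real) ^ k"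
      using order_trans[OF choose_le_power Ns] by (simp add: n_subsets)
    finally show ?thesis by (simp add: mult_right_mono)
  qed
  have B: "pr Pos (\<lambda>g. g ` (S - R) \<subseteq> g ` R) \<le> (k / N) ^ (k - card R)"
  proof -
    have "pr Pos (\<lambda>g. \<forall>v\<in>S - R. g v \<in> g ` R) \<le> (k / N) ^ card (S - R)"
      unfolding Pos_def
    proof (rule pr_PiE_dep)
      fix g :: "nat \<Rightarrow> nat"
      have "card (g ` R \<inter> {..<N}) \<le> card (g ` R)" using fR by (intro card_mono) auto
      also have "\<dots> \<le> k" using card_image_le[OF fR, of g] cR by linarith
      finally show "real (card (g ` R \<inter> {..<N})) \<le> k / N * card {..<N}" using N_pos by simp
    next
      fix g g' :: "nat \<Rightarrow> nat" assume "\<And>i. i \<in> {..<n} - (S - R) \<Longrightarrow> g i = g' i"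
      then show "g ` R = g' ` R" using R S by (intro image_cong) auto
    qed (use S N_pos in auto)
    also have "card (S - R) = k - card R" using R fR S by (simp add: card_Diff_subset)
    finally show ?thesis by (simp add: image_subset_iff)
  qed
  have "pr (\<Omega> \<times> \<Omega>) (\<lambda>(a, b). conc (fst a) R \<and> fst b ` (S - R) \<subseteq> fst b ` R)
     \<le> pr \<Omega> (\<lambda>a. conc (fst a) R) * pr \<Omega> (\<lambda>b. fst b ` (S - R) \<subseteq> fst b ` R)"
    by (rule pr_prod_indep) auto
  also have "\<dots> \<le> (2 ^ k * (2 ^ k * (s / N) ^ r)) * (k / N) ^ (k - card R)"
    using order_trans[OF lift A] order_trans[OF lift B] by (intro mult_mono pr_nonneg) auto
  also have "\<dots> = 2 ^ k * 2 ^ k * ((s / N) ^ r * (k / N) ^ (k - card R))" by simp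
  also have "\<dots> \<le> 2 ^ k * 2 ^ k * (1 / real k) ^ k"
    using conc_exponents[OF cR R(2) r] by (intro mult_left_mono) auto
  also have "\<dots> = (4 / k) ^ k" by (simp add: power_mult_distrib[symmetric])
  finally show ?thesis .
qed

text \<open>With good labels fixed and the cells of \<open>V\<close> known, each vertex of
  \<open>Z - V\<close> has to fall into one of \<open>10 * q\<close> cells out of
  \<open>N \<ge> q^2 / 6000\<close>.\<close>

lemma pr_hit:
  assumes Z: "Z \<subseteq> S" and V: "V \<subseteq> S"
  shows "pr \<Omega> (hit Z V) \<le> (60000 / q) ^ card (Z - V)"
proof -
  have "pr \<Omega> (hit Z V) = pr (lab N q \<times> Pos) (\<lambda>(f, g). hit Z V (g, f))"
    unfolding \<Omega>_def by (rule pr_prod_swap)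
  also have "\<dots> \<le> pr (lab N q) (\<lambda>f. Good N q t f) * (60000 / q) ^ card (Z - V)"
  proof (rule pr_prod_le)
    fix f assume f: "Good N q t f"
    \<comment> \<open>Goodness bounds the bad set only for samples of exactly \<open>t\<close>
      cells; the default \<open>{}\<close> keeps the cardinality bound for all other
      \<open>g\<close>.\<close>
    define B where "B g v = (if g ` V \<subseteq> {..<N} \<and> card (g ` V) = t then Bad N f (g ` V) else {})" for g :: "nat \<Rightarrow> nat" and v :: nat
    have "pr Pos (\<lambda>g. hit Z V (g, f)) \<le> pr Pos (\<lambda>g. \<forall>u\<in>Z - V. g u \<in> B g u)"
      using V S by (intro pr_mono fin_Pos) (auto simp: hit_def B_def Pos_def)
    also have "\<dots> \<le> (60000 / q) ^ card (Z - V)"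
      unfolding Pos_def
    proof (rule pr_PiE_dep)
      fix g :: "nat \<Rightarrow> nat" and v
      have "card (B g v \<inter> {..<N}) \<le> 10 * q"
      proof -
        have "card (Bad N f X \<inter> {..<N}) \<le> card (Bad N f X)" for X
          by (intro card_mono) (auto simp: Bad_def)
        then show ?thesis using f by (auto simp: B_def Good_def intro: order_trans)
      qed
      then have "real (card (B g v \<inter> {..<N})) \<le> 10 * real q" by linarith
      also have "\<dots> \<le> 60000 / q * N" using N_ge q_pos by (simp add: field_simps power2_eq_square)
      finally show "real (card (B g v \<inter> {..<N})) \<le> 60000 / q * card {..<N}" by simp
    next
      fix g g' :: "nat \<Rightarrow> nat" and v assume "\<And>i. i \<in> {..<n} - (Z - V) \<Longrightarrow> g i = g' i"
      then have "g ` V = g' ` V" using V S by (intro image_cong) auto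
      then show "B g v = B g' v" by (simp add: B_def)
    qed (use S Z N_pos in auto)
    finally show "pr Pos (\<lambda>g. case (f, g) of (f, g) \<Rightarrow> hit Z V (g, f)) \<le> (60000 / q) ^ card (Z - V)" by simp
  qed (auto simp: hit_def)
  also have "\<dots> \<le> 1 * (60000 / q) ^ card (Z - V)" by (intro mult_right_mono pr_le_1) auto
  finally show ?thesis by simp
qed

text \<open>The vertices of \<open>Z - V\<close> pay in the first copy and those of
  \<open>S - Z\<close> in the second, each with a factor O(1 / q). Only the \<open>t\<close>
  vertices of \<open>V\<close> can go unpaid, and \<open>q ^ t \<le> 2 ^ k\<close> absorbs
  them.\<close>

lemma pr_hit_miss:
  assumes R: "R \<subseteq> S" and Z: "Z \<subseteq> S" and V: "V \<subseteq> S" "card V = t"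
  shows "pr (\<Omega> \<times> \<Omega>) (\<lambda>(a, b). hit Z V a \<and> miss R Z a b) \<le> 2 * (4800000000 / q) ^ k"
proof -
  have fV: "finite V" "finite Z" using V Z finS by (auto intro: finite_subset)
  have "pr (\<Omega> \<times> \<Omega>) (\<lambda>(a, b). hit Z V a \<and> miss R Z a b)
    \<le> pr \<Omega> (hit Z V) * (2 * (real k + 1) * 20000 ^ k * (6000 / q) ^ card (S - Z))"
  proof (rule pr_prod_le)
    fix a
    show "pr \<Omega> (\<lambda>b. case (a, b) of (a, b) \<Rightarrow> hit Z V a \<and> miss R Z a b)
      \<le> 2 * (real k + 1) * 20000 ^ k * (6000 / q) ^ card (S - Z)"
    proof (cases "\<forall>u\<in>S - Z. k \<le> 320 * card (Rs a R u)")
      case True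
      have "pr \<Omega> (\<lambda>b. case (a, b) of (a, b) \<Rightarrow> hit Z V a \<and> miss R Z a b)
        \<le> pr \<Omega> (\<lambda>(g, f). inj_on g R \<and> (\<forall>u\<in>S - Z. \<forall>v\<in>Rs a R u. \<not> adjs N f (g u) (g v)))"
        by (intro pr_mono) (auto simp: miss_def)
      also have "\<dots> \<le> 2 * (real k + 1) * 20000 ^ k * (6000 / q) ^ card (S - Z)"
        by (rule pr_no_adjs_copy) (use R True in \<open>auto simp: Rs_def\<close>)
      finally show ?thesis .
    next
      case False
      then have "pr \<Omega> (\<lambda>b. case (a, b) of (a, b) \<Rightarrow> hit Z V a \<and> miss R Z a b) \<le> pr \<Omega> (\<lambda>_. False)"
        by (intro pr_mono) (auto simp: miss_def)
      also have "\<dots> \<le> 2 * (real k + 1) * 20000 ^ k * (6000 / q) ^ card (S - Z)" by simp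
      finally show ?thesis .
    qed
  qed auto
  also have "\<dots> \<le> (60000 / q) ^ card (Z - V) * (2 * 2 ^ k * 20000 ^ k * (60000 / q) ^ card (S - Z))"
  proof (intro mult_mono pr_hit Z V power_mono)
    have "k + 1 \<le> 2 ^ k" using less_exp[of k] by linarith
    then have "real (k + 1) \<le> real (2 ^ k)" by (simp only: of_nat_le_iff)
    then show "real k + 1 \<le> 2 ^ k" by simp
  qed (auto simp: divide_right_mono)
  also have "\<dots> = 2 * 2 ^ k * 20000 ^ k * (60000 ^ (card (Z - V) + card (S - Z)) * (1 / real q) ^ (card (Z - V) + card (S - Z)))"
    by (simp add: power_add power_divide)
  also have "\<dots> \<le> 2 * 2 ^ k * 20000 ^ k * (60000 ^ k * (2 ^ k * (1 / real q) ^ k))"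
  proof (intro mult_left_mono mult_mono)
    have c1: "card (S - Z) = k - card Z" using Z fV S by (simp add: card_Diff_subset)
    have c2: "card (Z - V) \<le> card Z" using fV by (intro card_mono) auto
    have c3: "card Z - t \<le> card (Z - V)" using V(2) diff_card_le_card_Diff[OF fV(1), of Z] by simp
    have c4: "card Z \<le> k" using Z S finS by (auto intro: card_mono)
    show "(60000 :: real) ^ (card (Z - V) + card (S - Z)) \<le> 60000 ^ k"
      using c1 c2 c4 by (intro power_increasing) auto
    have "k \<le> (card (Z - V) + card (S - Z)) + t" using c1 c3 c4 by linarith
    then have "(1 / real q) ^ ((card (Z - V) + card (S - Z)) + t) \<le> (1 / real q) ^ k"
      using q_pos by (intro power_decreasing) auto
    then have "(1 / real q) ^ (card (Z - V) + card (S - Z)) \<le> real q ^ t * (1 / real q) ^ k"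
      using q_pos by (simp add: power_add power_divide field_simps)
    also have "\<dots> \<le> 2 ^ k * (1 / real q) ^ k" using qt by (intro mult_right_mono) auto
    finally show "(1 / real q) ^ (card (Z - V) + card (S - Z)) \<le> 2 ^ k * (1 / real q) ^ k" .
  qed auto
  also have "\<dots> = 2 * (2 * 20000 * 60000 * 2 * (1 / real q)) ^ k"
    by (simp only: power_mult_distrib mult_ac)
  finally show ?thesis by simp
qed

text \<open>\<open>R\<close> has one vertex from each cell of the second copy that \<open>S\<close>
  occupies. A cell of the first copy is heavy if it holds more than a fraction \<open>1 / s\<close>
  of \<open>R\<close>; there are at most \<open>s\<close> heavy cells, so unless \<open>R\<close> is
  concentrated more than a quarter of it lies elsewhere, in small fibres, and
  \<open>sampling\<close> applies to that part.\<close>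

lemma half_cover:
  assumes a: "a \<in> \<Omega>" "Good N q t (snd a)" and k5: "k \<le> 5 * card (fst b ` S)" and h: "half N a b S"
  shows "\<exists>R\<in>{R. R \<subseteq> S \<and> k \<le> 5 * card R}. (conc (fst a) R \<and> fst b ` (S - R) \<subseteq> fst b ` R)
     \<or> (\<exists>Z\<in>{Z. Z \<subseteq> S}. \<exists>V\<in>{V. V \<subseteq> S \<and> card V = t}. hit Z V a \<and> miss R Z a b)"
proof -
  obtain g f where gf: "a = (g, f)" by (cases a)
  obtain g' f' where gf': "b = (g', f')" by (cases b)
  have gN: "g u < N" if "u \<in> S" for u using a(1) S that by (auto simp: gf \<Omega>_def Pos_def)
  obtain R where R: "R \<subseteq> S" "inj_on g' R" "g' ` R = g' ` S" by (metis subset_image_inj order_refl)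
  have fR: "finite R" using R finS finite_subset by blast
  have cR: "k \<le> 5 * card R" using k5 R by (metis card_image fst_conv gf')
  have R0: "0 < card R" using cR k_pos by linarith
  have out: "g' ` (S - R) \<subseteq> g' ` R" using R by auto
  show ?thesis
  proof (cases "conc g R")
    case True
    then show ?thesis using R cR out by (intro bexI[of _ R]) (auto simp: gf gf')
  next
    case nconc: False
    define Q where "Q = {x\<in>{..<N}. card R < s * card {v\<in>R. g v = x}}"
    have cQ: "card Q \<le> s"
    proof -
      have "card Q * card R = (\<Sum>x\<in>Q. card R)" by simp
      also have "\<dots> \<le> (\<Sum>x\<in>Q. s * card {v\<in>R. g v = x})" by (intro sum_mono) (auto simp: Q_def)
      also have "\<dots> = s * card (\<Union>x\<in>Q. {v\<in>R. g v = x})"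
        unfolding sum_distrib_left[symmetric] using fR by (subst card_UN_disjoint) (auto simp: Q_def)
      also have "\<dots> \<le> s * card R" using fR by (intro mult_le_mono2 card_mono) auto
      finally show ?thesis using R0 by simp
    qed
    obtain Q' where Q': "Q \<subseteq> Q'" "Q' \<subseteq> {..<N}" "card Q' = s"
      using exists_subset_between[of Q s "{..<N}"] cQ s(2) by (auto simp: Q_def)
    define A where "A = {v\<in>R. g v \<notin> Q}"
    have cA: "card R < 4 * card A"
    proof -
      have "card R = card ({v\<in>R. g v \<in> Q} \<union> A)" unfolding A_def by (rule arg_cong[of _ _ card]) auto
      also have "\<dots> = card {v\<in>R. g v \<in> Q} + card A"
        unfolding A_def using fR by (intro card_Un_disjoint) auto
      finally have e: "card R = card {v\<in>R. g v \<in> Q} + card A" .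
      have "\<not> 3 * card R \<le> 4 * card {v\<in>R. g v \<in> Q}"
      proof
        assume "3 * card R \<le> 4 * card {v\<in>R. g v \<in> Q}"
        then have "conc g R" unfolding conc_def using Q' R(1)
          by (intro bexI[of _ Q'] bexI[of _ "{v\<in>R. g v \<in> Q}"]) auto
        then show False using nconc by contradiction
      qed
      then show ?thesis using e by linarith
    qed
    have fA: "finite A" using fR by (simp add: A_def)
    have A0: "A \<noteq> {}" using cA by auto
    have AR: "A \<subseteq> R" by (auto simp: A_def)
    \<comment> \<open>Less than 1/64 of \<open>R\<close> is less than 1/16 of \<open>A\<close>, as
      \<open>sampling\<close> requires, whereas at least 1/64 of \<open>R\<close> means at least
      \<open>k / 320\<close> vertices.\<close>
    define Z where "Z = {u\<in>S. 64 * card (Rs a R u) < card R}"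
    have fRs: "finite (Rs a R u)" for u using fR by (simp add: Rs_def)
    have ZS: "Z \<subseteq> S" by (auto simp: Z_def)
    have "\<exists>V\<subseteq>A. card V = t \<and> inj_on g V \<and> (\<forall>u\<in>Z. 2 * card (V \<inter> Rs a R u) \<le> t)"
    proof (rule sampling[OF fA A0 t_pos])
      show "8 * t\<^sup>2 \<le> s" using s by simp
      show "finite Z" using ZS finS finite_subset by blast
      show "4 * card Z \<le> 2 ^ t"
      proof -
        have "card Z \<le> k" using ZS finS S(2) card_mono by blast
        then show ?thesis using kt by linarith
      qed
      show "s * card {v\<in>A. g v = x} \<le> 4 * card A" for x
      proof (cases "x \<in> Q")
        case True
        then have "{v\<in>A. g v = x} = {}" by (auto simp: A_def)
        then show ?thesis by (simp only: card.empty)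
      next
        case False
        show ?thesis
        proof (cases "x < N")
          case True
          have "card {v\<in>A. g v = x} \<le> card {v\<in>R. g v = x}" using fR AR by (intro card_mono) auto
          then have "s * card {v\<in>A. g v = x} \<le> s * card {v\<in>R. g v = x}" by (rule mult_le_mono2)
          also have "\<dots> \<le> card R" using False True by (auto simp: Q_def)
          finally show ?thesis using cA by linarith
        next
          case ge: False
          then have "{v\<in>A. g v = x} = {}" using gN AR R(1) by fastforce
          then show ?thesis by (simp only: card.empty)
        qed
      qed
      fix u assume u: "u \<in> Z"
      have "card (Rs a R u \<inter> A) \<le> card (Rs a R u)" using fRs by (intro card_mono) auto
      then show "16 * card (Rs a R u \<inter> A) \<le> card A" using u cA by (auto simp: Z_def)
    qed
    then obtain V where V: "V \<subseteq> A" "card V = t" "inj_on g V" "\<And>u. u \<in> Z \<Longrightarrow> 2 * card (V \<inter> Rs a R u) \<le> t"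
      by blast
    have VS: "V \<subseteq> S" and VR: "V \<subseteq> R" using V AR R by auto
    have fV: "finite V" using VS finS finite_subset by blast
    have "hit Z V a" unfolding hit_def
    proof (intro conjI ballI)
      show "Good N q t (snd a)" by (rule a(2))
      show cV: "card (fst a ` V) = t" using V by (simp add: gf card_image)
      fix u assume u: "u \<in> Z - V"
      have uS: "u \<in> S" using u ZS by auto
      have "card V = card (V \<inter> Rs a R u) + card (V - Rs a R u)"
        using card_Int_Diff[OF fV] by simp
      then have "t \<le> 2 * card (V - Rs a R u)" using V(2) V(4)[of u] u by auto
      also have "card (V - Rs a R u) = card (g ` (V - Rs a R u))"
        using V(3) by (subst card_image) (auto simp: inj_on_def)
      also have "\<dots> \<le> card {y\<in>g ` V. \<exists>w<N. adj f (g u) w \<and> adj f w y}"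
      proof (rule card_mono)
        show "g ` (V - Rs a R u) \<subseteq> {y\<in>g ` V. \<exists>w<N. adj f (g u) w \<and> adj f w y}"
        proof
          fix y assume "y \<in> g ` (V - Rs a R u)"
          then obtain v where v: "v \<in> V" "v \<notin> Rs a R u" "y = g v" by auto
          then have "closed N f (g u) (g v)" using VR by (auto simp: Rs_def gf)
          then obtain w where "w < N" "adjs N f (g u) w" "adjs N f (g v) w" by (auto simp: closed_def)
          then have "adj f (g u) w" "adj f w (g v)" using adj_sym by (auto simp: adjs_def)
          then show "y \<in> {y\<in>g ` V. \<exists>w<N. adj f (g u) w \<and> adj f w y}" using v \<open>w < N\<close> by auto
        qed
      qed (use fV in auto)
      finally show "fst a u \<in> Bad N (snd a) (fst a ` V)"
        using gN[OF uS] cV by (simp add: Bad_def gf)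
    qed
    moreover have "miss R Z a b" unfolding miss_def
    proof (intro conjI ballI)
      show "inj_on (fst b) R" using R by (simp add: gf')
      fix u assume u: "u \<in> S - Z"
      then have "card R \<le> 64 * card (Rs a R u)" by (auto simp: Z_def)
      then show "k \<le> 320 * card (Rs a R u)" using cR by linarith
      fix v assume v: "v \<in> Rs a R u"
      then have "v \<in> S" "\<not> closed N (snd a) (fst a u) (fst a v)" using R by (auto simp: Rs_def)
      then show "\<not> adjs N (snd b) (fst b u) (fst b v)" using h u by (auto simp: half_def)
    qed
    ultimately show ?thesis
      by (intro bexI[of _ R] disjI2 bexI[of _ Z] bexI[of _ V] conjI) (use R(1) cR ZS VS V(2) in simp_all)
  qed
qed

text \<open>Choosing \<open>R\<close>, \<open>Z\<close> and \<open>V\<close> costs at most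
  \<open>2 ^ k\<close> each, and \<open>8 * 4800000000 < 40000000000\<close>.\<close>

lemma pr_half:
  "pr (\<Omega> \<times> \<Omega>) (\<lambda>(a, b). Good N q t (snd a) \<and> k \<le> 5 * card (fst b ` S) \<and> half N a b S)
     \<le> 3 * (40000000000 / q) ^ k"
proof -
  let ?R = "{R. R \<subseteq> S \<and> k \<le> 5 * card R}"
  let ?Z = "{Z. Z \<subseteq> S}" and ?V = "{V. V \<subseteq> S \<and> card V = t}"
  let ?C = "\<lambda>R. \<lambda>(a, b). conc (fst a) R \<and> fst b ` (S - R) \<subseteq> fst b ` R"
  let ?E = "\<lambda>Z V R. \<lambda>(a, b). hit Z V a \<and> miss R Z a b"
  have fin: "finite (\<Omega> \<times> \<Omega>)" by simp
  have cZ: "real (card ?Z) \<le> 2 ^ k" using card_subS[of "\<lambda>_. True"] by simp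
  have "pr (\<Omega> \<times> \<Omega>) (\<lambda>(a, b). Good N q t (snd a) \<and> k \<le> 5 * card (fst b ` S) \<and> half N a b S)
    \<le> pr (\<Omega> \<times> \<Omega>) (\<lambda>p. \<exists>R\<in>?R. ?C R p \<or> (\<exists>Z\<in>?Z. \<exists>V\<in>?V. ?E Z V R p))"
  proof (rule pr_mono[OF fin])
    fix p assume p: "p \<in> \<Omega> \<times> \<Omega>" "case p of (a, b) \<Rightarrow> Good N q t (snd a) \<and> k \<le> 5 * card (fst b ` S) \<and> half N a b S"
    obtain a b where pe: "p = (a, b)" by (cases p)
    show "\<exists>R\<in>?R. ?C R p \<or> (\<exists>Z\<in>?Z. \<exists>V\<in>?V. ?E Z V R p)"
      using half_cover[of a b] p unfolding pe by simp
  qed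
  also have "\<dots> \<le> card ?R * ((4 / k) ^ k + 2 ^ k * (2 ^ k * (2 * (4800000000 / q) ^ k)))"
  proof (rule pr_Ex_le[OF fin fin_subS])
    fix R assume R: "R \<in> ?R"
    have "pr (\<Omega> \<times> \<Omega>) (\<lambda>p. \<exists>Z\<in>?Z. \<exists>V\<in>?V. ?E Z V R p) \<le> card ?Z * (2 ^ k * (2 * (4800000000 / q) ^ k))"
    proof (rule pr_Ex_le[OF fin])
      show "finite ?Z" using fin_subS[of "\<lambda>_. True"] by simp
      fix Z assume Z: "Z \<in> ?Z"
      have "pr (\<Omega> \<times> \<Omega>) (\<lambda>p. \<exists>V\<in>?V. ?E Z V R p) \<le> card ?V * (2 * (4800000000 / q) ^ k)"
      proof (rule pr_Ex_le[OF fin fin_subS])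
        fix V assume "V \<in> ?V"
        then show "pr (\<Omega> \<times> \<Omega>) (?E Z V R) \<le> 2 * (4800000000 / q) ^ k"
          using R Z by (intro pr_hit_miss) simp_all
      qed
      also have "\<dots> \<le> 2 ^ k * (2 * (4800000000 / q) ^ k)" using card_subS by (intro mult_right_mono) auto
      finally show "pr (\<Omega> \<times> \<Omega>) (\<lambda>p. \<exists>V\<in>?V. ?E Z V R p) \<le> 2 ^ k * (2 * (4800000000 / q) ^ k)" .
    qed
    also have "\<dots> \<le> 2 ^ k * (2 ^ k * (2 * (4800000000 / q) ^ k))" using cZ by (intro mult_right_mono) auto
    finally have "pr (\<Omega> \<times> \<Omega>) (\<lambda>p. \<exists>Z\<in>?Z. \<exists>V\<in>?V. ?E Z V R p) \<le> 2 ^ k * (2 ^ k * (2 * (4800000000 / q) ^ k))" .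
    then show "pr (\<Omega> \<times> \<Omega>) (\<lambda>p. ?C R p \<or> (\<exists>Z\<in>?Z. \<exists>V\<in>?V. ?E Z V R p))
      \<le> (4 / k) ^ k + 2 ^ k * (2 ^ k * (2 * (4800000000 / q) ^ k))"
      using pr_conc[of R] R by (intro order_trans[OF pr_disj[OF fin]] add_mono) auto
  qed
  also have "\<dots> \<le> 2 ^ k * ((4 / k) ^ k + 2 ^ k * (2 ^ k * (2 * (4800000000 / q) ^ k)))"
    using card_subS by (intro mult_right_mono) auto
  also have "\<dots> = (2 * (4 / k)) ^ k + 2 * (2 * 2 * 2 * (4800000000 / q)) ^ k"
    by (simp only: power_mult_distrib distrib_left mult_ac)
  also have "\<dots> \<le> (40000000000 / q) ^ k + 2 * (40000000000 / q) ^ k"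
  proof (intro add_mono mult_left_mono power_mono)
    have "8 / real k \<le> 8 / real q" using qk q_pos by (intro divide_left_mono) auto
    also have "\<dots> \<le> 40000000000 / q" by (intro divide_right_mono) auto
    finally show "2 * (4 / real k) \<le> 40000000000 / q" by simp
  qed (auto simp: divide_right_mono)
  finally show ?thesis by simp
qed

text \<open>A collapse of one copy onto \<open>k / 5\<close> cells is only bounded by about N^(k/5)
  (k / N)^k, near k^(-3k/5), not enough by itself. Two independent collapses suffice: by
  \<open>k ^ 15 \<le> N ^ 8\<close> the squared bound is at most k^(-k).\<close>

lemma pr_both_collapsed:
  "pr (\<Omega> \<times> \<Omega>) (\<lambda>(a, b). card (fst a ` S) \<le> k div 5 \<and> card (fst b ` S) \<le> k div 5) \<le> (40000000000 / q) ^ k"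
proof -
  let ?y = "real N ^ (k div 5) * ((k div 5) / N) ^ k"
  have kN1: "k div 5 \<le> N"
  proof (rule ccontr)
    assume "\<not> k div 5 \<le> N"
    then have "N < k" by linarith
    then have "N ^ 8 < k ^ 8" by (intro power_strict_mono) auto
    also have "\<dots> \<le> k ^ 15" using k_pos by (intro power_increasing) auto
    finally show False using kN(2) by simp
  qed
  have lift: "pr \<Omega> (\<lambda>a. card (fst a ` S) \<le> k div 5) \<le> ?y"
  proof -
    have "pr \<Omega> (\<lambda>a. card (fst a ` S) \<le> k div 5) \<le> pr Pos (\<lambda>g. card (g ` S) \<le> k div 5) * 1"
      unfolding \<Omega>_def by (rule pr_prod_le) (auto intro: pr_le_1)
    then show ?thesis using pr_image[OF S(1) kN1] S(2) by simp
  qed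
  have "pr (\<Omega> \<times> \<Omega>) (\<lambda>(a, b). card (fst a ` S) \<le> k div 5 \<and> card (fst b ` S) \<le> k div 5)
     \<le> pr \<Omega> (\<lambda>a. card (fst a ` S) \<le> k div 5) * pr \<Omega> (\<lambda>a. card (fst a ` S) \<le> k div 5)"
    by (rule pr_prod_indep) auto
  also have "\<dots> \<le> ?y * ?y" by (intro mult_mono lift pr_nonneg) auto
  also have "?y * ?y \<le> (1 / real k) ^ k"
  proof -
    have "(?y * ?y) ^ 5 = real N ^ (10 * (k div 5)) * ((k div 5) / N) ^ (10 * k)"
    proof -
      have "real N ^ (10 * (k div 5)) = real N ^ (5 * (k div 5)) * real N ^ (5 * (k div 5))"
        "((k div 5) / real N) ^ (10 * k) = ((k div 5) / N) ^ (5 * k) * ((k div 5) / N) ^ (5 * k)"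
        by (simp_all add: power_add[symmetric])
      then show ?thesis by (simp add: power_mult_distrib power_mult[symmetric] mult.commute)
    qed
    also have "\<dots> \<le> real N ^ (2 * k) * (k / N) ^ (10 * k)"
    proof (rule mult_mono)
      show "real N ^ (10 * (k div 5)) \<le> real N ^ (2 * k)" using N_pos by (intro power_increasing) auto
      show "((k div 5) / real N) ^ (10 * k) \<le> (k / real N) ^ (10 * k)"
        by (intro power_mono divide_right_mono) auto
    qed auto
    also have "\<dots> = (real k ^ 10 / real N ^ 8) ^ k"
    proof -
      have "real N ^ 2 * (k / N) ^ 10 = real k ^ 10 / real N ^ 8"
      proof -
        have e: "real N ^ 10 = real N ^ 2 * real N ^ 8" by (simp add: power_add[symmetric])
        have "real N ^ 2 * (k / N) ^ 10 = (real N ^ 2 * real k ^ 10) / (real N ^ 2 * real N ^ 8)"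
          unfolding power_divide e by (rule times_divide_eq_right)
        also have "\<dots> = real k ^ 10 / real N ^ 8"
          using N_pos by (intro mult_divide_mult_cancel_left) simp
        finally show ?thesis .
      qed
      then show ?thesis by (simp only: power_mult power_mult_distrib[symmetric])
    qed
    also have "\<dots> \<le> ((1 / real k) ^ 5) ^ k"
    proof (intro power_mono)
      have "real (k ^ 15) \<le> real (N ^ 8)" using kN(2) by (simp only: of_nat_le_iff)
      then have "real k ^ 10 * real k ^ 5 \<le> real N ^ 8" by (simp add: power_add[symmetric])
      then show "real k ^ 10 / real N ^ 8 \<le> (1 / real k) ^ 5"
        using k_pos N_pos by (simp add: power_divide divide_le_eq le_divide_eq)
    qed auto
    also have "\<dots> = ((1 / real k) ^ k) ^ 5" by (simp add: power_mult[symmetric] mult.commute)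
    finally show ?thesis by (rule power_le_imp_le_base[of _ 4, simplified]) auto
  qed
  also have "\<dots> \<le> (40000000000 / q) ^ k"
  proof (intro power_mono)
    have "1 / real k \<le> 1 / real q" using qk q_pos by (intro divide_left_mono) auto
    also have "\<dots> \<le> 40000000000 / q" by (intro divide_right_mono) auto
    finally show "1 / real k \<le> 40000000000 / q" .
  qed auto
  finally show ?thesis .
qed

text \<open>One direction of \<open>half\<close> is enough as soon as the copy that supplies the
  edges has \<open>S\<close> in at least \<open>k / 5\<close> cells. By symmetry only the case of
  two collapsed copies remains.\<close>

lemma pr_indep:
  "pr (\<Omega> \<times> \<Omega>) (\<lambda>(a, b). Good N q t (snd a) \<and> Good N q t (snd b) \<and> half N a b S \<and> half N b a S)
     \<le> 7 * (40000000000 / q) ^ k"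
proof -
  have fin: "finite (\<Omega> \<times> \<Omega>)" by simp
  let ?A = "\<lambda>(a, b). Good N q t (snd a) \<and> k \<le> 5 * card (fst b ` S) \<and> half N a b S"
  let ?B = "\<lambda>(b, a). Good N q t (snd a) \<and> k \<le> 5 * card (fst b ` S) \<and> half N a b S"
  let ?C = "\<lambda>(a, b). card (fst a ` S) \<le> k div 5 \<and> card (fst b ` S) \<le> k div 5"
  have "pr (\<Omega> \<times> \<Omega>) (\<lambda>(a, b). Good N q t (snd a) \<and> Good N q t (snd b) \<and> half N a b S \<and> half N b a S)
    \<le> pr (\<Omega> \<times> \<Omega>) (\<lambda>p. ?A p \<or> (?B p \<or> ?C p))"
    by (intro pr_mono[OF fin]) auto
  also have "\<dots> \<le> 3 * (40000000000 / q) ^ k + (3 * (40000000000 / q) ^ k + (40000000000 / q) ^ k)"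
  proof -
    have "pr (\<Omega> \<times> \<Omega>) ?B = pr (\<Omega> \<times> \<Omega>) ?A"
      by (subst pr_prod_swap) (simp add: case_prod_unfold)
    then show ?thesis using pr_half pr_both_collapsed
      by (intro order_trans[OF pr_disj[OF fin]] add_mono) simp_all
  qed
  finally show ?thesis by simp
qed

end

section \<open>The random colouring\<close>

lemma not_partn_3_3:
  fixes E F :: "nat \<Rightarrow> nat \<Rightarrow> bool"
  assumes sym: "\<And>u v. E u v = E v u" "\<And>u v. F u v = F v u"
    and tf: "\<And>u v w. E u v \<Longrightarrow> E v w \<Longrightarrow> E u w \<Longrightarrow> False" "\<And>u v w. F u v \<Longrightarrow> F v w \<Longrightarrow> F u w \<Longrightarrow> False"
    and no: "\<And>S. S \<subseteq> {..<n} \<Longrightarrow> card S = k \<Longrightarrow> \<exists>u\<in>S. \<exists>v\<in>S. u \<noteq> v \<and> (E u v \<or> F u v)"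
  shows "n < ramsey_number [3, 3, k]"
proof -
  \<comment> \<open>A pair in both graphs becomes red; green then only loses edges, so it stays
    triangle-free.\<close>
  define c :: "nat set \<Rightarrow> nat" where
    "c e = (if \<exists>u v. e = {u, v} \<and> E u v then 0 else if \<exists>u v. e = {u, v} \<and> F u v then 1 else 2)" for e
  have c0: "c {u, v} = 0 \<longleftrightarrow> E u v" and c1: "c {u, v} = 1 \<Longrightarrow> F u v"
    and c2: "c {u, v} = 2 \<longleftrightarrow> \<not> E u v \<and> \<not> F u v" for u v
    using sym by (auto simp: c_def doubleton_eq_iff split: if_splits)
  have len: "length [3, 3, k] = 3" by (simp add: numeral_3_eq_3)
  have "\<not> partn_lst {..<n} [3, 3, k] 2"
  proof
    assume "partn_lst {..<n} [3, 3, k] 2"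
    moreover have "c \<in> nsets {..<n} 2 \<rightarrow> {..<3}" by (auto simp: c_def)
    ultimately obtain i H where i: "i < 3" and H: "H \<in> nsets {..<n} ([3, 3, k] ! i)" "c ` nsets H 2 \<subseteq> {i}"
      by (rule partn_lstE) (rule len, metis len)
    have mono: "c {x, y} = i" if "x \<in> H" "y \<in> H" "x \<noteq> y" for x y
      using H(2) that by (auto simp: image_subset_iff)
    consider "i = 0" | "i = 1" | "i = 2" using i by linarith
    then show False
    proof cases
      case 1
      then obtain x y z where "x \<in> H" "y \<in> H" "z \<in> H" "x \<noteq> y" "x \<noteq> z" "y \<noteq> z"
        using H(1) by (auto simp: nsets_3_eq)
      then show False using mono c0 tf(1)[of x y z] 1 by metis
    next
      case 2
      then obtain x y z where "x \<in> H" "y \<in> H" "z \<in> H" "x \<noteq> y" "x \<noteq> z" "y \<noteq> z"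
        using H(1) by (auto simp: nsets_3_eq)
      then show False using mono c1 tf(2)[of x y z] 2 by metis
    next
      case 3
      then have "H \<subseteq> {..<n}" "card H = k" using H(1) by (auto simp: nsets_def numeral_2_eq_2)
      then obtain u v where "u \<in> H" "v \<in> H" "u \<noteq> v" "E u v \<or> F u v" using no by blast
      then show False using mono[of u v] c2[of u v] 3 by simp
    qed
  qed
  then show ?thesis
    using partn_lst_ramsey_number partn_lst_greater_resource by (meson not_less)
qed

definition edge :: "nat \<Rightarrow> copy \<Rightarrow> copy \<Rightarrow> nat \<Rightarrow> nat \<Rightarrow> bool" where
  "edge N a b u v \<longleftrightarrow> (adjs N (snd b) (fst b u) (fst b v) \<and> \<not> closed N (snd a) (fst a u) (fst a v))
     \<or> (adjs N (snd a) (fst a u) (fst a v) \<and> \<not> closed N (snd b) (fst b u) (fst b v))"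

lemma closed_sym: "closed N f x y = closed N f y x"
  by (auto simp: closed_def)

lemma edge_sym: "edge N a b u v = edge N a b v u"
  unfolding edge_def by (simp add: adjs_sym closed_sym)

lemma closedI: "adjs N f x w \<Longrightarrow> adjs N f w y \<Longrightarrow> closed N f x y"
  unfolding closed_def by (metis adjs_sym adjs_def)

text \<open>Two of the three edges of a triangle come from the same copy, which closes the third pair in that copy.\<close>

lemma edge_triangle_free: "edge N a b u v \<Longrightarrow> edge N a b v w \<Longrightarrow> edge N a b u w \<Longrightarrow> False"
  unfolding edge_def by (metis adjs_sym closedI adjs_triangle_free)

lemma edge_if_not_half:
  "\<not> (half N a b S \<and> half N b a S) \<Longrightarrow> \<exists>u\<in>S. \<exists>v\<in>S. u \<noteq> v \<and> edge N a b u v"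
  unfolding half_def edge_def by (metis adjs_def adj_def)

context params
begin

lemma pr_snd_not_Good: "pr \<Omega> (\<lambda>a. \<not> Good N q t (snd a)) \<le> 1 / 8"
proof -
  have "pr \<Omega> (\<lambda>a. \<not> Good N q t (snd a)) \<le> pr \<Omega> (\<lambda>(g, f). True \<and> \<not> Good N q t f)"
    by (rule pr_mono) auto
  also have "\<dots> \<le> pr Pos (\<lambda>_. True) * pr (lab N q) (\<lambda>f. \<not> Good N q t f)"
    unfolding \<Omega>_def by (rule pr_prod_indep) auto
  also have "\<dots> \<le> 1 * (1 / 8)" by (intro mult_mono pr_le_1 pr_not_Good pr_nonneg) auto
  finally show ?thesis by simp
qed

lemma pr_pair_not_Good:
  "pr (\<Omega> \<times> \<Omega>) (\<lambda>(a, b). \<not> (Good N q t (snd a) \<and> Good N q t (snd b))) \<le> 1 / 4"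
proof -
  let ?P = "\<lambda>a. \<not> Good N q t (snd a)"
  have "pr (\<Omega> \<times> \<Omega>) (\<lambda>(a, b). \<not> (Good N q t (snd a) \<and> Good N q t (snd b)))
    \<le> pr (\<Omega> \<times> \<Omega>) (\<lambda>p. (case p of (a, b) \<Rightarrow> ?P a \<and> True) \<or> (case p of (a, b) \<Rightarrow> True \<and> ?P b))"
    by (rule pr_mono) auto
  also have "\<dots> \<le> pr \<Omega> ?P * pr \<Omega> (\<lambda>_. True) + pr \<Omega> (\<lambda>_. True) * pr \<Omega> ?P"
    by (intro order_trans[OF pr_disj] add_mono pr_prod_indep) auto
  also have "\<dots> \<le> 1 / 8 * 1 + 1 * (1 / 8)"
    by (intro add_mono mult_mono pr_le_1 pr_snd_not_Good pr_nonneg) auto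
  finally show ?thesis by simp
qed

text \<open>All four labellings are good with probability at least 1/2, which leaves the other half
  for the union bound over the \<open>k\<close>-sets. The square comes from the independence of red
  and green, and \<open>98 = 2 * 7^2\<close>.\<close>

lemma less_ramsey_number:
  assumes small: "98 * real (n choose k) * ((40000000000 / q) ^ k)\<^sup>2 < 1"
  shows "n < ramsey_number [3, 3, k]"
proof -
  let ?\<beta> = "7 * (40000000000 / q) ^ k :: real"
  let ?G = "\<lambda>(a, b). Good N q t (snd a) \<and> Good N q t (snd b)"
  let ?I = "\<lambda>S (a, b). Good N q t (snd a) \<and> Good N q t (snd b) \<and> half N a b S \<and> half N b a S"
  let ?\<SS> = "{S. S \<subseteq> {..<n} \<and> card S = k}"
  have fin: "finite (\<Omega> \<times> \<Omega>)" by simp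
  have fin\<SS>: "finite ?\<SS>" by (rule finite_subset[of _ "Pow {..<n}"]) auto
  have "\<exists>p\<in>(\<Omega> \<times> \<Omega>) \<times> (\<Omega> \<times> \<Omega>). ?G (fst p) \<and> ?G (snd p) \<and> (\<forall>S\<in>?\<SS>. \<not> (?I S (fst p) \<and> ?I S (snd p)))"
  proof (rule ccontr)
    assume no: "\<not> ?thesis"
    have "0 < card ((\<Omega> \<times> \<Omega>) \<times> (\<Omega> \<times> \<Omega>))"
      using card_Pos card_lab_pos[OF q_pos] by (simp add: \<Omega>_def card_cartesian_product)
    then have "1 = pr ((\<Omega> \<times> \<Omega>) \<times> (\<Omega> \<times> \<Omega>)) (\<lambda>_. True)" by (auto simp: pr_def)
    also have "\<dots> \<le> pr ((\<Omega> \<times> \<Omega>) \<times> (\<Omega> \<times> \<Omega>)) (\<lambda>p. (case p of (a, b) \<Rightarrow> \<not> ?G a \<and> True)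
        \<or> ((case p of (a, b) \<Rightarrow> True \<and> \<not> ?G b) \<or> (\<exists>S\<in>?\<SS>. case p of (a, b) \<Rightarrow> ?I S a \<and> ?I S b)))"
      using no by (intro pr_mono) (simp, force)
    also have "\<dots> \<le> 1 / 4 + (1 / 4 + card ?\<SS> * (?\<beta> * ?\<beta>))"
    proof (intro order_trans[OF pr_disj] add_mono)
      have g: "pr (\<Omega> \<times> \<Omega>) (\<lambda>a. \<not> ?G a) \<le> 1 / 4"
        using pr_pair_not_Good by (simp add: case_prod_unfold)
      have "pr ((\<Omega> \<times> \<Omega>) \<times> (\<Omega> \<times> \<Omega>)) (\<lambda>(a, b). \<not> ?G a \<and> True)
         \<le> pr (\<Omega> \<times> \<Omega>) (\<lambda>a. \<not> ?G a) * pr (\<Omega> \<times> \<Omega>) (\<lambda>_. True)"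
        by (rule pr_prod_indep) auto
      also have "\<dots> \<le> 1 / 4 * 1" by (intro mult_mono g pr_le_1 pr_nonneg) auto
      finally show "pr ((\<Omega> \<times> \<Omega>) \<times> (\<Omega> \<times> \<Omega>)) (\<lambda>(a, b). \<not> ?G a \<and> True) \<le> 1 / 4" by simp
      have "pr ((\<Omega> \<times> \<Omega>) \<times> (\<Omega> \<times> \<Omega>)) (\<lambda>(a, b). True \<and> \<not> ?G b)
         \<le> pr (\<Omega> \<times> \<Omega>) (\<lambda>_. True) * pr (\<Omega> \<times> \<Omega>) (\<lambda>a. \<not> ?G a)"
        by (rule pr_prod_indep) auto
      also have "\<dots> \<le> 1 * (1 / 4)" by (intro mult_mono g pr_le_1 pr_nonneg) auto
      finally show "pr ((\<Omega> \<times> \<Omega>) \<times> (\<Omega> \<times> \<Omega>)) (\<lambda>(a, b). True \<and> \<not> ?G b) \<le> 1 / 4" by simp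
      show "pr ((\<Omega> \<times> \<Omega>) \<times> (\<Omega> \<times> \<Omega>)) (\<lambda>p. \<exists>S\<in>?\<SS>. case p of (a, b) \<Rightarrow> ?I S a \<and> ?I S b) \<le> card ?\<SS> * (?\<beta> * ?\<beta>)"
      proof (rule pr_Ex_le)
        fix S assume "S \<in> ?\<SS>"
        then interpret sets N q t d0 k s n S by unfold_locales auto
        have "pr ((\<Omega> \<times> \<Omega>) \<times> (\<Omega> \<times> \<Omega>)) (\<lambda>(a, b). ?I S a \<and> ?I S b) \<le> pr (\<Omega> \<times> \<Omega>) (?I S) * pr (\<Omega> \<times> \<Omega>) (?I S)"
          by (rule pr_prod_indep) auto
        also have "\<dots> \<le> ?\<beta> * ?\<beta>" by (intro mult_mono pr_indep pr_nonneg) auto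
        finally show "pr ((\<Omega> \<times> \<Omega>) \<times> (\<Omega> \<times> \<Omega>)) (\<lambda>(a, b). ?I S a \<and> ?I S b) \<le> ?\<beta> * ?\<beta>" .
      qed (use fin\<SS> in auto)
    qed auto
    also have "card ?\<SS> = n choose k" using n_subsets[of "{..<n}" k] by simp
    also have "1 / 4 + (1 / 4 + (n choose k) * (?\<beta> * ?\<beta>)) = 1 / 2 + 98 * real (n choose k) * ((40000000000 / q) ^ k)\<^sup>2 / 2"
      by (simp add: power2_eq_square)
    finally show False using small by linarith
  qed
  then obtain a b a' b' where ab: "?G (a, b)" "?G (a', b')" "\<And>S. S \<in> ?\<SS> \<Longrightarrow> \<not> (?I S (a, b) \<and> ?I S (a', b'))"
    by force
  show ?thesis
  proof (rule not_partn_3_3[where E = "edge N a b" and F = "edge N a' b'"])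
    fix S assume S: "S \<subseteq> {..<n}" "card S = k"
    then have "\<not> (half N a b S \<and> half N b a S) \<or> \<not> (half N a' b' S \<and> half N b' a' S)"
      using ab by auto
    then show "\<exists>u\<in>S. \<exists>v\<in>S. u \<noteq> v \<and> (edge N a b u v \<or> edge N a' b' u v)" using edge_if_not_half by blast
  qed (use edge_sym edge_triangle_free in blast)+
qed

end

section \<open>Choice of parameters\<close>

lemma ramsey_number_lower:
  "\<forall>\<^sub>F k :: nat in sequentially. 1 / 10 ^ 32 * real k ^ 3 / (ln (real k))\<^sup>2 \<le> real (ramsey_number [3, 3, k])"
proof -
  define M :: "real \<Rightarrow> real" where "M x = (x / (40000 * ln x))\<^sup>2 / 6000" for x
  \<comment> \<open>All requirements on \<open>k\<close>, stated for a real variable. Here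
    \<open>x / (40000 * ln x)\<close> is a lower bound for \<open>q\<close> and \<open>M x\<close>
    one for \<open>N\<close>, which keeps rounding out of the asymptotic comparisons.\<close>
  define Q :: "real \<Rightarrow> bool" where "Q x \<longleftrightarrow> 1 \<le> ln x \<and> 1 + x / (40000 * ln x) \<le> x / (20000 * ln x)
      \<and> ((ln x)\<^sup>2 + 1) ^ 10 \<le> x / (40000 * ln x) \<and> 1920 + 960 * ln x \<le> (ln x)\<^sup>2
      \<and> 100000000 \<le> x / (40000 * ln x) \<and> x\<^sup>2 \<le> exp (x / (32000000 * ln x))
      \<and> 8 * ((ln x)\<^sup>2 + 1)\<^sup>2 \<le> M x \<and> x / (20000 * ln x) \<le> x \<and> 48 * x / 20000 \<le> x / 320 - 1
      \<and> 512 * ((ln x)\<^sup>2 + 1) ^ 6 * x\<^sup>2 \<le> x ^ 3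
      \<and> x ^ 39 \<le> M x ^ 20 \<and> x ^ 15 \<le> M x ^ 8 \<and> 16 * ((ln x)\<^sup>2 + 1)\<^sup>2 * ln x \<le> x / 2
      \<and> ln x * ((ln x)\<^sup>2 + 1) \<le> x / 2 \<and> 4 * x \<le> exp ((ln x)\<^sup>2 / 2)
      \<and> x ^ 3 / (ln x)\<^sup>2 + 10 ^ 32 \<le> 6 * (x ^ 3 / (ln x)\<^sup>2) \<and> 10 \<le> x" for x
  have "\<forall>\<^sub>F x in at_top. Q x"
    unfolding Q_def M_def by (intro eventually_conj; real_asymp)
  then have ev: "\<forall>\<^sub>F k :: nat in sequentially. Q (real k)"
    using filterlim_real_sequentially by (rule eventually_compose_filterlim)
  have half_ln2: "1 / 2 \<le> ln (2 :: real)" using ln_le_minus_one[of "1 / 2"] by (simp add: ln_div)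
  from ev show ?thesis
  proof (rule eventually_mono)
    fix k :: nat
    define l where "l = ln (real k)"
    define y where "y = real k / (40000 * l)"
    assume "Q (real k)"
    then have a1: "1 \<le> l" "1 + y \<le> k / (20000 * l)" "(l\<^sup>2 + 1) ^ 10 \<le> y" "1920 + 960 * l \<le> l\<^sup>2"
        "100000000 \<le> y" "(real k)\<^sup>2 \<le> exp (k / (32000000 * l))" "8 * (l\<^sup>2 + 1)\<^sup>2 \<le> y\<^sup>2 / 6000"
        "k / (20000 * l) \<le> k" "48 * real k / 20000 \<le> real k / 320 - 1"
      and a2: "512 * (l\<^sup>2 + 1) ^ 6 * (real k)\<^sup>2 \<le> real k ^ 3" "real k ^ 39 \<le> (y\<^sup>2 / 6000) ^ 20"
        "real k ^ 15 \<le> (y\<^sup>2 / 6000) ^ 8" "16 * (l\<^sup>2 + 1)\<^sup>2 * l \<le> k / 2"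
        "l * (l\<^sup>2 + 1) \<le> k / 2" "4 * real k \<le> exp (l\<^sup>2 / 2)"
        "real k ^ 3 / l\<^sup>2 + 10 ^ 32 \<le> 6 * (real k ^ 3 / l\<^sup>2)" "10 \<le> real k"
      by (simp_all only: Q_def l_def y_def M_def)
    \<comment> \<open>The constant 20000 is chosen for \<open>pay\<close>:
      \<open>48 / 20000 < 1 / 320\<close>.\<close>
    define q where "q = nat \<lfloor>k / (20000 * l)\<rfloor>"
    define N where "N = q\<^sup>2 div 3000"
    define t where "t = nat \<lceil>l\<^sup>2\<rceil>"
    define s where "s = 8 * t\<^sup>2"
    define d0 where "d0 = (q + 399) div 400"
    \<comment> \<open>\<open>10 ^ 22\<close> is more than twice
      \<open>exp 1 * 40000000000^2\<close>, so the union bound decays like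
      \<open>(1 / 2) ^ k\<close>.\<close>
    define n where "n = nat \<lfloor>1 / 10 ^ 22 * k * (real q)\<^sup>2\<rfloor>"
    have l0: "0 \<le> l" using a1(1) by simp
    have kl: "real k = exp l" using a2(8) by (simp add: l_def)
    have z: "0 \<le> k / (20000 * l)" using a1(1) by simp
    have q_le: "q \<le> k / (20000 * l)" and q_ge: "y \<le> q"
      using z a1(2) unfolding q_def by linarith+
    have qk: "real q \<le> k" using q_le a1(8) by linarith
    have t: "l\<^sup>2 \<le> t" "t \<le> l\<^sup>2 + 1" unfolding t_def using zero_le_power2[of l] by linarith+
    have sb: "s \<le> 8 * (l\<^sup>2 + 1)\<^sup>2" unfolding s_def using power_mono[OF t(2), of 2] by simp
    have y0: "0 \<le> y" using a1(5) by linarith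
    have yq: "y\<^sup>2 \<le> (real q)\<^sup>2" using q_ge y0 by (intro power_mono)
    have q8: "100000000 \<le> q" using a1(5) q_ge by linarith
    have Nu: "3000 * N \<le> q\<^sup>2" and Nl: "q\<^sup>2 \<le> 3000 * N + 2999"
      using div_mult_mod_eq[of "q\<^sup>2" 3000] mod_less_divisor[of 3000 "q\<^sup>2"] unfolding N_def by linarith+
    have Nu': "3000 * real N \<le> (real q)\<^sup>2" using of_nat_mono[OF Nu, where ?'a = real] by simp
    have q2: "10000 * 10000 \<le> (real q)\<^sup>2" unfolding power2_eq_square using q8 by (intro mult_mono) auto
    have Nl': "(real q)\<^sup>2 \<le> 6000 * N" using of_nat_mono[OF Nl, where ?'a = real] q2 by simp
    have Ny: "y\<^sup>2 / 6000 \<le> N" using Nl' yq by linarith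
    have Nk: "real N \<le> (real k)\<^sup>2" and N64: "real N * 64 \<le> (real k)\<^sup>2"
      using Nu' power_mono[OF qk of_nat_0_le_iff, of 2] by linarith+
    have two: "exp (x / 2) \<le> 2 ^ m" if "x \<le> real m" "0 \<le> x" for x m
    proof -
      have "exp (x / 2) \<le> exp (m * ln 2)"
        using mult_mono[OF that(1) half_ln2] that(2) by simp
      also have "\<dots> = 2 ^ m" by (simp add: exp_of_nat_mult)
      finally show ?thesis .
    qed
    have "y / 400 \<le> d0"
    proof -
      have "q \<le> 400 * d0" unfolding d0_def by linarith+
      then show ?thesis using q_ge by linarith
    qed
    have lq: "ln q \<le> l" unfolding l_def using qk q8 by simp
    interpret params N q t d0 k s n
    proof
      show "3000 * real N \<le> (real q)\<^sup>2" by (rule Nu')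
      have "real t ^ 10 \<le> (l\<^sup>2 + 1) ^ 10" by (intro power_mono t) auto
      then have "real (t ^ 10) \<le> real q" using a1(3) q_ge unfolding of_nat_power by linarith
      then show "t ^ 10 \<le> q" by (simp only: of_nat_le_iff)
      show "1920 + 960 * ln q \<le> t" using lq a1(4) t(1) by linarith
      show "100000000 \<le> q" by (rule q8)
      show "q \<le> 400 * d0" "400 * d0 \<le> q + 400" unfolding d0_def by linarith+
      have "real N * 64 \<le> exp (k / (32000000 * l))" using N64 a1(6) by linarith
      also have "k / (32000000 * l) = y / 400 / 2" by (simp add: y_def)
      also have "exp (y / 400 / 2) \<le> 2 ^ d0" using \<open>y / 400 \<le> d0\<close> y0 by (intro two) auto
      finally show "real N * 64 \<le> 2 ^ d0" .
      show "s = 8 * t\<^sup>2" by (rule s_def)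
      show "s \<le> N" using sb a1(7) Ny by linarith
      show "q \<le> k" using qk by simp
      have ql: "q * l \<le> k / 20000" using q_le a1(1) by (simp add: field_simps)
      then show "48 * q * ln k \<le> k / 320 - 1" unfolding l_def[symmetric] using a1(9) by linarith
      have "k = 40000 * y * l" using a1(1) by (simp add: y_def)
      also have "\<dots> \<le> 40000 * q * l" using q_ge a1(1) by simp
      finally show "k \<le> 40000 * q * ln k" unfolding l_def .
      show "(real q)\<^sup>2 \<le> 6000 * N" by (rule Nl')
      have "real s ^ 3 * N \<le> (8 * (l\<^sup>2 + 1)\<^sup>2) ^ 3 * (real k)\<^sup>2" by (intro mult_mono power_mono sb Nk) auto
      also have "\<dots> = 512 * (l\<^sup>2 + 1) ^ 6 * (real k)\<^sup>2" by (simp add: power_mult_distrib power_mult[symmetric])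
      finally have "real (s ^ 3 * N) \<le> real (k ^ 3)" using a2(1) unfolding of_nat_power of_nat_mult by linarith
      then show "s ^ 3 * N \<le> k ^ 3" by (simp only: of_nat_le_iff)
      have "(y\<^sup>2 / 6000) ^ 20 \<le> real N ^ 20" using Ny by (intro power_mono) auto
      then have "real (k ^ 39) \<le> real (N ^ 20)" using a2(2) unfolding of_nat_power of_nat_mult by linarith
      then show "k ^ 39 \<le> N ^ 20" by (simp only: of_nat_le_iff)
      have "(y\<^sup>2 / 6000) ^ 8 \<le> real N ^ 8" using Ny by (intro power_mono) auto
      then have "real (k ^ 15) \<le> real (N ^ 8)" using a2(3) unfolding of_nat_power of_nat_mult by linarith
      then show "k ^ 15 \<le> N ^ 8" by (simp only: of_nat_le_iff)
      have "real N ^ s \<le> ((real k)\<^sup>2) ^ s" by (intro power_mono Nk) auto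
      also have "\<dots> = exp (2 * s * l)" by (simp add: kl exp_of_nat_mult[symmetric] power_mult[symmetric] del: exp_of_nat_mult)
      also have "2 * s * l \<le> k / 2" using mult_right_mono[OF sb l0] a2(4) by (simp add: algebra_simps)
      also have "exp (real k / 2) \<le> 2 ^ k" by (rule two) auto
      finally show "real N ^ s \<le> 2 ^ k" by simp
      have "real q ^ t \<le> real k ^ t" by (intro power_mono qk) auto
      also have "\<dots> = exp (t * l)" by (simp add: kl exp_of_nat_mult)
      also have "t * l \<le> k / 2" using mult_right_mono[OF t(2) l0] a2(5) by (simp add: algebra_simps)
      also have "exp (real k / 2) \<le> 2 ^ k" by (rule two) auto
      finally show "real q ^ t \<le> 2 ^ k" by simp
      have "real (4 * k) \<le> exp (l\<^sup>2 / 2)" using a2(6) by simp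
      also have "\<dots> \<le> 2 ^ t" using t(1) by (intro two) auto
      finally have "real (4 * k) \<le> real (2 ^ t)" by simp
      then show "4 * k \<le> 2 ^ t" by (simp only: of_nat_le_iff)
    qed
    have k0: "0 < k" using k_pos .
    have q0: "0 < real q" using q_pos by simp
    have nb: "n \<le> 1 / 10 ^ 22 * k * (real q)\<^sup>2" "1 / 10 ^ 22 * k * (real q)\<^sup>2 - 1 \<le> n"
    proof -
      have "0 \<le> 1 / 10 ^ 22 * k * (real q)\<^sup>2" by simp
      then show "n \<le> 1 / 10 ^ 22 * k * (real q)\<^sup>2" "1 / 10 ^ 22 * k * (real q)\<^sup>2 - 1 \<le> n"
        unfolding n_def by linarith+
    qed
    have "n < ramsey_number [3, 3, k]"
    proof (rule less_ramsey_number)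
      have sq: "(x ^ k)\<^sup>2 = (x\<^sup>2) ^ k" for x :: real
        by (simp add: power_mult[symmetric] mult.commute)
      have "98 * real (n choose k) * ((40000000000 / q) ^ k)\<^sup>2
        \<le> 98 * (exp 1 * n / k) ^ k * ((40000000000 / q) ^ k)\<^sup>2"
        using k0 by (intro mult_right_mono mult_left_mono choose_le_exp) auto
      also have "\<dots> = 98 * (exp 1 * n / k * (40000000000 / q)\<^sup>2) ^ k"
        by (simp only: sq power_mult_distrib[symmetric] mult.assoc)
      also have "\<dots> \<le> 98 * (1 / 2) ^ k"
      proof (intro mult_left_mono power_mono)
        have "n / k * (40000000000 / q)\<^sup>2 \<le> 1 / 10 ^ 22 * (real q)\<^sup>2 * (40000000000 / q)\<^sup>2"
          using nb(1) k0 by (intro mult_right_mono) (auto simp: field_simps)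
        also have "\<dots> = 4 / 25" using q0 by (simp add: power_divide)
        finally have "exp 1 * (n / k * (40000000000 / q)\<^sup>2) \<le> 3 * (4 / 25)"
          using exp_le by (intro mult_mono) auto
        then show "exp 1 * n / k * (40000000000 / q)\<^sup>2 \<le> 1 / 2" by simp
      qed auto
      also have "98 * (1 / 2) ^ k \<le> 98 * (1 / 2 :: real) ^ 10" using a2(8) by (intro mult_left_mono power_decreasing) auto
      also have "98 * (1 / 2) ^ 10 < (1 :: real)" by (simp add: power_divide)
      finally show "98 * real (n choose k) * ((40000000000 / q) ^ k)\<^sup>2 < 1" .
    qed
    moreover define z where "z = real k ^ 3 / l\<^sup>2"
    moreover have "k * y\<^sup>2 = z / 1600000000"
      by (simp add: z_def y_def power_divide power_mult_distrib power2_eq_square power3_eq_cube)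
    moreover have "1 / 10 ^ 22 * (k * y\<^sup>2) \<le> 1 / 10 ^ 22 * k * (real q)\<^sup>2"
      using mult_left_mono[OF yq, of "k / 10 ^ 22"] by simp
    ultimately have r: "1 / 10 ^ 22 * (z / 1600000000) - 1 \<le> real (ramsey_number [3, 3, k])"
        and z: "z + 10 ^ 32 \<le> 6 * z"
      using a2(7) nb(2) by simp_all
    \<comment> \<open>\<open>10 ^ 22 * 40000^2\<close> is 1.6 times 10^31; the slack up to
      \<open>10 ^ 32\<close> absorbs the rounding of \<open>n\<close>.\<close>
    have "z / 10 ^ 32 \<le> 1 / 10 ^ 22 * (z / 1600000000) - 1" using z by simp
    then have "z / 10 ^ 32 \<le> real (ramsey_number [3, 3, k])" using r by (rule order_trans)
    then show "1 / 10 ^ 32 * real k ^ 3 / (ln (real k))\<^sup>2 \<le> real (ramsey_number [3, 3, k])"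
      by (simp add: z_def l_def)
  qed
qed

section \<open>Independent sets in triangle-free graphs\<close>

lemma sum_card_Pow:
  assumes "finite A" shows "2 * (\<Sum>B\<in>Pow A. card B) = card A * 2 ^ card A"
  using assms
proof (induction A rule: finite_induct)
  case (insert a A)
  have "(\<Sum>B\<in>Pow (insert a A). card B) = (\<Sum>B\<in>Pow A. card B) + (\<Sum>B\<in>insert a ` Pow A. card B)"
    unfolding Pow_insert using insert by (intro sum.union_disjoint) auto
  also have "(\<Sum>B\<in>insert a ` Pow A. card B) = (\<Sum>B\<in>Pow A. card (insert a B))"
    using insert by (subst sum.reindex) (auto simp: inj_on_def)
  also have "\<dots> = (\<Sum>B\<in>Pow A. card B + 1)"
    using insert finite_subset by (intro sum.cong refl) (subst card_insert_disjoint, auto)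
  finally show ?case using insert by (simp add: sum_Suc card_Pow)
qed simp

text \<open>If \<open>x\<close> is at least half of \<open>ln D\<close>, the second summand on the
  right is enough. Otherwise \<open>2 ^ x \<le> exp x \<le> sqrt D\<close>, and \<open>D\<close> is
  enough.\<close>

lemma log_balance:
  fixes D :: real assumes "1 \<le> D"
  shows "ln D / 8 * (2 ^ x + 1) \<le> D + x * 2 ^ x / 2"
proof (cases "ln D / 2 \<le> x")
  case True
  have "ln D / 8 * (2 ^ x + 1) \<le> ln D / 8 * (2 ^ x + 2 ^ x)"
    using assms by (intro mult_left_mono add_mono) auto
  also have "\<dots> = ln D / 2 * 2 ^ x / 2" by simp
  also have "\<dots> \<le> x * 2 ^ x / 2" using True by (intro divide_right_mono mult_right_mono) auto
  finally show ?thesis using assms by simp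
next
  case False
  have s: "1 \<le> sqrt D" using assms by simp
  have l: "ln D = 2 * ln (sqrt D)" using assms by (simp add: ln_sqrt)
  have "(2 :: real) ^ x \<le> exp 1 ^ x" using exp_ge_add_one_self[of 1] by (intro power_mono) auto
  also have "\<dots> = exp x" by (simp add: exp_of_nat_mult[symmetric])
  also have "\<dots> \<le> exp (ln (sqrt D))" using False l by simp
  also have "\<dots> = sqrt D" using s by simp
  finally have "ln D / 8 * (2 ^ x + 1) \<le> ln D / 8 * (sqrt D + sqrt D)"
    using s assms by (intro mult_left_mono add_mono) auto
  also have "\<dots> = ln (sqrt D) * sqrt D / 2" using l by simp
  also have "\<dots> \<le> sqrt D * sqrt D / 2"
    using s ln_le_minus_one[of "sqrt D"] by (intro divide_right_mono mult_right_mono) auto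
  also have "\<dots> \<le> D" using assms by simp
  finally show ?thesis by (rule order_trans) simp
qed

definition free :: "('a \<Rightarrow> 'a \<Rightarrow> bool) \<Rightarrow> 'a set \<Rightarrow> bool" where
  "free E W \<longleftrightarrow> (\<forall>x\<in>W. \<forall>y\<in>W. \<not> E x y)"

text \<open>Alon's argument: the weight of a vertex, averaged over a uniformly random independent set, is
  bounded below by conditioning on the part of that set outside the closed neighbourhood of the vertex.\<close>

lemma independent_set_triangle_free:
  fixes E :: "'a \<Rightarrow> 'a \<Rightarrow> bool" and D :: real
  assumes V: "finite V" and D: "1 \<le> D"
    and sym: "\<And>x y. E x y = E y x" and irr: "\<And>x. \<not> E x x"
    and tf: "\<And>x y z. x \<in> V \<Longrightarrow> y \<in> V \<Longrightarrow> z \<in> V \<Longrightarrow> E x y \<Longrightarrow> E y z \<Longrightarrow> E x z \<Longrightarrow> False"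
    and deg: "\<And>v. v \<in> V \<Longrightarrow> card {w\<in>V. E v w} \<le> D"
  shows "\<exists>W\<subseteq>V. free E W \<and> card V * ln D / (16 * D) \<le> card W"
proof -
  define \<I> where "\<I> = {W. W \<subseteq> V \<and> free E W}"
  define N where "N v = {w\<in>V. E v w}" for v
  define X where "X v W = D * of_bool (v \<in> W) + card (N v \<inter> W)" for v W
  have fI: "finite \<I>" by (rule finite_subset[of _ "Pow V"]) (use V in \<open>auto simp: \<I>_def\<close>)
  have "{} \<in> \<I>" by (simp add: \<I>_def free_def)
  then have cI: "0 < card \<I>" using fI card_gt_0_iff by blast
  have fin: "finite W" if "W \<subseteq> V" for W using that V finite_subset by blast
  \<comment> \<open>Double counting: each element of \<open>W\<close> contributes \<open>D\<close>
    for itself and at most \<open>D\<close> as a neighbour of others.\<close>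
  have upper: "(\<Sum>v\<in>V. X v W) \<le> 2 * D * card W" if "W \<in> \<I>" for W
  proof -
    have W: "W \<subseteq> V" using that by (simp add: \<I>_def)
    have "(\<Sum>v\<in>V. real (card (N v \<inter> W))) = (\<Sum>v\<in>V. \<Sum>w\<in>W. of_bool (E v w))"
    proof (rule sum.cong)
      fix v assume "v \<in> V"
      have "N v \<inter> W = {w\<in>W. E v w}" using W by (auto simp: N_def)
      then show "real (card (N v \<inter> W)) = (\<Sum>w\<in>W. of_bool (E v w))"
        using fin[OF W] by (simp add: Int_def)
    qed simp
    also have "\<dots> = (\<Sum>w\<in>W. \<Sum>v\<in>V. of_bool (E v w))" by (rule sum.swap)
    also have "\<dots> = (\<Sum>w\<in>W. real (card {v\<in>V. E w v}))"
      using V by (simp add: Int_def sym)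
    also have "\<dots> \<le> card W * D" using deg W by (intro sum_bounded_above) auto
    finally have 1: "(\<Sum>v\<in>V. real (card (N v \<inter> W))) \<le> card W * D" .
    have "(\<Sum>v\<in>V. of_bool (v \<in> W)) = real (card W)"
      using V W by (simp add: Int_absorb1 Int_def) (metis Collect_mem_eq Int_absorb1 Int_def)
    then have "(\<Sum>v\<in>V. D * of_bool (v \<in> W)) = D * card W" by (simp only: sum_distrib_left[symmetric])
    then show ?thesis using 1 by (simp add: X_def sum.distrib algebra_simps)
  qed
  have lower: "ln D / 8 * card \<I> \<le> (\<Sum>W\<in>\<I>. X v W)" if v: "v \<in> V" for v
  proof -
    define \<phi> where "\<phi> W = W - insert v (N v)" for W
    have fib: "ln D / 8 * card {W\<in>\<I>. \<phi> W = W0} \<le> (\<Sum>W\<in>{W\<in>\<I>. \<phi> W = W0}. X v W)" if "W0 \<in> \<phi> ` \<I>" for W0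
    proof -
      define A where "A = {u\<in>N v. \<forall>w\<in>W0. \<not> E u w}"
      have W0: "W0 \<subseteq> V" "free E W0" "W0 \<inter> insert v (N v) = {}"
        using that by (auto simp: \<phi>_def \<I>_def free_def)
      have A: "A \<subseteq> N v" "A \<subseteq> V" "v \<notin> A" "W0 \<inter> A = {}" using W0(3) irr by (auto simp: A_def N_def)
      have Afree: "\<not> E x y" if "x \<in> A" "y \<in> A" for x y
        using that tf[of v x y] v by (auto simp: A_def N_def)
      have vW0: "\<not> E v w" if "w \<in> W0" for w using W0 that by (auto simp: N_def)
      \<comment> \<open>Given \<open>W0\<close>, either \<open>v\<close> alone is added or an
        arbitrary subset of \<open>A\<close>: a neighbourhood is independent in a triangle-free
        graph. The weights over this fibre therefore sum to at least \<open>D\<close> plus the total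
        size of all subsets of \<open>A\<close>.\<close>
      have eq: "{W\<in>\<I>. \<phi> W = W0} = insert (insert v W0) ((\<union>) W0 ` Pow A)" (is "?L = ?R")
      proof (intro equalityI subsetI)
        fix W assume "W \<in> ?L"
        then have W: "W \<subseteq> V" "free E W" "W - insert v (N v) = W0" by (auto simp: \<phi>_def \<I>_def)
        show "W \<in> ?R"
        proof (cases "v \<in> W")
          case True
          then have "W \<inter> N v = {}" using W(2) by (auto simp: free_def N_def)
          then have "W = insert v W0" using W(3) True by auto
          then show ?thesis by simp
        next
          case False
          have "W \<inter> N v \<subseteq> A" using W(2,3) by (auto simp: A_def free_def)
          moreover have "W = W0 \<union> (W \<inter> N v)" using W(3) False by auto
          ultimately show ?thesis by blast
        qed
      next
        fix W assume "W \<in> ?R"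
        then consider "W = insert v W0" | B where "B \<subseteq> A" "W = W0 \<union> B" by auto
        then show "W \<in> ?L"
        proof cases
          case 1
          then show ?thesis using W0 v vW0 irr sym by (auto simp: \<I>_def \<phi>_def free_def)
        next
          case 2
          have "free E W" unfolding free_def 2(2)
          proof (intro ballI)
            fix x y assume "x \<in> W0 \<union> B" "y \<in> W0 \<union> B"
            then have "x \<in> W0 \<or> x \<in> A" "y \<in> W0 \<or> y \<in> A" using 2(1) by auto
            moreover have "\<not> E a b" if "a \<in> A" "b \<in> W0" for a b
              using that by (auto simp: A_def)
            ultimately show "\<not> E x y" using W0(2) Afree sym unfolding free_def by metis
          qed
          moreover have "W \<subseteq> V" using W0(1) A(2) 2 by blast
          moreover have "W - insert v (N v) = W0" using W0(3) A(1) 2 by blast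
          ultimately show ?thesis by (simp add: \<I>_def \<phi>_def)
        qed
      qed
      have fA: "finite A" using A(2) V finite_subset by blast
      have inj: "inj_on ((\<union>) W0) (Pow A)" using A(4) by (auto simp: inj_on_def)
      have notin: "insert v W0 \<notin> (\<union>) W0 ` Pow A" using W0(3) A(3) by auto
      have c: "card {W\<in>\<I>. \<phi> W = W0} = 2 ^ card A + 1"
        unfolding eq using notin fA by (simp add: card_image[OF inj] card_Pow)
      have "(\<Sum>W\<in>{W\<in>\<I>. \<phi> W = W0}. X v W) = X v (insert v W0) + (\<Sum>B\<in>Pow A. X v (W0 \<union> B))"
        unfolding eq using notin fA by (simp add: sum.reindex[OF inj])
      also have "(\<Sum>B\<in>Pow A. X v (W0 \<union> B)) = (\<Sum>B\<in>Pow A. real (card B))"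
      proof (rule sum.cong)
        fix B assume "B \<in> Pow A"
        then have "N v \<inter> (W0 \<union> B) = B" "v \<notin> W0 \<union> B" using A W0(3) by auto
        then show "X v (W0 \<union> B) = real (card B)" by (simp add: X_def)
      qed simp
      also have "\<dots> = real (2 * (\<Sum>B\<in>Pow A. card B)) / 2" by simp
      also have "\<dots> = card A * 2 ^ card A / 2" unfolding sum_card_Pow[OF fA] by simp
      finally have "(\<Sum>W\<in>{W\<in>\<I>. \<phi> W = W0}. X v W) = X v (insert v W0) + card A * 2 ^ card A / 2" .
      moreover have "D \<le> X v (insert v W0)" by (simp add: X_def)
      ultimately have "D + card A * 2 ^ card A / 2 \<le> (\<Sum>W\<in>{W\<in>\<I>. \<phi> W = W0}. X v W)" by simp
      moreover have "ln D / 8 * real (2 ^ card A + 1) \<le> D + card A * 2 ^ card A / 2"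
        using log_balance[OF D, of "card A"] by (simp add: add.commute)
      ultimately show ?thesis unfolding c by linarith
    qed
    have "ln D / 8 * card \<I> = (\<Sum>W\<in>\<I>. ln D / 8)" by simp
    also have "\<dots> = (\<Sum>W0\<in>\<phi> ` \<I>. \<Sum>W\<in>{W\<in>\<I>. \<phi> W = W0}. ln D / 8)"
      by (rule sum.image_gen[OF fI])
    also have "\<dots> \<le> (\<Sum>W0\<in>\<phi> ` \<I>. \<Sum>W\<in>{W\<in>\<I>. \<phi> W = W0}. X v W)"
    proof (rule sum_mono)
      fix W0 assume "W0 \<in> \<phi> ` \<I>"
      then show "(\<Sum>W\<in>{W\<in>\<I>. \<phi> W = W0}. ln D / 8) \<le> (\<Sum>W\<in>{W\<in>\<I>. \<phi> W = W0}. X v W)"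
        using fib by (simp add: mult.commute)
    qed
    also have "\<dots> = (\<Sum>W\<in>\<I>. X v W)" by (rule sum.image_gen[OF fI, symmetric])
    finally show ?thesis .
  qed
  have "card V * (ln D / 8 * card \<I>) = (\<Sum>v\<in>V. ln D / 8 * card \<I>)" by simp
  also have "\<dots> \<le> (\<Sum>v\<in>V. \<Sum>W\<in>\<I>. X v W)" by (intro sum_mono lower)
  also have "\<dots> = (\<Sum>W\<in>\<I>. \<Sum>v\<in>V. X v W)" by (rule sum.swap)
  also have "\<dots> \<le> (\<Sum>W\<in>\<I>. 2 * D * card W)" by (intro sum_mono upper)
  finally have total: "card V * (ln D / 8 * card \<I>) \<le> (\<Sum>W\<in>\<I>. 2 * D * card W)" .
  have "\<exists>W\<in>\<I>. card V * (ln D / 8) \<le> 2 * D * card W"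
  proof (rule ccontr)
    assume "\<not> ?thesis"
    then have "(\<Sum>W\<in>\<I>. 2 * D * card W) < (\<Sum>W\<in>\<I>. card V * (ln D / 8))"
      using fI cI by (intro sum_strict_mono) (auto simp: not_le)
    then show False using total by (simp add: algebra_simps)
  qed
  then obtain W where "W \<in> \<I>" "card V * (ln D / 8) \<le> 2 * D * card W" by blast
  then show ?thesis using D by (auto simp: \<I>_def field_simps intro!: exI[of _ W])
qed

section \<open>The upper bound\<close>

lemma exists_ge_average:
  fixes a :: real
  assumes "finite \<Omega>" "\<Omega> \<noteq> {}" "a * card \<Omega> \<le> (\<Sum>\<omega>\<in>\<Omega>. F \<omega>)"
  shows "\<exists>\<omega>\<in>\<Omega>. a \<le> F \<omega>"
proof (rule ccontr)
  assume "\<not> ?thesis"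
  then have "(\<Sum>\<omega>\<in>\<Omega>. F \<omega>) < (\<Sum>\<omega>\<in>\<Omega>. a)" using assms by (intro sum_strict_mono) (auto simp: not_le)
  then show False using assms(3) by (simp add: mult.commute)
qed

text \<open>The zero set of a uniform \<open>f\<close> is a random subset of density
  \<open>1 / r\<close>; this bounds the expected number of sets \<open>U i\<close> inside it, scaled
  by the number of functions.\<close>

lemma sum_card_zero_part:
  assumes "finite V" "finite I" "\<And>i. i \<in> I \<Longrightarrow> U i \<subseteq> V \<and> card (U i) = m" "0 < (r::nat)"
  shows "(\<Sum>f\<in>V \<rightarrow>\<^sub>E {..<r}. real (card {i\<in>I. \<forall>v\<in>U i. f v = 0})) \<le> card I * (1 / r) ^ m * card (V \<rightarrow>\<^sub>E {..<r})"
proof -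
  let ?\<Omega> = "V \<rightarrow>\<^sub>E {..<r}"
  have fin: "finite ?\<Omega>" using assms by (intro finite_PiE) auto
  have "(\<Sum>f\<in>?\<Omega>. real (card {i\<in>I. \<forall>v\<in>U i. f v = 0})) = (\<Sum>f\<in>?\<Omega>. \<Sum>i\<in>I. of_bool (\<forall>v\<in>U i. f v = 0))"
    using assms(2) by (simp add: Int_def)
  also have "\<dots> = (\<Sum>i\<in>I. \<Sum>f\<in>?\<Omega>. of_bool (\<forall>v\<in>U i. f v = 0))" by (rule sum.swap)
  also have "\<dots> \<le> card I * ((1 / r) ^ m * card ?\<Omega>)"
  proof (rule sum_bounded_above)
    fix i assume i: "i \<in> I"
    have "pr ?\<Omega> (\<lambda>f. \<forall>v\<in>U i. f v = 0) \<le> (1 / r) ^ m"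
      using pr_PiE_zero[OF assms(1) _ assms(4), of "U i"] assms(3)[OF i] by simp
    moreover have "0 < card ?\<Omega>" using assms(1,4) by (simp add: card_PiE)
    ultimately show "(\<Sum>f\<in>?\<Omega>. of_bool (\<forall>v\<in>U i. f v = 0)) \<le> (1 / r) ^ m * card ?\<Omega>"
      unfolding pr_sum[OF fin] by (simp only: divide_le_eq of_nat_0_less_iff if_True)
  qed
  finally show ?thesis by (simp only: mult.assoc)
qed

text \<open>Each vertex is kept with probability \<open>1 / r\<close>; then one vertex of each
  surviving triangle and all vertices of degree above \<open>4 * D / r\<close> are deleted. Each of
  the two deletions costs on average at most a quarter of the expected \<open>card V / r\<close>
  vertices: the first by \<open>4 * \<kappa> * D \<le> r^2\<close>, the second because at most
  \<open>card V * D / r^2\<close> ordered adjacent pairs are expected.\<close>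

lemma sparse_triangle_free_subset:
  fixes E :: "'a \<Rightarrow> 'a \<Rightarrow> bool" and D \<kappa> :: real
  assumes V: "finite V" and D: "0 < D" and \<kappa>: "0 \<le> \<kappa>"
    and sym: "\<And>x y. E x y = E y x" and irr: "\<And>x. \<not> E x x"
    and deg: "\<And>v. v \<in> V \<Longrightarrow> card {w\<in>V. E v w} \<le> D"
    and \<T>: "finite \<T>" "\<And>T. T \<in> \<T> \<Longrightarrow> T \<subseteq> V \<and> card T = 3" "card \<T> \<le> card V * \<kappa> * D"
    and tri: "\<And>x y z. x \<in> V \<Longrightarrow> y \<in> V \<Longrightarrow> z \<in> V \<Longrightarrow> E x y \<Longrightarrow> E y z \<Longrightarrow> E x z \<Longrightarrow> {x, y, z} \<in> \<T>"
    and r: "0 < r" "4 * \<kappa> * D \<le> (real r)\<^sup>2"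
  shows "\<exists>W\<subseteq>V. card V / (2 * real r) \<le> card W \<and> (\<forall>v\<in>W. card {w\<in>W. E v w} \<le> 4 * D / r)
     \<and> (\<forall>x\<in>W. \<forall>y\<in>W. \<forall>z\<in>W. E x y \<longrightarrow> E y z \<longrightarrow> \<not> E x z)"
proof -
  let ?\<Omega> = "V \<rightarrow>\<^sub>E {..<r}"
  define \<Delta> where "\<Delta> = 4 * D / r"
  define P where "P = {(v, w). v \<in> V \<and> w \<in> V \<and> E v w}"
  define Z where "Z f = {v\<in>V. f v = (0::nat)}" for f
  define TZ where "TZ f = {T\<in>\<T>. \<forall>v\<in>T. f v = (0::nat)}" for f
  define PZ where "PZ f = {p\<in>P. f (fst p) = (0::nat) \<and> f (snd p) = 0}" for f
  have \<Delta>: "0 < \<Delta>" using D r by (simp add: \<Delta>_def)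
  have fin: "finite ?\<Omega>" using V by (intro finite_PiE) auto
  have c\<Omega>: "0 < card ?\<Omega>" using V r by (simp add: card_PiE)
  have Peq: "P = (SIGMA v:V. {w\<in>V. E v w})" by (auto simp: P_def)
  have fP: "finite P" unfolding Peq using V by auto
  have cP: "card P \<le> card V * D"
    unfolding Peq using V deg by (simp add: sum_bounded_above)
  have eZ: "(\<Sum>f\<in>?\<Omega>. real (card (Z f))) = card V / r * card ?\<Omega>"
  proof -
    have "(\<Sum>f\<in>?\<Omega>. real (card (Z f))) = (\<Sum>f\<in>?\<Omega>. \<Sum>v\<in>V. of_bool (f v = 0))"
      unfolding Z_def using V by (simp add: Int_def)
    also have "\<dots> = (\<Sum>v\<in>V. \<Sum>f\<in>?\<Omega>. of_bool (f v = 0))" by (rule sum.swap)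
    also have "\<dots> = (\<Sum>v\<in>V. 1 / r * card ?\<Omega>)"
    proof (rule sum.cong)
      fix v assume v: "v \<in> V"
      have "pr ?\<Omega> (\<lambda>f. f v = 0) = pr ?\<Omega> (\<lambda>f. \<forall>u\<in>V. f u \<in> (if u = v then {0} else UNIV))"
        unfolding pr_def using v by (intro arg_cong2[where f = "(/)"] arg_cong[where f = real] arg_cong[where f = card]) auto
      also have "\<dots> = (\<Prod>u\<in>V. card ((if u = v then {0} else UNIV) \<inter> {..<r}) / card {..<r})"
        using V r by (intro pr_PiE_prod) auto
      also have "\<dots> = (\<Prod>u\<in>V. if u = v then 1 / r else 1)" using r by (intro prod.cong) auto
      also have "\<dots> = 1 / r" using V v by (simp add: prod.delta)
      finally have "pr ?\<Omega> (\<lambda>f. f v = 0) = 1 / r" .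
      then show "(\<Sum>f\<in>?\<Omega>. of_bool (f v = 0)) = 1 / r * card ?\<Omega>"
        unfolding pr_sum[OF fin] using c\<Omega> by (simp only: divide_eq_eq of_nat_0_less_iff)
    qed simp
    finally show ?thesis by simp
  qed
  have eT: "(\<Sum>f\<in>?\<Omega>. real (card (TZ f))) \<le> card V / (4 * real r) * card ?\<Omega>"
  proof -
    have "(\<Sum>f\<in>?\<Omega>. real (card (TZ f))) \<le> card \<T> * (1 / r) ^ 3 * card ?\<Omega>"
      unfolding TZ_def by (rule sum_card_zero_part) (use V \<T> r in auto)
    also have "\<dots> \<le> card V / (4 * real r) * card ?\<Omega>"
    proof (rule mult_right_mono)
      have "card \<T> * (1 / real r) ^ 3 \<le> card V * \<kappa> * D * (1 / real r) ^ 3" using \<T>(3) by (rule mult_right_mono) simp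
      also have "\<dots> = card V / 4 * (4 * \<kappa> * D) * (1 / real r) ^ 3" by simp
      also have "\<dots> \<le> card V / 4 * (real r)\<^sup>2 * (1 / real r) ^ 3"
        by (intro mult_right_mono mult_left_mono r) auto
      also have "\<dots> = card V / (4 * real r)" using r by (simp add: power2_eq_square power3_eq_cube)
      finally show "card \<T> * (1 / real r) ^ 3 \<le> card V / (4 * real r)" .
    qed simp
    finally show ?thesis .
  qed
  have eP: "(\<Sum>f\<in>?\<Omega>. real (card (PZ f))) \<le> card V * D / (real r)\<^sup>2 * card ?\<Omega>"
  proof -
    have "(\<Sum>f\<in>?\<Omega>. real (card (PZ f))) = (\<Sum>f\<in>?\<Omega>. real (card {p\<in>P. \<forall>v\<in>{fst p, snd p}. f v = 0}))"
      unfolding PZ_def by simp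
    also have "\<dots> \<le> card P * (1 / r)\<^sup>2 * card ?\<Omega>"
    proof (rule sum_card_zero_part[OF V fP _ r(1)])
      fix p assume "p \<in> P"
      then have "fst p \<in> V" "snd p \<in> V" "fst p \<noteq> snd p" using irr by (auto simp: P_def)
      then show "{fst p, snd p} \<subseteq> V \<and> card {fst p, snd p} = 2" by simp
    qed
    also have "\<dots> \<le> card V * D * (1 / r)\<^sup>2 * card ?\<Omega>" using cP by (intro mult_right_mono) auto
    finally show ?thesis by (simp add: power_divide)
  qed
  have avg: "card V / (2 * real r) * card ?\<Omega> \<le> (\<Sum>f\<in>?\<Omega>. real (card (Z f)) - card (TZ f) - card (PZ f) / \<Delta>)"
  proof -
    have "(\<Sum>f\<in>?\<Omega>. real (card (PZ f))) / \<Delta> \<le> card V * D / (real r)\<^sup>2 * card ?\<Omega> / \<Delta>"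
      using eP \<Delta> by (intro divide_right_mono) auto
    also have "\<dots> = card V / (4 * real r) * card ?\<Omega>"
      using D r by (simp add: \<Delta>_def power2_eq_square)
    finally have "(\<Sum>f\<in>?\<Omega>. card (PZ f) / \<Delta>) \<le> card V / (4 * real r) * card ?\<Omega>"
      by (simp add: sum_divide_distrib)
    then show ?thesis using eZ eT by (simp add: sum_subtractf)
  qed
  then obtain f where f: "card V / (2 * real r) \<le> real (card (Z f)) - card (TZ f) - card (PZ f) / \<Delta>"
    using exists_ge_average[OF fin _ avg] c\<Omega> by (metis card.empty less_irrefl)
  define p where "p T = (SOME v. v \<in> T)" for T :: "'a set"
  have p: "p T \<in> T" if "T \<in> \<T>" for T
  proof -
    have "T \<noteq> {}" using \<T>(2)[OF that] by auto
    then show ?thesis by (simp add: p_def some_in_eq)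
  qed
  define B where "B = {v\<in>Z f. \<Delta> < card {w\<in>Z f. E v w}}"
  define W where "W = Z f - p ` TZ f - B"
  have fZ: "finite (Z f)" using V by (simp add: Z_def)
  have fT: "finite (TZ f)" using \<T>(1) by (simp add: TZ_def)
  have fB: "finite B" using fZ by (simp add: B_def)
  have "card B * \<Delta> \<le> card (PZ f)"
  proof -
    have "card B * \<Delta> = (\<Sum>v\<in>B. \<Delta>)" by simp
    also have "\<dots> \<le> (\<Sum>v\<in>B. real (card {w\<in>Z f. E v w}))" by (intro sum_mono) (auto simp: B_def)
    also have "\<dots> \<le> (\<Sum>v\<in>Z f. real (card {w\<in>Z f. E v w}))"
      using fZ by (intro sum_mono2) (auto simp: B_def)
    also have "\<dots> = card (SIGMA v:Z f. {w\<in>Z f. E v w})" using fZ by simp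
    also have "(SIGMA v:Z f. {w\<in>Z f. E v w}) = PZ f" by (auto simp: PZ_def Z_def P_def)
    finally show ?thesis .
  qed
  then have B: "card B \<le> card (PZ f) / \<Delta>" using \<Delta> by (simp add: le_divide_eq)
  have "card (Z f) \<le> card (W \<union> (p ` TZ f \<union> B))"
    using fZ fT fB by (intro card_mono) (auto simp: W_def)
  also have "\<dots> \<le> card W + (card (p ` TZ f) + card B)"
    by (intro order_trans[OF card_Un_le] add_mono card_Un_le order_refl)
  also have "\<dots> \<le> card W + (card (TZ f) + card B)" using fT by (simp add: card_image_le)
  finally have "card V / (2 * real r) \<le> card W" using B f by linarith
  moreover have "card {w\<in>W. E v w} \<le> 4 * D / r" if "v \<in> W" for v
  proof -
    have "card {w\<in>W. E v w} \<le> card {w\<in>Z f. E v w}" using fZ by (intro card_mono) (auto simp: W_def)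
    also have "\<dots> \<le> \<Delta>" using that by (auto simp: W_def B_def not_less)
    finally show ?thesis by (simp add: \<Delta>_def)
  qed
  moreover have "\<not> E x z" if "x \<in> W" "y \<in> W" "z \<in> W" "E x y" "E y z" for x y z
  proof
    assume "E x z"
    then have T: "{x, y, z} \<in> \<T>" using that tri by (auto simp: W_def Z_def)
    then have "{x, y, z} \<in> TZ f" using that by (auto simp: TZ_def W_def Z_def)
    then have "p {x, y, z} \<notin> W" by (auto simp: W_def)
    then show False using p[OF T] that by auto
  qed
  moreover have "W \<subseteq> V" by (auto simp: W_def Z_def)
  ultimately show ?thesis by blast
qed

section \<open>Two triangle-free graphs without a common independent set of size k\<close>

locale red_green =
  fixes V :: "'a set" and R G :: "'a \<Rightarrow> 'a \<Rightarrow> bool" and k :: nat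
  assumes V: "finite V"
    and R_sym: "R x y = R y x" and R_irr: "\<not> R x x"
    and G_sym: "G x y = G y x" and G_irr: "\<not> G x x"
    and R_tf: "x \<in> V \<Longrightarrow> y \<in> V \<Longrightarrow> z \<in> V \<Longrightarrow> R x y \<Longrightarrow> R y z \<Longrightarrow> R x z \<Longrightarrow> False"
    and G_tf: "x \<in> V \<Longrightarrow> y \<in> V \<Longrightarrow> z \<in> V \<Longrightarrow> G x y \<Longrightarrow> G y z \<Longrightarrow> G x z \<Longrightarrow> False"
    and no: "W \<subseteq> V \<Longrightarrow> free R W \<Longrightarrow> free G W \<Longrightarrow> card W < k"
begin

text \<open>The set spans no red edge because of \<open>u\<close> and no green edge because of
  \<open>v\<close>.\<close>

lemma red_green_degree:
  assumes u: "u \<in> V" and v: "v \<in> V"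
  shows "card {w\<in>V. R u w \<and> G v w} < k"
proof (rule no)
  show "free R {w\<in>V. R u w \<and> G v w}" using R_tf[of u] u by (auto simp: free_def)
  show "free G {w\<in>V. R u w \<and> G v w}" using G_tf[of v] v by (auto simp: free_def)
qed auto

lemma red_degree:
  assumes k: "2 \<le> k" and u: "u \<in> V"
  shows "card {w\<in>V. R u w} \<le> 16 * (real k)\<^sup>2 / ln k"
proof -
  let ?U = "{w\<in>V. R u w}"
  have "\<exists>W\<subseteq>?U. free G W \<and> card ?U * ln k / (16 * real k) \<le> card W"
  proof (rule independent_set_triangle_free)
    fix v assume v: "v \<in> ?U"
    have "{w\<in>?U. G v w} = {w\<in>V. R u w \<and> G v w}" by auto
    then show "real (card {w\<in>?U. G v w}) \<le> real k" using red_green_degree[of u v] u v by simp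
  qed (use V k G_sym G_irr G_tf in auto)
  then obtain W where W: "W \<subseteq> ?U" "free G W" "card ?U * ln k / (16 * real k) \<le> card W" by blast
  have "free R W" using W(1) R_tf[of u] u by (auto simp: free_def)
  then have "card W < k" using no W by auto
  then have "card ?U * ln k / (16 * real k) \<le> k" using W(3) by linarith
  moreover have "0 < ln (real k)" using k by simp
  ultimately show ?thesis using k by (simp add: field_simps power2_eq_square)
qed

text \<open>A triangle of the union is not monochromatic, so two edges of one colour meet at a
  vertex and the third has the other colour. These are the ones with two red edges at
  \<open>u\<close>; exchanging the colours gives the rest.\<close>

definition fans :: "('a \<times> 'a \<times> 'a) set" where
  "fans = (SIGMA u:V. SIGMA v:{v\<in>V. R u v}. {w\<in>V. R u w \<and> G v w})"

lemma card_fans: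
  assumes k: "2 \<le> k"
  shows "finite fans" "card fans \<le> card V * (16 * (real k)\<^sup>2 / ln k * k)"
proof -
  show "finite fans" unfolding fans_def using V by auto
  have "real (card fans) = (\<Sum>u\<in>V. \<Sum>v\<in>{v\<in>V. R u v}. real (card {w\<in>V. R u w \<and> G v w}))"
    unfolding fans_def using V by (simp add: card_SigmaI)
  also have "\<dots> \<le> card V * (16 * (real k)\<^sup>2 / ln k * k)"
  proof (rule sum_bounded_above)
    fix u assume u: "u \<in> V"
    have "(\<Sum>v\<in>{v\<in>V. R u v}. real (card {w\<in>V. R u w \<and> G v w})) \<le> card {v\<in>V. R u v} * real k"
      using red_green_degree u by (intro sum_bounded_above) (auto simp: less_imp_le)
    also have "\<dots> \<le> 16 * (real k)\<^sup>2 / ln k * k" using red_degree[OF k u] by (rule mult_right_mono) simp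
    finally show "(\<Sum>v\<in>{v\<in>V. R u v}. real (card {w\<in>V. R u w \<and> G v w})) \<le> 16 * (real k)\<^sup>2 / ln k * k" .
  qed
  finally show "card fans \<le> card V * (16 * (real k)\<^sup>2 / ln k * k)" .
qed

end

lemma red_green_swap:
  assumes "red_green V R G k" shows "red_green V G R k"
proof -
  interpret red_green V R G k by fact
  show ?thesis by unfold_locales (fact V G_sym G_irr R_sym R_irr G_tf R_tf | rule no, assumption+)+
qed

text \<open>Alon's bound for the sparse subset is
  \<open>card V / (2 * r) * ln (4 * D / r) / (16 * (4 * D / r))\<close>, where \<open>r\<close>
  cancels outside the logarithm. So \<open>r\<close> may be as large as the destruction of all
  triangles requires, and \<open>big\<close> keeps the logarithm nonnegative.\<close>

lemma (in red_green) card_bound: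
  assumes k: "2 \<le> k" and r: "0 < r" "128 * real k ^ 3 / ln k \<le> (real r)\<^sup>2"
    and big: "r * ln k \<le> 128 * (real k)\<^sup>2"
  shows "card V * ln (128 * (real k)\<^sup>2 / (r * ln k)) * ln k < 4096 * real k ^ 3"
proof -
  interpret swap: red_green V G R k by (rule red_green_swap) (rule red_green_axioms)
  define E where "E x y \<longleftrightarrow> R x y \<or> G x y" for x y
  define D where "D = 32 * (real k)\<^sup>2 / ln k"
  define \<T> where "\<T> = (\<lambda>(u, v, w). {u, v, w}) ` (fans \<union> swap.fans)"
  have lk: "0 < ln (real k)" using k by simp
  have D0: "0 < D" using k lk by (simp add: D_def)
  have fin: "finite (fans \<union> swap.fans)" using card_fans swap.card_fans k by simp
  have deg: "card {w\<in>V. E v w} \<le> D" if "v \<in> V" for v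
  proof -
    have "{w\<in>V. E v w} = {w\<in>V. R v w} \<union> {w\<in>V. G v w}" by (auto simp: E_def)
    then have "card {w\<in>V. E v w} \<le> card {w\<in>V. R v w} + card {w\<in>V. G v w}" by (simp add: card_Un_le)
    then show ?thesis using red_degree[OF k that] swap.red_degree[OF k that] by (simp add: D_def)
  qed
  have "card \<T> \<le> card (fans \<union> swap.fans)" unfolding \<T>_def by (rule card_image_le[OF fin])
  also have "\<dots> \<le> card fans + card swap.fans" by (rule card_Un_le)
  finally have c\<T>: "card \<T> \<le> card V * k * D"
    using card_fans(2)[OF k] swap.card_fans(2)[OF k] by (simp add: D_def algebra_simps)
  have "\<exists>W\<subseteq>V. card V / (2 * real r) \<le> card W \<and> (\<forall>v\<in>W. card {w\<in>W. E v w} \<le> 4 * D / r)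
     \<and> (\<forall>x\<in>W. \<forall>y\<in>W. \<forall>z\<in>W. E x y \<longrightarrow> E y z \<longrightarrow> \<not> E x z)"
  proof (rule sparse_triangle_free_subset)
    show "finite \<T>" unfolding \<T>_def using fin by simp
    show "E x y = E y x" "\<not> E x x" for x y using R_sym G_sym R_irr G_irr by (auto simp: E_def)
    show "T \<subseteq> V \<and> card T = 3" if "T \<in> \<T>" for T
    proof -
      obtain e where e: "e \<in> fans \<union> swap.fans" "T = (case e of (u, v, w) \<Rightarrow> {u, v, w})"
        using \<open>T \<in> \<T>\<close> unfolding \<T>_def by blast
      obtain u v w where "e = (u, v, w)" by (cases e)
      then have T: "T = {u, v, w}" "(u, v, w) \<in> fans \<union> swap.fans" using e by simp_all
      then have "u \<noteq> v" "u \<noteq> w" "v \<noteq> w" "u \<in> V" "v \<in> V" "w \<in> V"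
        using R_irr G_irr by (auto simp: fans_def swap.fans_def)
      then show ?thesis using T by simp
    qed
    show "{x, y, z} \<in> \<T>" if V: "x \<in> V" "y \<in> V" "z \<in> V" and E: "E x y" "E y z" "E x z" for x y z
    proof -
      have in\<T>: "{u, v, w} \<in> \<T>" if "u \<in> V" "v \<in> V" "w \<in> V" "R u v \<and> R u w \<and> G v w \<or> G u v \<and> G u w \<and> R v w" for u v w
        using that unfolding \<T>_def fans_def swap.fans_def by (intro image_eqI[of _ _ "(u, v, w)"]) auto
      have perm: "{x, y, z} = {y, x, z}" "{x, y, z} = {z, x, y}" by auto
      have "\<not> (R x y \<and> R y z \<and> R x z)" "\<not> (G x y \<and> G y z \<and> G x z)" using V R_tf G_tf by blast+
      then have "(R x y \<and> R x z \<and> G y z \<or> G x y \<and> G x z \<and> R y z)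
         \<or> (R y x \<and> R y z \<and> G x z \<or> G y x \<and> G y z \<and> R x z) \<or> (R z x \<and> R z y \<and> G x y \<or> G z x \<and> G z y \<and> R x y)"
        using E unfolding E_def R_sym[of y x] G_sym[of y x] R_sym[of z x] G_sym[of z x] R_sym[of z y] G_sym[of z y]
        by blast
      then show ?thesis using in\<T>[of x y z] in\<T>[of y x z] in\<T>[of z x y] V perm by metis
    qed
    show "4 * real k * D \<le> (real r)\<^sup>2" using r(2) by (simp add: D_def power2_eq_square power3_eq_cube)
  qed (use V D0 deg c\<T> r in auto)
  then obtain W where W: "W \<subseteq> V" "card V / (2 * real r) \<le> card W" "\<And>v. v \<in> W \<Longrightarrow> card {w\<in>W. E v w} \<le> 4 * D / r"
      "\<And>x y z. x \<in> W \<Longrightarrow> y \<in> W \<Longrightarrow> z \<in> W \<Longrightarrow> E x y \<Longrightarrow> E y z \<Longrightarrow> \<not> E x z"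
    by blast
  have \<Delta>: "4 * D / r = 128 * (real k)\<^sup>2 / (r * ln k)" by (simp add: D_def)
  have \<Delta>1: "1 \<le> 4 * D / r" unfolding \<Delta> using big r lk by (simp add: le_divide_eq)
  have "\<exists>I\<subseteq>W. free E I \<and> card W * ln (4 * D / r) / (16 * (4 * D / r)) \<le> card I"
  proof (rule independent_set_triangle_free[OF _ \<Delta>1])
    show "finite W" using W(1) V by (rule finite_subset)
    show "E x y = E y x" "\<not> E x x" for x y using R_sym G_sym R_irr G_irr by (auto simp: E_def)
    show "x \<in> W \<Longrightarrow> y \<in> W \<Longrightarrow> z \<in> W \<Longrightarrow> E x y \<Longrightarrow> E y z \<Longrightarrow> E x z \<Longrightarrow> False" for x y z
      using W(4) by blast
  qed (use W(3) in auto)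
  then obtain I where I: "I \<subseteq> W" "free E I" "card W * ln (4 * D / r) / (16 * (4 * D / r)) \<le> card I" by blast
  have "card I < k" using no[of I] I W(1) by (auto simp: free_def E_def)
  then have "card W * ln (4 * D / r) / (16 * (4 * D / r)) < k" using I(3) by linarith
  moreover have "card V / (2 * real r) * ln (4 * D / r) / (16 * (4 * D / r)) \<le> card W * ln (4 * D / r) / (16 * (4 * D / r))"
    using W(2) \<Delta>1 by (intro divide_right_mono mult_right_mono) auto
  ultimately have "card V / (2 * real r) * ln (4 * D / r) / (16 * (4 * D / r)) < k" by linarith
  moreover have "card V / (2 * real r) * ln (4 * D / r) / (16 * (4 * D / r)) = card V * ln (4 * D / r) / (128 * D)"
    using r by simp
  ultimately have "card V * ln (4 * D / r) / (128 * D) < k" by (simp only:)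
  then have "card V * ln (4 * D / r) < k * (128 * D)" using D0 by (simp add: divide_less_eq)
  also have "k * (128 * D) = 4096 * real k ^ 3 / ln k" by (simp add: D_def power2_eq_square power3_eq_cube)
  finally show ?thesis unfolding \<Delta> using lk by (simp add: less_divide_eq)
qed

lemma ramsey_number_le:
  assumes k: "2 \<le> k" and r: "0 < r" "128 * real k ^ 3 / ln k \<le> (real r)\<^sup>2"
    and big: "r * ln k \<le> 128 * (real k)\<^sup>2"
    and n: "4096 * real k ^ 3 \<le> n * ln (128 * (real k)\<^sup>2 / (r * ln k)) * ln k"
  shows "ramsey_number [3, 3, k] \<le> n"
  unfolding ramsey_number_def
proof (rule Least_le, rule ccontr)
  assume "\<not> partn_lst {..<n} [3, 3, k] 2"
  then obtain f where f: "f \<in> nsets {..<n} 2 \<rightarrow> {..<length [3, 3, k]}"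
    and nf: "\<And>i. i < length [3, 3, k] \<Longrightarrow> \<not> monochromatic {..<n} ([3, 3, k] ! i) 2 f i"
    unfolding partn_lst_def by blast
  have n3: "\<not> (\<forall>e\<in>nsets H 2. f e = i)" if "H \<in> nsets {..<n} 3" "i < 2" for H and i :: nat
    using nf[of i] that by (auto simp: monochromatic_def less_2_cases_iff image_subset_iff)
  have nk: "\<not> (\<forall>e\<in>nsets H 2. f e = 2)" if "H \<in> nsets {..<n} k" for H
    using nf[of 2] that by (auto simp: monochromatic_def image_subset_iff)
  define C where "C i x y \<longleftrightarrow> x \<noteq> y \<and> f {x, y} = i" for i :: nat and x y
  have tf: False if "x < n" "y < n" "z < n" "C i x y" "C i y z" "C i x z" "i < 2" for x y z i
  proof -
    have "x \<noteq> y" "y \<noteq> z" "x \<noteq> z" using that by (auto simp: C_def)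
    then have "{x, y, z} \<in> nsets {..<n} 3" using that by (simp add: nsets_def)
    moreover have "\<forall>e\<in>nsets {x, y, z} 2. f e = i"
      using that by (auto simp: nsets_2_eq C_def insert_commute)
    ultimately show False using n3 that by blast
  qed
  interpret red_green "{..<n}" "C 0" "C 1" k
  proof
    show "card W < k" if W: "W \<subseteq> {..<n}" "free (C 0) W" "free (C 1) W" for W
    proof (rule ccontr)
      assume "\<not> card W < k"
      then obtain H where H: "H \<subseteq> W" "card H = k" by (meson not_less obtain_subset_with_card_n)
      have "finite H" using H W by (meson finite_lessThan finite_subset)
      then have "H \<in> nsets {..<n} k" using H W by (auto simp: nsets_def)
      moreover have "f e = 2" if "e \<in> nsets H 2" for e
      proof -
        obtain x y where xy: "e = {x, y}" "x \<in> H" "y \<in> H" "x \<noteq> y" using \<open>e \<in> nsets H 2\<close> by (rule nsets2_E)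
        then have "x \<in> W" "y \<in> W" using H by auto
        then have "\<not> C 0 x y" "\<not> C 1 x y" using W(2,3) by (auto simp only: free_def)
        then have "f e \<noteq> 0" "f e \<noteq> 1" using xy by (auto simp: C_def)
        moreover have "e \<in> nsets {..<n} 2" using xy H W by auto
        ultimately show "f e = 2" using f by (auto simp: Pi_def)
      qed
      ultimately show False using nk by blast
    qed
    show "x \<in> {..<n} \<Longrightarrow> y \<in> {..<n} \<Longrightarrow> z \<in> {..<n} \<Longrightarrow> C 0 x y \<Longrightarrow> C 0 y z \<Longrightarrow> C 0 x z \<Longrightarrow> False" for x y z
      using tf[of x y z 0] by simp
    show "x \<in> {..<n} \<Longrightarrow> y \<in> {..<n} \<Longrightarrow> z \<in> {..<n} \<Longrightarrow> C 1 x y \<Longrightarrow> C 1 y z \<Longrightarrow> C 1 x z \<Longrightarrow> False" for x y z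
      using tf[of x y z 1] by simp
  qed (auto simp: C_def insert_commute)
  show False using card_bound[OF k r big] n by simp
qed

lemma ramsey_number_upper:
  "\<forall>\<^sub>F k :: nat in sequentially. real (ramsey_number [3, 3, k]) \<le> 16385 * real k ^ 3 / (ln (real k))\<^sup>2"
proof -
  \<comment> \<open>With \<open>r\<close> of order sqrt (k^3 / ln k), the degree bound
    \<open>128 * k^2 / (r * ln k)\<close> is sqrt k up to logarithms; the last clause records only
    that it is at least k^(1/4).\<close>
  define Q :: "real \<Rightarrow> bool" where "Q x \<longleftrightarrow> 2 \<le> x \<and> 1 \<le> ln x \<and> 1 \<le> x ^ 3 / (ln x)\<^sup>2
    \<and> 13 * sqrt (x ^ 3 / ln x) * ln x * x powr (1 / 4) \<le> 128 * x\<^sup>2" for x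
  have "\<forall>\<^sub>F x in at_top. Q x" unfolding Q_def by (intro eventually_conj; real_asymp)
  then have "\<forall>\<^sub>F k :: nat in sequentially. Q (real k)"
    using filterlim_real_sequentially by (rule eventually_compose_filterlim)
  then show ?thesis
  proof (rule eventually_mono)
    fix k :: nat
    assume "Q (real k)"
    then have a: "2 \<le> real k \<and> 1 \<le> ln (real k) \<and> 1 \<le> real k ^ 3 / (ln (real k))\<^sup>2
      \<and> 13 * sqrt (real k ^ 3 / ln (real k)) * ln (real k) * real k powr (1 / 4) \<le> 128 * (real k)\<^sup>2"
      by (simp only: Q_def)
    define z where "z = real k ^ 3 / ln k"
    define r where "r = nat \<lceil>12 * sqrt z\<rceil>"
    \<comment> \<open>The logarithm of the degree bound is at least \<open>ln k / 4\<close>, and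
      \<open>16384 = 4 * 4096\<close>; rounding up turns this into 16385.\<close>
    define n where "n = nat \<lceil>16384 * (real k ^ 3 / (ln k)\<^sup>2)\<rceil>"
    have k: "2 \<le> k" and l: "1 \<le> ln (real k)" using a by auto
    have "real k ^ 3 / (ln k)\<^sup>2 \<le> z" unfolding z_def power2_eq_square
      using l k by (intro divide_left_mono) auto
    then have "1 \<le> z" using a by linarith
    then have s0: "1 \<le> sqrt z" by simp
    have rs: "12 * sqrt z \<le> r" and r: "r \<le> 13 * sqrt z"
      unfolding r_def using s0 by linarith+
    have r0: "0 < r" using rs s0 by (cases r) auto
    have "r * ln k * real k powr (1 / 4) \<le> 13 * sqrt z * ln k * real k powr (1 / 4)"
      using r l by (intro mult_right_mono) auto
    then have rk: "r * ln k * real k powr (1 / 4) \<le> 128 * (real k)\<^sup>2" using a unfolding z_def by linarith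
    have p: "1 \<le> real k powr (1 / 4)" using k by (simp add: ge_one_powr_ge_zero)
    have nn: "16384 * (real k ^ 3 / (ln k)\<^sup>2) \<le> n" "n \<le> 16384 * (real k ^ 3 / (ln k)\<^sup>2) + 1"
    proof -
      have "0 \<le> 16384 * (real k ^ 3 / (ln k)\<^sup>2)" by simp
      then show "16384 * (real k ^ 3 / (ln k)\<^sup>2) \<le> n" "n \<le> 16384 * (real k ^ 3 / (ln k)\<^sup>2) + 1"
        unfolding n_def by linarith+
    qed
    have "ramsey_number [3, 3, k] \<le> n"
    proof (rule ramsey_number_le[OF k r0])
      have "(12 * sqrt z)\<^sup>2 \<le> (real r)\<^sup>2" using rs s0 by (intro power_mono) auto
      then have "144 * z \<le> (real r)\<^sup>2" using \<open>1 \<le> z\<close> by (simp add: power_mult_distrib)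
      then have "128 * z \<le> (real r)\<^sup>2" using \<open>1 \<le> z\<close> by linarith
      then show "128 * real k ^ 3 / ln k \<le> (real r)\<^sup>2" by (simp add: z_def)
      have "r * ln k * 1 \<le> r * ln k * real k powr (1 / 4)" using p l by (intro mult_left_mono) auto
      then show "r * ln k \<le> 128 * (real k)\<^sup>2" using rk by linarith
      have "real k powr (1 / 4) \<le> 128 * (real k)\<^sup>2 / (r * ln k)"
        using rk r0 l by (simp add: le_divide_eq mult.commute)
      then have "ln (real k powr (1 / 4)) \<le> ln (128 * (real k)\<^sup>2 / (r * ln k))"
        using k by (intro ln_mono) auto
      then have L: "ln k / 4 \<le> ln (128 * (real k)\<^sup>2 / (r * ln k))" using k by (simp add: ln_powr)
      have "4096 * real k ^ 3 = 16384 * (real k ^ 3 / (ln k)\<^sup>2) * (ln k / 4) * ln k"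
        using l by (simp add: power2_eq_square)
      also have "\<dots> \<le> n * ln (128 * (real k)\<^sup>2 / (r * ln k)) * ln k"
        using nn(1) L l by (intro mult_right_mono mult_mono) auto
      finally show "4096 * real k ^ 3 \<le> n * ln (128 * (real k)\<^sup>2 / (r * ln k)) * ln k" .
    qed
    then show "real (ramsey_number [3, 3, k]) \<le> 16385 * real k ^ 3 / (ln (real k))\<^sup>2"
      using nn(2) a by simp
  qed
qed

theorem theorem1p1:
  shows "\<exists>c C :: real. 0 < c \<and> c < C \<and>
    (\<forall>\<^sub>F k :: nat in sequentially.
      c * real k ^ 3 / (ln (real k))\<^sup>2 \<le> real (ramsey_number [3, 3, k]) \<and>
      real (ramsey_number [3, 3, k]) \<le> C * real k ^ 3 / (ln (real k))\<^sup>2)"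
proof (intro exI conjI)
  show "\<forall>\<^sub>F k :: nat in sequentially.
      1 / 10 ^ 32 * real k ^ 3 / (ln (real k))\<^sup>2 \<le> real (ramsey_number [3, 3, k]) \<and>
      real (ramsey_number [3, 3, k]) \<le> 16385 * real k ^ 3 / (ln (real k))\<^sup>2"
    using ramsey_number_lower ramsey_number_upper by (rule eventually_conj)
qed simp_all

end
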